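(* The Feichtinger algebra $S_0(G)$ on an infinite compact abelian group $G$ is not approximately amenable.
   Context: For a compact abelian group $G$ with dual group $\hat G$, the Feichtinger (Segal) algebra is $S_0(G)=\{f=\sum_{\gamma\in\hat G}c_\gamma\chi_\gamma:\ \|f\|=\sum_{\gamma}|c_\gamma|<\infty\}$, where $\chi_\gamma$ is the character of $G$ associated with $\gamma\in\hat G$; its product is convolution on $G$ with respect to normalized Haar measure. A Banach algebra $A$ is approximately amenable if for every Banach $A$-bimodule $X$ and every bounded derivation $D:A\to X^*$ (dual bimodule) there is a net $(D_\alpha)$ of inner derivations $A\to X^*$ with $D_\alpha(a)\to D(a)$ in norm for all $a\in A$. *)

theory Defs
  imports "HOL-Probability.Probability"
begin

section \<open>Complex Banach spaces, Banach algebras and Banach bimodules\<close>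

text \<open>
  Approximate amenability quantifies over all Banach bimodules of an algebra.  This quantifier
  stands inside a formula, so Banach spaces are structures on a carrier set and not instances of
  a type class.
\<close>

record 'a cnormed =
  carrier :: "'a set"
  vadd :: "'a \<Rightarrow> 'a \<Rightarrow> 'a"
  vzero :: "'a"
  vscale :: "complex \<Rightarrow> 'a \<Rightarrow> 'a"
  vnorm :: "'a \<Rightarrow> real"

record 'a calgebra = "'a cnormed" +
  vmult :: "'a \<Rightarrow> 'a \<Rightarrow> 'a"

record ('a, 'x) cbimodule = "'x cnormed" +
  lact :: "'a \<Rightarrow> 'x \<Rightarrow> 'x"
  ract :: "'x \<Rightarrow> 'a \<Rightarrow> 'x"

definition vminus :: "('a, 'm) cnormed_scheme \<Rightarrow> 'a \<Rightarrow> 'a \<Rightarrow> 'a" where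
  "vminus E x y = vadd E x (vscale E (- 1) y)"

locale complex_banach_space =
  fixes E :: "('a, 'm) cnormed_scheme"
  assumes add_closed: "\<lbrakk>x \<in> carrier E; y \<in> carrier E\<rbrakk> \<Longrightarrow> vadd E x y \<in> carrier E"
    and zero_closed: "vzero E \<in> carrier E"
    and scale_closed: "x \<in> carrier E \<Longrightarrow> vscale E r x \<in> carrier E"
    and add_assoc: "\<lbrakk>x \<in> carrier E; y \<in> carrier E; z \<in> carrier E\<rbrakk>
          \<Longrightarrow> vadd E (vadd E x y) z = vadd E x (vadd E y z)"
    and add_commute: "\<lbrakk>x \<in> carrier E; y \<in> carrier E\<rbrakk> \<Longrightarrow> vadd E x y = vadd E y x"
    and add_zero: "x \<in> carrier E \<Longrightarrow> vadd E x (vzero E) = x"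
    and add_inverse: "x \<in> carrier E \<Longrightarrow> vadd E x (vscale E (- 1) x) = vzero E"
    and scale_add_right: "\<lbrakk>x \<in> carrier E; y \<in> carrier E\<rbrakk>
          \<Longrightarrow> vscale E r (vadd E x y) = vadd E (vscale E r x) (vscale E r y)"
    and scale_add_left: "x \<in> carrier E
          \<Longrightarrow> vscale E (r + s) x = vadd E (vscale E r x) (vscale E s x)"
    and scale_scale: "x \<in> carrier E \<Longrightarrow> vscale E r (vscale E s x) = vscale E (r * s) x"
    and scale_one: "x \<in> carrier E \<Longrightarrow> vscale E 1 x = x"
    and norm_nonneg: "x \<in> carrier E \<Longrightarrow> 0 \<le> vnorm E x"
    and norm_eq_zero: "x \<in> carrier E \<Longrightarrow> vnorm E x = 0 \<longleftrightarrow> x = vzero E"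
    and norm_scale: "x \<in> carrier E \<Longrightarrow> vnorm E (vscale E r x) = cmod r * vnorm E x"
    and norm_triangle: "\<lbrakk>x \<in> carrier E; y \<in> carrier E\<rbrakk>
          \<Longrightarrow> vnorm E (vadd E x y) \<le> vnorm E x + vnorm E y"
    and complete: "\<lbrakk>\<And>n. \<sigma> n \<in> carrier E;
            \<And>e. 0 < e \<Longrightarrow> \<exists>N. \<forall>m\<ge>N. \<forall>n\<ge>N. vnorm E (vminus E (\<sigma> m) (\<sigma> n)) < e\<rbrakk>
          \<Longrightarrow> \<exists>l\<in>carrier E. (\<lambda>n. vnorm E (vminus E (\<sigma> n) l)) \<longlonglongrightarrow> 0"

definition linear_map ::
  "('a, 'm) cnormed_scheme \<Rightarrow> ('b, 'n) cnormed_scheme \<Rightarrow> ('a \<Rightarrow> 'b) \<Rightarrow> bool" where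
  "linear_map E F T \<longleftrightarrow>
     (\<forall>x\<in>carrier E. T x \<in> carrier F) \<and>
     (\<forall>x\<in>carrier E. \<forall>y\<in>carrier E. T (vadd E x y) = vadd F (T x) (T y)) \<and>
     (\<forall>r. \<forall>x\<in>carrier E. T (vscale E r x) = vscale F r (T x))"

definition bounded_linear_map ::
  "('a, 'm) cnormed_scheme \<Rightarrow> ('b, 'n) cnormed_scheme \<Rightarrow> ('a \<Rightarrow> 'b) \<Rightarrow> bool" where
  "bounded_linear_map E F T \<longleftrightarrow>
     linear_map E F T \<and> (\<exists>K. \<forall>x\<in>carrier E. vnorm F (T x) \<le> K * vnorm E x)"

locale complex_banach_algebra = complex_banach_space A for A :: "('a, 'm) calgebra_scheme" +
  assumes mult_linear_right: "a \<in> carrier A \<Longrightarrow> linear_map A A (\<lambda>b. vmult A a b)"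
    and mult_linear_left: "b \<in> carrier A \<Longrightarrow> linear_map A A (\<lambda>a. vmult A a b)"
    and mult_assoc: "\<lbrakk>a \<in> carrier A; b \<in> carrier A; c \<in> carrier A\<rbrakk>
          \<Longrightarrow> vmult A (vmult A a b) c = vmult A a (vmult A b c)"
    and norm_mult: "\<lbrakk>a \<in> carrier A; b \<in> carrier A\<rbrakk>
          \<Longrightarrow> vnorm A (vmult A a b) \<le> vnorm A a * vnorm A b"

locale banach_bimodule = complex_banach_space X
  for A :: "('a, 'm) calgebra_scheme" and X :: "('a, 'x, 'n) cbimodule_scheme" +
  assumes lact_linear_right: "a \<in> carrier A \<Longrightarrow> linear_map X X (\<lambda>x. lact X a x)"
    and lact_linear_left: "x \<in> carrier X \<Longrightarrow> linear_map A X (\<lambda>a. lact X a x)"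
    and ract_linear_left: "a \<in> carrier A \<Longrightarrow> linear_map X X (\<lambda>x. ract X x a)"
    and ract_linear_right: "x \<in> carrier X \<Longrightarrow> linear_map A X (\<lambda>a. ract X x a)"
    and lact_mult: "\<lbrakk>a \<in> carrier A; b \<in> carrier A; x \<in> carrier X\<rbrakk>
          \<Longrightarrow> lact X (vmult A a b) x = lact X a (lact X b x)"
    and ract_mult: "\<lbrakk>a \<in> carrier A; b \<in> carrier A; x \<in> carrier X\<rbrakk>
          \<Longrightarrow> ract X x (vmult A a b) = ract X (ract X x a) b"
    and lact_ract: "\<lbrakk>a \<in> carrier A; b \<in> carrier A; x \<in> carrier X\<rbrakk>
          \<Longrightarrow> ract X (lact X a x) b = lact X a (ract X x b)"
    and act_bounded: "\<exists>K. \<forall>a\<in>carrier A. \<forall>x\<in>carrier X.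
          vnorm X (lact X a x) \<le> K * vnorm A a * vnorm X x \<and>
          vnorm X (ract X x a) \<le> K * vnorm A a * vnorm X x"

text \<open>
  The dual bimodule, with $(a \cdot \phi)(x) = \phi(x \cdot a)$ and
  $(\phi \cdot a)(x) = \phi(a \cdot x)$.  Functionals are taken to be \<open>0\<close> outside the carrier, so
  that equality of functionals is equality of functions.
\<close>

definition dual_bimodule ::
  "('a, 'x, 'n) cbimodule_scheme \<Rightarrow> ('a, 'x \<Rightarrow> complex) cbimodule" where
  "dual_bimodule X =
    \<lparr>carrier = {\<phi>. (\<forall>x. x \<notin> carrier X \<longrightarrow> \<phi> x = 0) \<and>
       (\<forall>x\<in>carrier X. \<forall>y\<in>carrier X. \<phi> (vadd X x y) = \<phi> x + \<phi> y) \<and>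
       (\<forall>r. \<forall>x\<in>carrier X. \<phi> (vscale X r x) = r * \<phi> x) \<and>
       (\<exists>K. \<forall>x\<in>carrier X. cmod (\<phi> x) \<le> K * vnorm X x)},
     vadd = (\<lambda>\<phi> \<psi> x. \<phi> x + \<psi> x),
     vzero = (\<lambda>x. 0),
     vscale = (\<lambda>r \<phi> x. r * \<phi> x),
     vnorm = (\<lambda>\<phi>. SUP x\<in>{x \<in> carrier X. vnorm X x \<le> 1}. cmod (\<phi> x)),
     lact = (\<lambda>a \<phi> x. if x \<in> carrier X then \<phi> (ract X x a) else 0),
     ract = (\<lambda>\<phi> a x. if x \<in> carrier X then \<phi> (lact X a x) else 0)\<rparr>"


section \<open>Derivations and approximate amenability\<close>

definition bounded_derivation ::
  "('a, 'm) calgebra_scheme \<Rightarrow> ('a, 'x, 'n) cbimodule_scheme \<Rightarrow> ('a \<Rightarrow> 'x) \<Rightarrow> bool" where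
  "bounded_derivation A E D \<longleftrightarrow>
     bounded_linear_map A E D \<and>
     (\<forall>a\<in>carrier A. \<forall>b\<in>carrier A.
        D (vmult A a b) = vadd E (lact E a (D b)) (ract E (D a) b))"

definition inner_derivation ::
  "('a, 'm) calgebra_scheme \<Rightarrow> ('a, 'x, 'n) cbimodule_scheme \<Rightarrow> ('a \<Rightarrow> 'x) \<Rightarrow> bool" where
  "inner_derivation A E D \<longleftrightarrow>
     (\<exists>e\<in>carrier E. \<forall>a\<in>carrier A. D a = vminus E (lact E a e) (ract E e a))"

text \<open>
  A net of inner derivations is given by its filter of tails: a proper filter on the maps
  \<open>A \<rightarrow> E\<close> that contains the set of inner derivations.  Conversely each such filter is
  the filter of tails of a net.
\<close>

definition approximately_inner ::
  "('a, 'm) calgebra_scheme \<Rightarrow> ('a, 'x, 'n) cbimodule_scheme \<Rightarrow> ('a \<Rightarrow> 'x) \<Rightarrow> bool" where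
  "approximately_inner A E D \<longleftrightarrow>
     (\<exists>F. F \<noteq> bot \<and> (\<forall>\<^sub>F D' in F. inner_derivation A E D') \<and>
        (\<forall>a\<in>carrier A. ((\<lambda>D'. vnorm E (vminus E (D' a) (D a))) \<longlongrightarrow> 0) F))"

definition approximately_amenable_in ::
  "'x itself \<Rightarrow> ('a, 'm) calgebra_scheme \<Rightarrow> bool" where
  "approximately_amenable_in _ A \<longleftrightarrow>
     (\<forall>X :: ('a, 'x) cbimodule. banach_bimodule A X \<longrightarrow>
        (\<forall>D. bounded_derivation A (dual_bimodule X) D \<longrightarrow>
           approximately_inner A (dual_bimodule X) D))"

text \<open>
  The bimodules in \<^const>\<open>approximately_amenable_in\<close> are those whose points belong to the type
  \<^typ>\<open>'x\<close>.  A larger type gives a stronger condition (\<open>approximately_amenable_in_mono\<close> below),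
  and \<^typ>\<open>'a \<times> 'a \<Rightarrow> complex\<close> is large enough: for a Banach algebra with points in
  \<^typ>\<open>'a\<close> the condition then holds for all Banach bimodules.  Indeed, let \<open>D : A \<rightarrow> X*\<close> be a bounded derivation, and fix
  a finite subset of \<open>A\<close> and a tolerance.  If inner derivations given by \<open>\<phi> \<in> Y*\<close> approximate
  the restriction of \<open>D\<close> to each countably generated closed submodule \<open>Y\<close>, then the norms
  of the \<open>\<phi>\<close> can be chosen bounded uniformly in \<open>Y\<close>, because countably many \<open>Y\<close> lie in one of
  the same kind; extend the \<open>\<phi>\<close> to \<open>X\<close> and take a weak* limit.  Each \<open>Y\<close> has at most
  as many points as there are sequences in \<open>A\<close> (if \<open>A\<close> is nonzero).
\<close>

definition approximately_amenable :: "('a, 'm) calgebra_scheme \<Rightarrow> bool" where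
  "approximately_amenable A \<longleftrightarrow> approximately_amenable_in TYPE('a \<times> 'a \<Rightarrow> complex) A"

lemma approximately_amenable_in_mono:
  fixes A :: "('a, 'm) calgebra_scheme" and \<iota> :: "'x \<Rightarrow> 'y"
  assumes inj: "inj \<iota>" and am: "approximately_amenable_in TYPE('y) A"
  shows "approximately_amenable_in TYPE('x) A"
  unfolding approximately_amenable_in_def
proof (intro allI impI)
  fix X :: "('a, 'x) cbimodule" and D
  assume X: "banach_bimodule A X" and D: "bounded_derivation A (dual_bimodule X) D"
  interpret X: banach_bimodule A X by fact
  define j where "j = inv \<iota>"
  have j[simp]: "j (\<iota> x) = x" for x using inj by (simp add: j_def)
  define Y :: "('a, 'y) cbimodule" where "Y =
    \<lparr>carrier = \<iota> ` carrier X, vadd = (\<lambda>x y. \<iota> (vadd X (j x) (j y))), vzero = \<iota> (vzero X),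
     vscale = (\<lambda>r x. \<iota> (vscale X r (j x))), vnorm = (\<lambda>x. vnorm X (j x)),
     lact = (\<lambda>a x. \<iota> (lact X a (j x))), ract = (\<lambda>x a. \<iota> (ract X (j x) a))\<rparr>"
  have Ysimps[simp]: "carrier Y = \<iota> ` carrier X"
    "vadd Y (\<iota> x) (\<iota> y) = \<iota> (vadd X x y)" "vzero Y = \<iota> (vzero X)"
    "vscale Y r (\<iota> x) = \<iota> (vscale X r x)" "vnorm Y (\<iota> x) = vnorm X x"
    "lact Y a (\<iota> x) = \<iota> (lact X a x)" "ract Y (\<iota> x) a = \<iota> (ract X x a)"
    "vminus Y (\<iota> x) (\<iota> y) = \<iota> (vminus X x y)" for x y r a
    by (simp_all add: Y_def vminus_def)
  have Y: "banach_bimodule A Y"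
  proof
    fix \<sigma> :: "nat \<Rightarrow> 'y"
    assume s: "\<And>n. \<sigma> n \<in> carrier Y"
      and c: "\<And>e. 0 < e \<Longrightarrow> \<exists>N. \<forall>m\<ge>N. \<forall>n\<ge>N. vnorm Y (vminus Y (\<sigma> m) (\<sigma> n)) < e"
    define \<tau> where "\<tau> n = j (\<sigma> n)" for n
    have \<sigma>: "\<sigma> = (\<lambda>n. \<iota> (\<tau> n))" and t: "\<And>n. \<tau> n \<in> carrier X"
      using s[unfolded Ysimps] by (auto simp: \<tau>_def fun_eq_iff dest: imageE) (metis imageE j)+
    obtain l where "l \<in> carrier X" "(\<lambda>n. vnorm X (vminus X (\<tau> n) l)) \<longlonglongrightarrow> 0"
      using X.complete[of \<tau>] t c by (auto simp: \<sigma>)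
    then show "\<exists>l\<in>carrier Y. (\<lambda>n. vnorm Y (vminus Y (\<sigma> n) l)) \<longlonglongrightarrow> 0"
      by (auto simp: \<sigma>)
  next
    from X.act_bounded obtain K where "\<forall>a\<in>carrier A. \<forall>x\<in>carrier X.
          vnorm X (lact X a x) \<le> K * vnorm A a * vnorm X x \<and>
          vnorm X (ract X x a) \<le> K * vnorm A a * vnorm X x" by blast
    then show "\<exists>K. \<forall>a\<in>carrier A. \<forall>x\<in>carrier Y.
          vnorm Y (lact Y a x) \<le> K * vnorm A a * vnorm Y x \<and>
          vnorm Y (ract Y x a) \<le> K * vnorm A a * vnorm Y x"
      by (intro exI[of _ K]) auto
  qed (insert X.lact_linear_right X.lact_linear_left X.ract_linear_left X.ract_linear_right,
      auto simp: linear_map_def X.lact_mult X.ract_mult X.lact_ract inj_eq[OF inj]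
        X.add_closed X.zero_closed X.scale_closed X.add_assoc X.add_zero
        X.add_inverse X.scale_add_right X.scale_add_left X.scale_scale X.scale_one
        X.norm_nonneg X.norm_eq_zero X.norm_scale X.norm_triangle intro: X.add_commute)
  define up where "up \<phi> y = (if y \<in> carrier Y then \<phi> (j y) else 0)" for \<phi> :: "'x \<Rightarrow> complex" and y
  define down where "down \<psi> x = (if x \<in> carrier X then \<psi> (\<iota> x) else 0)" for \<psi> :: "'y \<Rightarrow> complex" and x
  have mem: "\<iota> x \<in> carrier Y \<longleftrightarrow> x \<in> carrier X" for x using inj by (auto simp: inj_eq)
  have lact_X: "lact X a x \<in> carrier X" if "a \<in> carrier A" "x \<in> carrier X" for a x
    using X.lact_linear_right that by (auto simp: linear_map_def)
  have ract_X: "ract X x a \<in> carrier X" if "a \<in> carrier A" "x \<in> carrier X" for a x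
    using X.ract_linear_left that by (auto simp: linear_map_def)
  let ?X = "dual_bimodule X" and ?Y = "dual_bimodule Y"
  have up_carrier: "up \<phi> \<in> carrier ?Y" if "\<phi> \<in> carrier ?X" for \<phi>
  proof -
    from that obtain K where "\<forall>x\<in>carrier X. cmod (\<phi> x) \<le> K * vnorm X x"
      by (auto simp: dual_bimodule_def)
    then have "\<exists>K. \<forall>y\<in>carrier Y. cmod (up \<phi> y) \<le> K * vnorm Y y"
      by (intro exI[of _ K]) (auto simp: up_def)
    with that show ?thesis
      by (auto simp: dual_bimodule_def up_def inj_eq[OF inj] image_iff X.add_closed X.scale_closed)
  qed
  have down_carrier: "down \<psi> \<in> carrier ?X" if "\<psi> \<in> carrier ?Y" for \<psi>
  proof -
    from that obtain K where "\<forall>y\<in>carrier Y. cmod (\<psi> y) \<le> K * vnorm Y y"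
      by (auto simp: dual_bimodule_def)
    then have "\<exists>K. \<forall>x\<in>carrier X. cmod (down \<psi> x) \<le> K * vnorm X x"
      by (intro exI[of _ K]) (auto simp: down_def)
    with that show ?thesis
      by (auto simp: dual_bimodule_def down_def X.add_closed X.scale_closed)
  qed
  have norm_down: "vnorm ?X (down \<psi>) = vnorm ?Y \<psi>" for \<psi>
  proof -
    have "(\<lambda>x. cmod (down \<psi> x)) ` {x \<in> carrier X. vnorm X x \<le> 1} =
          (\<lambda>y. cmod (\<psi> y)) ` {y \<in> carrier Y. vnorm Y y \<le> 1}"
      by (force simp: down_def image_iff)
    then show ?thesis by (simp add: dual_bimodule_def)
  qed
  have dD: "bounded_derivation A ?Y (\<lambda>a. up (D a))"
  proof -
    have Dc: "D a \<in> carrier ?X" if "a \<in> carrier A" for a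
      using D that by (auto simp: bounded_derivation_def bounded_linear_map_def linear_map_def)
    have nup: "vnorm ?Y (up \<phi>) = vnorm ?X \<phi>" if "\<phi> \<in> carrier ?X" for \<phi>
    proof -
      have "down (up \<phi>) = \<phi>"
        using that by (auto simp: down_def up_def dual_bimodule_def fun_eq_iff)
      then show ?thesis using norm_down[of "up \<phi>"] by simp
    qed
    have "vadd ?Y (up \<phi>) (up \<psi>) = up (vadd ?X \<phi> \<psi>)" "vscale ?Y r (up \<phi>) = up (vscale ?X r \<phi>)" for \<phi> \<psi> r
      by (auto simp: dual_bimodule_def up_def fun_eq_iff)
    moreover have "lact ?Y a (up \<phi>) = up (lact ?X a \<phi>)" "ract ?Y (up \<phi>) a = up (ract ?X \<phi> a)"
      if "a \<in> carrier A" for \<phi> a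
      using that by (auto simp: dual_bimodule_def up_def fun_eq_iff inj_eq[OF inj] image_iff lact_X ract_X)
    ultimately show ?thesis
      using D Dc up_carrier
      by (auto simp: bounded_derivation_def bounded_linear_map_def linear_map_def nup)
  qed
  obtain F where F: "F \<noteq> bot" "\<forall>\<^sub>F D' in F. inner_derivation A ?Y D'"
    "\<And>a. a \<in> carrier A \<Longrightarrow> ((\<lambda>D'. vnorm ?Y (vminus ?Y (D' a) (up (D a)))) \<longlongrightarrow> 0) F"
    using am Y dD unfolding approximately_amenable_in_def approximately_inner_def by blast
  define G where "G = filtermap (\<lambda>D' a. down (D' a)) F"
  have "inner_derivation A ?X (\<lambda>a. down (D' a))" if "inner_derivation A ?Y D'" for D'
  proof -
    from that obtain e where e: "e \<in> carrier ?Y"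
      "\<And>a. a \<in> carrier A \<Longrightarrow> D' a = vminus ?Y (lact ?Y a e) (ract ?Y e a)"
      by (auto simp: inner_derivation_def)
    have "down (D' a) = vminus ?X (lact ?X a (down e)) (ract ?X (down e) a)" if "a \<in> carrier A" for a
      using that e(2)[OF that]
      by (auto simp: dual_bimodule_def down_def vminus_def fun_eq_iff lact_X ract_X)
    with down_carrier[OF e(1)] show ?thesis by (auto simp: inner_derivation_def)
  qed
  with F(2) have "\<forall>\<^sub>F D' in G. inner_derivation A ?X D'"
    by (auto simp: G_def eventually_filtermap elim: eventually_mono)
  moreover have "((\<lambda>D'. vnorm ?X (vminus ?X (D' a) (D a))) \<longlongrightarrow> 0) G" if "a \<in> carrier A" for a
  proof -
    have Da: "D a \<in> carrier ?X"
      using D that by (auto simp: bounded_derivation_def bounded_linear_map_def linear_map_def)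
    have "vminus ?X (down \<psi>) (D a) = down (vminus ?Y \<psi> (up (D a)))" for \<psi>
      using Da by (auto simp: dual_bimodule_def vminus_def down_def up_def fun_eq_iff)
    then have "vnorm ?X (vminus ?X (down (D' a)) (D a)) = vnorm ?Y (vminus ?Y (D' a) (up (D a)))" for D'
      by (simp add: norm_down)
    with F(3)[OF that] show ?thesis by (simp add: G_def filterlim_filtermap)
  qed
  moreover have "G \<noteq> bot" using F(1) by (simp add: G_def filtermap_bot_iff)
  ultimately show "approximately_inner A ?X D" unfolding approximately_inner_def by blast
qed


section \<open>The Feichtinger algebra of a compact abelian group\<close>

definition normalized_haar_measure :: "'g::topological_ab_group_add measure \<Rightarrow> bool" where
  "normalized_haar_measure M \<longleftrightarrow>
     sets M = sets borel \<and>
     emeasure M UNIV = 1 \<and>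
     (\<forall>a. \<forall>B\<in>sets borel. emeasure M ((+) a ` B) = emeasure M B) \<and>
     (\<forall>B\<in>sets borel. emeasure M B = (INF U\<in>{U. open U \<and> B \<subseteq> U}. emeasure M U)) \<and>
     (\<forall>U. open U \<longrightarrow> emeasure M U = (SUP K\<in>{K. compact K \<and> K \<subseteq> U}. emeasure M K))"

text \<open>The dual group, each element \<open>\<gamma>\<close> being identified with its character.\<close>

definition dual_group :: "('g::topological_ab_group_add \<Rightarrow> complex) set" where
  "dual_group = {\<gamma>. continuous_on UNIV \<gamma> \<and> (\<forall>x. cmod (\<gamma> x) = 1) \<and>
                    (\<forall>x y. \<gamma> (x + y) = \<gamma> x * \<gamma> y)}"

definition character_expansion ::
  "(('g::topological_ab_group_add \<Rightarrow> complex) \<Rightarrow> complex) \<Rightarrow> ('g \<Rightarrow> complex) \<Rightarrow> bool" where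
  "character_expansion c f \<longleftrightarrow>
     (\<lambda>\<gamma>. cmod (c \<gamma>)) summable_on dual_group \<and>
     (\<forall>x. ((\<lambda>\<gamma>. c \<gamma> * \<gamma> x) has_sum f x) dual_group)"

text \<open>
  The coefficients are determined by \<open>f\<close> (\<open>character_expansion_unique\<close> below), so the
  description in the norm is proper.
\<close>

definition feichtinger_norm :: "('g::topological_ab_group_add \<Rightarrow> complex) \<Rightarrow> real" where
  "feichtinger_norm f =
     (THE r. \<exists>c. character_expansion c f \<and> r = (\<Sum>\<^sub>\<infinity>\<gamma>\<in>dual_group. cmod (c \<gamma>)))"

definition convolution ::
  "'g::topological_ab_group_add measure \<Rightarrow> ('g \<Rightarrow> complex) \<Rightarrow> ('g \<Rightarrow> complex) \<Rightarrow> 'g \<Rightarrow> complex" where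
  "convolution M f g = (\<lambda>x. LINT y|M. f y * g (x - y))"

definition feichtinger_algebra ::
  "'g::topological_ab_group_add measure \<Rightarrow> ('g \<Rightarrow> complex) calgebra" where
  "feichtinger_algebra M =
    \<lparr>carrier = {f. \<exists>c. character_expansion c f},
     vadd = (\<lambda>f g x. f x + g x),
     vzero = (\<lambda>x. 0),
     vscale = (\<lambda>r f x. r * f x),
     vnorm = feichtinger_norm,
     vmult = convolution M\<rparr>"

lemma haar_measureD:
  assumes "normalized_haar_measure M"
  shows "sets M = sets borel" "space M = UNIV" "prob_space M"
    "B \<in> sets borel \<Longrightarrow> emeasure M ((+) a ` B) = emeasure M B"
proof -
  note H = assms[unfolded normalized_haar_measure_def]
  show s: "sets M = sets borel" using H by (rule conjunct1)
  show "B \<in> sets borel \<Longrightarrow> emeasure M ((+) a ` B) = emeasure M B"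
    using H[THEN conjunct2, THEN conjunct2, THEN conjunct1] by blast
  from s show sp: "space M = UNIV" by (metis sets_eq_imp_space_eq space_borel)
  have "emeasure M UNIV = 1" using H[THEN conjunct2] by (rule conjunct1)
  with sp show "prob_space M" by (intro prob_spaceI) simp
qed

lemma integrable_bounded_continuous:
  fixes f :: "'g::topological_ab_group_add \<Rightarrow> complex"
  assumes M: "normalized_haar_measure M" and f: "continuous_on UNIV f" "\<And>x. cmod (f x) \<le> B"
  shows "integrable M f"
proof -
  interpret prob_space M using haar_measureD(3)[OF M] .
  note s = haar_measureD(1)[OF M]
  have "f \<in> borel_measurable M"
    using borel_measurable_continuous_onI[OF f(1)] measurable_cong_sets[OF s refl] by blast
  then show ?thesis
    using f(2) by (intro integrable_const_bound[where B = B]) auto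
qed

lemma integral_has_sum:
  fixes h :: "'i \<Rightarrow> 'g::topological_ab_group_add \<Rightarrow> complex"
  assumes M: "normalized_haar_measure M"
    and h: "\<And>i. i \<in> I \<Longrightarrow> continuous_on UNIV (h i)" "\<And>i x. i \<in> I \<Longrightarrow> cmod (h i x) \<le> b i"
    and b: "b summable_on I" and s: "\<And>x. ((\<lambda>i. h i x) has_sum s x) I"
  shows "continuous_on UNIV s" "((\<lambda>i. LINT x|M. h i x) has_sum (LINT x|M. s x)) I"
    "\<And>x. cmod (s x) \<le> infsum b I"
proof -
  have b0: "0 \<le> b i" if "i \<in> I" for i using h(2)[OF that] norm_ge_zero order_trans by blast
  have tail: "cmod (s x - (\<Sum>i\<in>F. h i x)) \<le> infsum b I - sum b F" if "finite F" "F \<subseteq> I" for F x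
  proof -
    have 1: "((\<lambda>i. h i x) has_sum (s x - (\<Sum>i\<in>F. h i x))) (I - F)"
      using has_sum_Diff[OF s has_sum_finite that(2)] that(1) by blast
    have 2: "(b has_sum (infsum b I - sum b F)) (I - F)"
      using has_sum_Diff[OF has_sum_infsum[OF b] has_sum_finite that(2)] that(1) by blast
    show ?thesis
      using norm_infsum_le[OF 1 2] h(2) by auto
  qed
  show bd: "cmod (s x) \<le> infsum b I" for x using tail[of "{}"] by simp
  have lim: "((\<lambda>F. infsum b I - sum b F) \<longlongrightarrow> 0) (finite_subsets_at_top I)"
    using has_sum_infsum[OF b] unfolding has_sum_def by (auto intro!: tendsto_eq_intros)
  have ev: "\<forall>\<^sub>F F in finite_subsets_at_top I. finite F \<and> F \<subseteq> I"
    by (rule eventually_finite_subsets_at_top_weakI) auto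
  have "uniform_limit UNIV (\<lambda>F x. \<Sum>i\<in>F. h i x) s (finite_subsets_at_top I)"
  proof (rule uniform_limitI)
    fix e :: real assume "0 < e"
    then have "\<forall>\<^sub>F F in finite_subsets_at_top I. infsum b I - sum b F < e"
      using order_tendstoD(2)[OF lim] by blast
    with ev show "\<forall>\<^sub>F F in finite_subsets_at_top I. \<forall>x\<in>UNIV. dist (\<Sum>i\<in>F. h i x) (s x) < e"
    proof eventually_elim
      case (elim F)
      then show ?case using tail[of F] by (auto simp: dist_norm norm_minus_commute intro: le_less_trans)
    qed
  qed
  moreover have "\<forall>\<^sub>F F in finite_subsets_at_top I. continuous_on UNIV (\<lambda>x. \<Sum>i\<in>F. h i x)"
    using ev by eventually_elim (auto intro!: continuous_on_sum h(1))
  ultimately show cs: "continuous_on UNIV s"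
    by (intro uniform_limit_theorem[OF _ _ finite_subsets_at_top_neq_bot])
  have int_s: "integrable M s" using integrable_bounded_continuous[OF M cs bd] .
  have ih: "integrable M (h i)" if "i \<in> I" for i
    by (rule integrable_bounded_continuous[OF M h(1)[OF that] h(2)[OF that]])
  interpret prob_space M using haar_measureD(3)[OF M] .
  have "((\<lambda>F. (\<Sum>i\<in>F. LINT x|M. h i x) - (LINT x|M. s x)) \<longlongrightarrow> 0) (finite_subsets_at_top I)"
  proof (rule Lim_null_comparison[OF _ lim])
    show "\<forall>\<^sub>F F in finite_subsets_at_top I.
        cmod ((\<Sum>i\<in>F. LINT x|M. h i x) - (LINT x|M. s x)) \<le> infsum b I - sum b F"
      using ev
    proof eventually_elim
      case (elim F)
      have i: "integrable M (\<lambda>x. (\<Sum>i\<in>F. h i x) - s x)"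
        using ih int_s elim by (intro Bochner_Integration.integrable_diff Bochner_Integration.integrable_sum) auto
      have "(\<Sum>i\<in>F. LINT x|M. h i x) - (LINT x|M. s x) = (LINT x|M. (\<Sum>i\<in>F. h i x) - s x)"
        using ih int_s elim by (subst Bochner_Integration.integral_diff) (auto simp: subset_iff)
      also have "cmod \<dots> \<le> (LINT x|M. cmod ((\<Sum>i\<in>F. h i x) - s x))"
        by simp
      also have "\<dots> \<le> (LINT x|M. infsum b I - sum b F)"
        using tail elim
        by (intro integral_mono integrable_norm[OF i]) (auto simp: norm_minus_commute[of _ "s _"])
      also have "\<dots> = infsum b I - sum b F" by (simp add: prob_space)
      finally show ?case .
    qed
  qed
  then show "((\<lambda>i. LINT x|M. h i x) has_sum (LINT x|M. s x)) I"
    unfolding has_sum_def using Lim_null by blast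
qed

lemma dual_groupD:
  assumes "\<gamma> \<in> dual_group"
  shows "continuous_on UNIV \<gamma>" "cmod (\<gamma> x) = 1" "\<gamma> (x + y) = \<gamma> x * \<gamma> y"
    "\<gamma> 0 = 1" "\<gamma> (- x) = cnj (\<gamma> x)" "\<gamma> (x - y) = \<gamma> x * cnj (\<gamma> y)"
proof -
  show 1: "continuous_on UNIV \<gamma>" "cmod (\<gamma> x) = 1" "\<gamma> (x + y) = \<gamma> x * \<gamma> y" for x y
    using assms by (auto simp: dual_group_def)
  have "\<gamma> 0 * \<gamma> 0 = \<gamma> 0" "\<gamma> 0 \<noteq> 0" using 1(3)[of 0 0] 1(2)[of 0] by auto
  then show 2: "\<gamma> 0 = 1" by simp
  have "\<gamma> x * \<gamma> (- x) = 1" "\<gamma> x * cnj (\<gamma> x) = 1" for x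
    using 1(3)[of x "- x"] 2 1(2)[of x] by (simp_all add: complex_norm_square[symmetric])
  then show 3: "\<gamma> (- x) = cnj (\<gamma> x)" for x by (metis mult.assoc mult.commute mult.right_neutral)
  show "\<gamma> (x - y) = \<gamma> x * cnj (\<gamma> y)" using 1(3)[of x "- y"] 3 by simp
qed

lemma haar_integral_translate:
  fixes f :: "'g::topological_ab_group_add \<Rightarrow> complex"
  assumes M: "normalized_haar_measure M" and f: "continuous_on UNIV f"
  shows "(LINT x|M. f (a + x)) = (LINT x|M. f x)"
proof -
  note s = haar_measureD(1)[OF M] and sp = haar_measureD(2)[OF M]
  have t: "(\<lambda>x. b + x) \<in> measurable M M" for b
  proof -
    have "continuous_on UNIV (\<lambda>x. b + x)" by (intro continuous_intros)
    then show ?thesis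
      using borel_measurable_continuous_onI measurable_cong_sets[OF s s] by blast
  qed
  have "distr M M (\<lambda>x. a + x) = M"
  proof (rule measure_eqI)
    fix B assume "B \<in> sets (distr M M (\<lambda>x. a + x))"
    then have B: "B \<in> sets M" by simp
    have "emeasure (distr M M (\<lambda>x. a + x)) B = emeasure M ((\<lambda>x. a + x) -` B)"
      by (simp add: emeasure_distr[OF t B] sp)
    also have "(\<lambda>x. a + x) -` B = (+) (- a) ` B" by (force simp: image_iff)
    also have "emeasure M \<dots> = emeasure M B"
      by (rule haar_measureD(4)[OF M]) (use B s in simp)
    finally show "emeasure (distr M M (\<lambda>x. a + x)) B = emeasure M B" .
  qed simp
  moreover have "f \<in> borel_measurable M"
    using borel_measurable_continuous_onI[OF f] measurable_cong_sets[OF s refl] by blast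
  ultimately show ?thesis using integral_distr[OF t, of f a] by simp
qed

lemma character_orthogonality:
  assumes M: "normalized_haar_measure M" and \<gamma>: "\<gamma> \<in> dual_group" and \<delta>: "\<delta> \<in> dual_group"
  shows "(LINT x|M. \<gamma> x * cnj (\<delta> x)) = (if \<gamma> = \<delta> then 1 else 0)"
proof (cases "\<gamma> = \<delta>")
  case True
  have "measure M (space M) = 1"
    using haar_measureD(3)[OF M] by (rule prob_space.prob_space)
  moreover have "\<gamma> x * cnj (\<gamma> x) = 1" for x
    using dual_groupD(2)[OF \<gamma>] by (simp add: complex_norm_square[symmetric])
  ultimately show ?thesis using True by simp
next
  case False
  then obtain a where a: "\<gamma> a \<noteq> \<delta> a" by auto
  let ?I = "LINT x|M. \<gamma> x * cnj (\<delta> x)"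
  have "?I = (LINT x|M. \<gamma> (a + x) * cnj (\<delta> (a + x)))"
    using \<gamma> \<delta> by (intro haar_integral_translate[OF M, symmetric] continuous_intros dual_groupD)
  also have "\<dots> = (LINT x|M. (\<gamma> a * cnj (\<delta> a)) * (\<gamma> x * cnj (\<delta> x)))"
    by (simp add: dual_groupD(3)[OF \<gamma>] dual_groupD(3)[OF \<delta>] mult_ac)
  also have "\<dots> = (\<gamma> a * cnj (\<delta> a)) * ?I" by simp
  finally have "?I = 0 \<or> \<gamma> a * cnj (\<delta> a) = 1" by auto
  moreover have "\<gamma> a * cnj (\<delta> a) \<noteq> 1"
  proof
    assume "\<gamma> a * cnj (\<delta> a) = 1"
    then have "\<gamma> a * (cnj (\<delta> a) * \<delta> a) = \<delta> a" by (simp add: mult.assoc[symmetric])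
    moreover have "cnj (\<delta> a) * \<delta> a = 1"
      using dual_groupD(2)[OF \<delta>] by (simp add: complex_norm_square[symmetric] mult.commute)
    ultimately show False using a by simp
  qed
  ultimately show ?thesis using False by simp
qed

lemma character_expansion_coefficient:
  assumes M: "normalized_haar_measure M" and c: "character_expansion c f" and \<delta>: "\<delta> \<in> dual_group"
  shows "(LINT x|M. f x * cnj (\<delta> x)) = c \<delta>"
proof -
  have cont: "continuous_on UNIV (\<lambda>x. c \<gamma> * \<gamma> x * cnj (\<delta> x))" if "\<gamma> \<in> dual_group" for \<gamma>
    by (intro continuous_intros dual_groupD(1)[OF that] dual_groupD(1)[OF \<delta>])
  have "((\<lambda>\<gamma>. LINT x|M. c \<gamma> * \<gamma> x * cnj (\<delta> x)) has_sum (LINT x|M. f x * cnj (\<delta> x))) dual_group"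
  proof (rule integral_has_sum(2)[OF M])
    show "(\<lambda>\<gamma>. cmod (c \<gamma>)) summable_on dual_group"
      and "\<And>x. ((\<lambda>\<gamma>. c \<gamma> * \<gamma> x * cnj (\<delta> x)) has_sum f x * cnj (\<delta> x)) dual_group"
      using c by (auto simp: character_expansion_def intro: has_sum_cmult_left)
  qed (use \<delta> in \<open>auto simp: norm_mult dual_groupD(2) cont\<close>)
  moreover have "((\<lambda>\<gamma>. LINT x|M. c \<gamma> * \<gamma> x * cnj (\<delta> x)) has_sum c \<delta>) dual_group"
  proof -
    have "(LINT x|M. c \<gamma> * \<gamma> x * cnj (\<delta> x)) = (if \<gamma> = \<delta> then c \<delta> else 0)"
      if "\<gamma> \<in> dual_group" for \<gamma>
      using character_orthogonality[OF M that \<delta>] by (simp add: mult.assoc)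
    then show ?thesis
      using \<delta> by (intro has_sum_finite_neutralI[of "{\<delta>}"]) auto
  qed
  ultimately show ?thesis using has_sum_unique by blast
qed

lemma character_expansion_unique:
  fixes M :: "'g::topological_ab_group_add measure" and f :: "'g \<Rightarrow> complex"
  assumes "normalized_haar_measure M" "character_expansion c f" "character_expansion d f"
    "\<gamma> \<in> dual_group"
  shows "c \<gamma> = d \<gamma>"
  using character_expansion_coefficient[OF assms(1,2,4)] character_expansion_coefficient[OF assms(1,3,4)] by simp

lemma feichtinger_norm_eq:
  fixes M :: "'g::topological_ab_group_add measure" and f :: "'g \<Rightarrow> complex"
  assumes "normalized_haar_measure M" "character_expansion c f"
  shows "feichtinger_norm f = (\<Sum>\<^sub>\<infinity>\<gamma>\<in>dual_group. cmod (c \<gamma>))"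
  unfolding feichtinger_norm_def
proof (rule the_equality)
  fix r assume "\<exists>c. character_expansion c f \<and> r = (\<Sum>\<^sub>\<infinity>\<gamma>\<in>dual_group. cmod (c \<gamma>))"
  then show "r = (\<Sum>\<^sub>\<infinity>\<gamma>\<in>dual_group. cmod (c \<gamma>))"
    using character_expansion_unique[OF assms] by (auto intro!: infsum_cong)
qed (use assms in auto)

lemma character_expansion_convolution:
  assumes M: "normalized_haar_measure M" and c: "character_expansion c f" and d: "character_expansion d g"
  shows "character_expansion (\<lambda>\<gamma>. c \<gamma> * d \<gamma>) (convolution M f g)"
    and "(\<Sum>\<^sub>\<infinity>\<gamma>\<in>dual_group. cmod (c \<gamma> * d \<gamma>)) \<le>
         (\<Sum>\<^sub>\<infinity>\<gamma>\<in>dual_group. cmod (c \<gamma>)) * (\<Sum>\<^sub>\<infinity>\<gamma>\<in>dual_group. cmod (d \<gamma>))"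
proof -
  let ?G = "dual_group :: ('a \<Rightarrow> complex) set"
  let ?d = "\<Sum>\<^sub>\<infinity>\<gamma>\<in>?G. cmod (d \<gamma>)"
  have cs: "(\<lambda>\<gamma>. cmod (c \<gamma>)) summable_on ?G" and ds: "(\<lambda>\<gamma>. cmod (d \<gamma>)) summable_on ?G"
    and f: "\<And>x. ((\<lambda>\<gamma>. c \<gamma> * \<gamma> x) has_sum f x) ?G" and g: "\<And>x. ((\<lambda>\<gamma>. d \<gamma> * \<gamma> x) has_sum g x) ?G"
    using c d by (auto simp: character_expansion_def)
  have le: "cmod (c \<gamma> * d \<gamma>) \<le> cmod (c \<gamma>) * ?d" if "\<gamma> \<in> ?G" for \<gamma>
    using finite_sum_le_infsum[OF ds, of "{\<gamma>}"] that by (auto simp: norm_mult intro: mult_left_mono)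
  have cd: "(\<lambda>\<gamma>. cmod (c \<gamma>) * ?d) summable_on ?G" using cs by (intro summable_on_cmult_left)
  have s: "(\<lambda>\<gamma>. cmod (c \<gamma> * d \<gamma>)) summable_on ?G"
    using le by (intro summable_on_comparison_test[OF cd]) auto
  show "(\<Sum>\<^sub>\<infinity>\<gamma>\<in>?G. cmod (c \<gamma> * d \<gamma>)) \<le> (\<Sum>\<^sub>\<infinity>\<gamma>\<in>?G. cmod (c \<gamma>)) * ?d"
    using infsum_mono[OF s cd le] infsum_cmult_left'[of "\<lambda>\<gamma>. cmod (c \<gamma>)" ?d ?G] by simp
  have gc: "continuous_on UNIV g" and gb: "\<And>x. cmod (g x) \<le> ?d"
  proof -
    have h: "continuous_on UNIV (\<lambda>x. d \<gamma> * \<gamma> x)" "cmod (d \<gamma> * \<gamma> x) \<le> cmod (d \<gamma>)"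
      if "\<gamma> \<in> ?G" for \<gamma> x
      using that by (simp_all add: norm_mult dual_groupD(2) continuous_on_mult_left dual_groupD(1))
    show "continuous_on UNIV g" "cmod (g x) \<le> ?d" for x
      using integral_has_sum(1,3)[where h = "\<lambda>\<gamma> x. d \<gamma> * \<gamma> x", OF M h ds g] by auto
  qed
  have gcx: "continuous_on UNIV (\<lambda>y. g (x - y))" for x
    by (rule continuous_on_compose2[OF gc]) (auto intro!: continuous_intros)
  have conv: "(LINT y|M. c \<gamma> * \<gamma> y * g (x - y)) = c \<gamma> * d \<gamma> * \<gamma> x" if \<gamma>: "\<gamma> \<in> ?G" for \<gamma> x
  proof -
    have 1: "continuous_on UNIV (\<lambda>y. \<delta> (x - y))" if "\<delta> \<in> ?G" for \<delta>
      by (rule continuous_on_compose2[OF dual_groupD(1)[OF that]]) (auto intro!: continuous_intros)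
    have cont: "continuous_on UNIV (\<lambda>y. \<gamma> y * (d \<delta> * \<delta> (x - y)))" if "\<delta> \<in> ?G" for \<delta>
      by (intro continuous_intros dual_groupD(1)[OF \<gamma>] 1[OF that])
    have "((\<lambda>\<delta>. LINT y|M. \<gamma> y * (d \<delta> * \<delta> (x - y))) has_sum (LINT y|M. \<gamma> y * g (x - y))) ?G"
      by (rule integral_has_sum(2)[OF M _ _ ds])
        (use \<gamma> g in \<open>auto simp: norm_mult dual_groupD(2) cont intro!: has_sum_cmult_right\<close>)
    moreover have "((\<lambda>\<delta>. LINT y|M. \<gamma> y * (d \<delta> * \<delta> (x - y))) has_sum (d \<gamma> * \<gamma> x)) ?G"
    proof -
      have "(LINT y|M. \<gamma> y * (d \<delta> * \<delta> (x - y))) = (if \<gamma> = \<delta> then d \<gamma> * \<gamma> x else 0)" if "\<delta> \<in> ?G" for \<delta>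
      proof -
        have "(LINT y|M. \<gamma> y * (d \<delta> * \<delta> (x - y))) = (LINT y|M. (d \<delta> * \<delta> x) * (\<gamma> y * cnj (\<delta> y)))"
          by (simp add: dual_groupD(6)[OF that] mult_ac)
        then show ?thesis using character_orthogonality[OF M \<gamma> that] by simp
      qed
      then show ?thesis using \<gamma> by (intro has_sum_finite_neutralI[of "{\<gamma>}"]) auto
    qed
    ultimately have "(LINT y|M. \<gamma> y * g (x - y)) = d \<gamma> * \<gamma> x" using has_sum_unique by blast
    then show ?thesis by (simp add: mult.assoc)
  qed
  have cont: "continuous_on UNIV (\<lambda>y. c \<gamma> * \<gamma> y * g (x - y))" if "\<gamma> \<in> ?G" for \<gamma> x
    by (intro continuous_intros dual_groupD(1)[OF that] gcx)
  have "((\<lambda>\<gamma>. LINT y|M. c \<gamma> * \<gamma> y * g (x - y)) has_sum convolution M f g x) ?G" for x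
    unfolding convolution_def
    by (rule integral_has_sum(2)[OF M _ _ cd])
      (use f gb in \<open>auto simp: norm_mult dual_groupD(2) cont intro!: has_sum_cmult_left mult_left_mono\<close>)
  then have "((\<lambda>\<gamma>. c \<gamma> * d \<gamma> * \<gamma> x) has_sum convolution M f g x) ?G" for x
    using conv by (simp cong: has_sum_cong)
  with s show "character_expansion (\<lambda>\<gamma>. c \<gamma> * d \<gamma>) (convolution M f g)"
    by (simp add: character_expansion_def)
qed

lemma character_expansion_add:
  assumes "character_expansion c f" "character_expansion d g"
  shows "character_expansion (\<lambda>\<gamma>. c \<gamma> + d \<gamma>) (\<lambda>x. f x + g x)"
    and "(\<Sum>\<^sub>\<infinity>\<gamma>\<in>dual_group. cmod (c \<gamma> + d \<gamma>)) \<le>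
         (\<Sum>\<^sub>\<infinity>\<gamma>\<in>dual_group. cmod (c \<gamma>)) + (\<Sum>\<^sub>\<infinity>\<gamma>\<in>dual_group. cmod (d \<gamma>))"
proof -
  let ?G = "dual_group :: ('a \<Rightarrow> complex) set"
  have c: "(\<lambda>\<gamma>. cmod (c \<gamma>)) summable_on ?G" and d: "(\<lambda>\<gamma>. cmod (d \<gamma>)) summable_on ?G"
    using assms by (auto simp: character_expansion_def)
  have s: "(\<lambda>\<gamma>. cmod (c \<gamma> + d \<gamma>)) summable_on ?G"
    by (rule summable_on_comparison_test[OF summable_on_add[OF c d]]) (auto intro: norm_triangle_ineq)
  show "(\<Sum>\<^sub>\<infinity>\<gamma>\<in>?G. cmod (c \<gamma> + d \<gamma>)) \<le> (\<Sum>\<^sub>\<infinity>\<gamma>\<in>?G. cmod (c \<gamma>)) + (\<Sum>\<^sub>\<infinity>\<gamma>\<in>?G. cmod (d \<gamma>))"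
    unfolding infsum_add[OF c d, symmetric]
    by (rule infsum_mono[OF s summable_on_add[OF c d]]) (rule norm_triangle_ineq)
  show "character_expansion (\<lambda>\<gamma>. c \<gamma> + d \<gamma>) (\<lambda>x. f x + g x)"
    using assms s by (auto simp: character_expansion_def distrib_right intro: has_sum_add)
qed

lemma character_expansion_scale:
  assumes "character_expansion c f"
  shows "character_expansion (\<lambda>\<gamma>. r * c \<gamma>) (\<lambda>x. r * f x)"
  using assms
  by (auto simp: character_expansion_def norm_mult mult.assoc intro: has_sum_cmult_right summable_on_cmult_right)

lemma character_expansion_zero: "character_expansion (\<lambda>\<gamma>. 0) (\<lambda>x. 0)"
  by (simp add: character_expansion_def)

lemma character_expansion_determines:
  assumes "character_expansion c f" "character_expansion d g" "\<And>\<gamma>. \<gamma> \<in> dual_group \<Longrightarrow> c \<gamma> = d \<gamma>"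
  shows "f = g"
proof
  fix x
  have "((\<lambda>\<gamma>. c \<gamma> * \<gamma> x) has_sum f x) dual_group" "((\<lambda>\<gamma>. d \<gamma> * \<gamma> x) has_sum g x) dual_group"
    using assms(1,2) by (auto simp: character_expansion_def)
  moreover have "((\<lambda>\<gamma>. c \<gamma> * \<gamma> x) has_sum f x) dual_group \<longleftrightarrow> ((\<lambda>\<gamma>. d \<gamma> * \<gamma> x) has_sum f x) dual_group"
    using assms(3) by (intro has_sum_cong) simp
  ultimately show "f x = g x" using has_sum_unique by blast
qed

theorem feichtinger_algebra_is_banach_algebra:
  fixes M :: "'g::topological_ab_group_add measure"
  assumes M: "normalized_haar_measure M"
  shows "complex_banach_algebra (feichtinger_algebra M)"
proof -
  let ?S = "feichtinger_algebra M" and ?G = "dual_group :: ('g \<Rightarrow> complex) set"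
  let ?C = "{f :: 'g \<Rightarrow> complex. \<exists>c. character_expansion c f}"
  note N = feichtinger_norm_eq[OF M]
  have S: "carrier ?S = ?C" "vadd ?S f g = (\<lambda>x. f x + g x)"
    "vzero ?S = (\<lambda>x. 0)" "vscale ?S r f = (\<lambda>x. r * f x)" "vnorm ?S f = feichtinger_norm f"
    "vmult ?S f g = convolution M f g" "vminus ?S f g = (\<lambda>x. f x - g x)" for f g r
    by (simp_all add: feichtinger_algebra_def vminus_def)
  have sub: "character_expansion (\<lambda>\<gamma>. c \<gamma> - d \<gamma>) (\<lambda>x. f x - g x)"
    if "character_expansion c f" "character_expansion d g" for c d and f g :: "'g \<Rightarrow> complex"
    using character_expansion_add(1)[OF that(1) character_expansion_scale[OF that(2), of "- 1"]] by simp
  have complete: "\<exists>l\<in>?C. (\<lambda>n. feichtinger_norm (\<lambda>x. \<sigma> n x - l x)) \<longlonglongrightarrow> 0"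
    if s: "\<And>n. \<sigma> n \<in> ?C"
      and cau: "\<And>e. 0 < e \<Longrightarrow> \<exists>N. \<forall>m\<ge>N. \<forall>n\<ge>N. feichtinger_norm (\<lambda>x. \<sigma> m x - \<sigma> n x) < e" for \<sigma>
  proof -
    obtain c where c: "\<And>n. character_expansion (c n) (\<sigma> n)" using s by simp metis
    have sc: "(\<lambda>\<gamma>. cmod (c m \<gamma> - c n \<gamma>)) summable_on ?G" for m n
      using sub[OF c c] by (simp add: character_expansion_def)
    have fin: "(\<Sum>\<gamma>\<in>F. cmod (c m \<gamma> - c n \<gamma>)) \<le> feichtinger_norm (\<lambda>x. \<sigma> m x - \<sigma> n x)"
      if "finite F" "F \<subseteq> ?G" for F m n
      unfolding N[OF sub[OF c c]] using that by (intro finite_sum_le_infsum[OF sc]) auto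
    have "Cauchy (\<lambda>n. c n \<gamma>)" if "\<gamma> \<in> ?G" for \<gamma>
    proof (rule CauchyI)
      fix e :: real assume "0 < e"
      then obtain N where "\<forall>m\<ge>N. \<forall>n\<ge>N. feichtinger_norm (\<lambda>x. \<sigma> m x - \<sigma> n x) < e" using cau by blast
      then show "\<exists>N. \<forall>m\<ge>N. \<forall>n\<ge>N. cmod (c m \<gamma> - c n \<gamma>) < e"
        using le_less_trans[OF fin[of "{\<gamma>}", simplified]] that by blast
    qed
    then obtain a where a: "\<And>\<gamma>. \<gamma> \<in> ?G \<Longrightarrow> (\<lambda>n. c n \<gamma>) \<longlonglongrightarrow> a \<gamma>"
      unfolding Cauchy_convergent_iff convergent_def by metis
    have fin': "(\<Sum>\<gamma>\<in>F. cmod (c m \<gamma> - a \<gamma>)) \<le> e"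
      if "finite F" "F \<subseteq> ?G" "m \<ge> N" "\<forall>m\<ge>N. \<forall>n\<ge>N. feichtinger_norm (\<lambda>x. \<sigma> m x - \<sigma> n x) < e" for F m N e
    proof (rule tendsto_upperbound)
      show "(\<lambda>n. \<Sum>\<gamma>\<in>F. cmod (c m \<gamma> - c n \<gamma>)) \<longlonglongrightarrow> (\<Sum>\<gamma>\<in>F. cmod (c m \<gamma> - a \<gamma>))"
        using that(2) by (intro tendsto_intros a) auto
      show "\<forall>\<^sub>F n in sequentially. (\<Sum>\<gamma>\<in>F. cmod (c m \<gamma> - c n \<gamma>)) \<le> e"
        unfolding eventually_sequentially
        using order_trans[OF fin[OF that(1,2)] less_imp_le] that(3,4) by blast
    qed simp
    have lim: "(\<lambda>\<gamma>. cmod (c m \<gamma> - a \<gamma>)) summable_on ?G \<and> (\<Sum>\<^sub>\<infinity>\<gamma>\<in>?G. cmod (c m \<gamma> - a \<gamma>)) \<le> e"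
      if "m \<ge> N" "\<forall>m\<ge>N. \<forall>n\<ge>N. feichtinger_norm (\<lambda>x. \<sigma> m x - \<sigma> n x) < e" for m N e
    proof
      show s: "(\<lambda>\<gamma>. cmod (c m \<gamma> - a \<gamma>)) summable_on ?G"
        using fin'[OF _ _ that(1,2)] by (intro nonneg_bdd_above_summable_on bdd_aboveI[of _ e]) auto
      show "(\<Sum>\<^sub>\<infinity>\<gamma>\<in>?G. cmod (c m \<gamma> - a \<gamma>)) \<le> e"
        using fin'[OF _ _ that(1,2)] by (intro infsum_le_finite_sums[OF s]) auto
    qed
    define l where "l x = (\<Sum>\<^sub>\<infinity>\<gamma>\<in>?G. a \<gamma> * \<gamma> x)" for x
    have l: "character_expansion a l"
    proof -
      obtain N where "\<forall>m\<ge>N. \<forall>n\<ge>N. feichtinger_norm (\<lambda>x. \<sigma> m x - \<sigma> n x) < 1" using cau[of 1] by auto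
      then have s1: "(\<lambda>\<gamma>. cmod (c N \<gamma> - a \<gamma>)) summable_on ?G" using lim[of N N 1] by blast
      have s2: "(\<lambda>\<gamma>. cmod (c N \<gamma>)) summable_on ?G" using c by (simp add: character_expansion_def)
      have le: "cmod (a \<gamma>) \<le> cmod (c N \<gamma> - a \<gamma>) + cmod (c N \<gamma>)" for \<gamma>
        using norm_triangle_sub[of "a \<gamma>" "c N \<gamma>"] by (simp add: norm_minus_commute)
      have s3: "(\<lambda>\<gamma>. cmod (a \<gamma>)) summable_on ?G"
        by (rule summable_on_comparison_test[OF summable_on_add[OF s1 s2]])
          (use le in auto)
      have "(\<lambda>\<gamma>. a \<gamma> * \<gamma> x) summable_on ?G" for x
        by (rule abs_summable_summable, rule summable_on_comparison_test[OF s3])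
          (auto simp: norm_mult dual_groupD(2))
      with s3 show ?thesis by (simp add: character_expansion_def l_def)
    qed
    have "(\<lambda>n. feichtinger_norm (\<lambda>x. \<sigma> n x - l x)) \<longlonglongrightarrow> 0"
    proof (rule LIMSEQ_I)
      fix e :: real assume "0 < e"
      then obtain N where "\<forall>m\<ge>N. \<forall>n\<ge>N. feichtinger_norm (\<lambda>x. \<sigma> m x - \<sigma> n x) < e / 2"
        using cau[of "e / 2"] by auto
      then have "feichtinger_norm (\<lambda>x. \<sigma> n x - l x) \<le> e / 2" if "n \<ge> N" for n
        unfolding N[OF sub[OF c l]] using lim[OF that] by blast
      moreover have "0 \<le> feichtinger_norm (\<lambda>x. \<sigma> n x - l x)" for n
        unfolding N[OF sub[OF c l]] by (intro infsum_nonneg) auto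
      ultimately show "\<exists>no. \<forall>n\<ge>no. norm (feichtinger_norm (\<lambda>x. \<sigma> n x - l x) - 0) < e"
        using \<open>0 < e\<close> by (intro exI[of _ N]) (fastforce intro: le_less_trans[of _ "e / 2"])
    qed
    with l show ?thesis by blast
  qed
  note CE = character_expansion_add(1) character_expansion_scale character_expansion_zero
    character_expansion_convolution(1)[OF M]
  have closed: "convolution M f g \<in> ?C" "(\<lambda>x. f x + g x) \<in> ?C" "(\<lambda>x. r * f x) \<in> ?C"
    if fg: "f \<in> ?C" "g \<in> ?C" for f g r
  proof -
    from fg obtain c d where cd: "character_expansion c f" "character_expansion d g" by blast
    show "convolution M f g \<in> ?C" "(\<lambda>x. f x + g x) \<in> ?C" "(\<lambda>x. r * f x) \<in> ?C"
      using CE(4)[OF cd] CE(1)[OF cd] CE(2)[OF cd(1)] by auto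
  qed
  show ?thesis
  proof (unfold_locales, unfold S linear_map_def)
    fix f g h :: "'g \<Rightarrow> complex" and r s :: complex
    show "(\<lambda>x. f x + g x) \<in> ?C" if "f \<in> ?C" "g \<in> ?C" using closed(2) that by blast
    show "(\<lambda>x. 0) \<in> ?C" using CE(3) by blast
    show "(\<lambda>x. r * f x) \<in> ?C" if "f \<in> ?C" using closed(3) that by blast
    show "0 \<le> feichtinger_norm f" if f: "f \<in> ?C"
    proof -
      from f obtain c where c: "character_expansion c f" by blast
      show ?thesis unfolding N[OF c] by (intro infsum_nonneg) simp
    qed
    show "feichtinger_norm f = 0 \<longleftrightarrow> f = (\<lambda>x. 0)" if f: "f \<in> ?C"
    proof
      from f obtain c where c: "character_expansion c f" by blast
      assume "feichtinger_norm f = 0"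
      then have "cmod (c \<gamma>) = 0" if "\<gamma> \<in> ?G" for \<gamma>
        using c that unfolding N[OF c]
        by (intro nonneg_infsum_le_0D[where A = ?G and f = "\<lambda>\<gamma>. cmod (c \<gamma>)"])
          (auto simp: character_expansion_def)
      then show "f = (\<lambda>x. 0)"
        by (intro character_expansion_determines[OF c character_expansion_zero]) auto
    next
      assume "f = (\<lambda>x. 0)" then show "feichtinger_norm f = 0" by (simp add: N[OF CE(3)])
    qed
    show "feichtinger_norm (\<lambda>x. r * f x) = cmod r * feichtinger_norm f" if f: "f \<in> ?C"
    proof -
      from f obtain c where c: "character_expansion c f" by blast
      show ?thesis by (simp add: N[OF c] N[OF CE(2)[OF c]] norm_mult infsum_cmult_right')
    qed
    show "feichtinger_norm (\<lambda>x. f x + g x) \<le> feichtinger_norm f + feichtinger_norm g"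
      if fg: "f \<in> ?C" "g \<in> ?C"
    proof -
      from fg obtain c d where cd: "character_expansion c f" "character_expansion d g" by blast
      show ?thesis unfolding N[OF cd(1)] N[OF cd(2)] N[OF CE(1)[OF cd]]
        by (rule character_expansion_add(2)[OF cd])
    qed
    show "feichtinger_norm (convolution M f g) \<le> feichtinger_norm f * feichtinger_norm g"
      if fg: "f \<in> ?C" "g \<in> ?C"
    proof -
      from fg obtain c d where cd: "character_expansion c f" "character_expansion d g" by blast
      show ?thesis unfolding N[OF cd(1)] N[OF cd(2)] N[OF CE(4)[OF cd]]
        by (rule character_expansion_convolution(2)[OF M cd])
    qed
    show "convolution M (convolution M f g) h = convolution M f (convolution M g h)"
      if fgh: "f \<in> ?C" "g \<in> ?C" "h \<in> ?C"
    proof -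
      from fgh obtain a b c where a: "character_expansion a f" and b: "character_expansion b g"
        and c: "character_expansion c h" by blast
      show ?thesis
        by (rule character_expansion_determines[OF CE(4)[OF CE(4)[OF a b] c] CE(4)[OF a CE(4)[OF b c]]]) simp
    qed
    have conv_add_right: "convolution M f (\<lambda>x. g x + h x) = (\<lambda>x. convolution M f g x + convolution M f h x)"
      if fgh: "f \<in> ?C" "g \<in> ?C" "h \<in> ?C" for f g h
    proof -
      from fgh obtain a b c where a: "character_expansion a f" and b: "character_expansion b g"
        and c: "character_expansion c h" by blast
      show ?thesis
        by (rule character_expansion_determines[OF CE(4)[OF a CE(1)[OF b c]] CE(1)[OF CE(4)[OF a b] CE(4)[OF a c]]])
          (simp add: algebra_simps)
    qed
    have conv_scale_right: "convolution M f (\<lambda>x. r * g x) = (\<lambda>x. r * convolution M f g x)"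
      if fg: "f \<in> ?C" "g \<in> ?C" for f g r
    proof -
      from fg obtain a b where a: "character_expansion a f" and b: "character_expansion b g" by blast
      show ?thesis
        by (rule character_expansion_determines[OF CE(4)[OF a CE(2)[OF b]] CE(2)[OF CE(4)[OF a b]]])
          (simp add: algebra_simps)
    qed
    have comm: "convolution M f g = convolution M g f" if fg: "f \<in> ?C" "g \<in> ?C" for f g
    proof -
      from fg obtain a b where a: "character_expansion a f" and b: "character_expansion b g" by blast
      show ?thesis
        by (rule character_expansion_determines[OF CE(4)[OF a b] CE(4)[OF b a]]) simp
    qed
    show "(\<forall>g\<in>?C. convolution M f g \<in> ?C) \<and>
      (\<forall>g\<in>?C. \<forall>h\<in>?C. convolution M f (\<lambda>x. g x + h x) = (\<lambda>x. convolution M f g x + convolution M f h x)) \<and>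
      (\<forall>r. \<forall>g\<in>?C. convolution M f (\<lambda>x. r * g x) = (\<lambda>x. r * convolution M f g x))" if "f \<in> ?C"
      using that conv_add_right conv_scale_right closed(1) by blast
    show "(\<forall>f\<in>?C. convolution M f g \<in> ?C) \<and>
      (\<forall>f\<in>?C. \<forall>h\<in>?C. convolution M (\<lambda>x. f x + h x) g = (\<lambda>x. convolution M f g x + convolution M h g x)) \<and>
      (\<forall>r. \<forall>f\<in>?C. convolution M (\<lambda>x. r * f x) g = (\<lambda>x. r * convolution M f g x))" if g: "g \<in> ?C"
    proof (intro conjI ballI allI)
      fix f h :: "'g \<Rightarrow> complex" and r assume f: "f \<in> ?C"
      show "convolution M f g \<in> ?C" by (rule closed(1)[OF f g])
      show "convolution M (\<lambda>x. r * f x) g = (\<lambda>x. r * convolution M f g x)"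
        unfolding comm[OF closed(3)[OF f f] g] comm[OF f g] by (rule conv_scale_right[OF g f])
      assume h: "h \<in> ?C"
      show "convolution M (\<lambda>x. f x + h x) g = (\<lambda>x. convolution M f g x + convolution M h g x)"
        unfolding comm[OF closed(2)[OF f h] g] comm[OF f g] comm[OF h g] by (rule conv_add_right[OF g f h])
    qed
  next
    fix \<sigma> :: "nat \<Rightarrow> 'g \<Rightarrow> complex"
    assume "\<And>n. \<sigma> n \<in> ?C"
      "\<And>e. 0 < e \<Longrightarrow> \<exists>N. \<forall>m\<ge>N. \<forall>n\<ge>N. feichtinger_norm (\<lambda>x. \<sigma> m x - \<sigma> n x) < e"
    then show "\<exists>l\<in>?C. (\<lambda>n. feichtinger_norm (\<lambda>x. \<sigma> n x - l x)) \<longlonglongrightarrow> 0" by (rule complete)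
  qed (auto simp: algebra_simps)
qed

end

theory Submission
  imports Defs
begin

text \<open>
  The Fourier coefficients at a sequence of distinct characters map the algebra homomorphically onto
  \<open>\<ell>\<^sup>1\<close> with pointwise multiplication.  That quotient is not approximately amenable:
  bounded matrices \<open>G\<close> bordered by a column \<open>p\<close> and a row \<open>q\<close> form a bimodule with
  \<open>(G, p, q) \<cdot> a = (a\<^sub>i G\<^sub>i\<^sub>j, a\<^sub>i p\<^sub>i, \<Sum>\<^sub>i a\<^sub>i G\<^sub>i\<^sub>j)\<close> and symmetrically on the left, and
  \<open>a \<mapsto> (\<Sum>\<^sub>i a\<^sub>i p\<^sub>i - \<Sum>\<^sub>j a\<^sub>j q\<^sub>j)\<close> is a derivation into its dual.  Cut the index
  set into blocks \<open>B\<^sub>k\<close> of size \<open>4\<^sup>k\<close>.  Let \<open>a\<close> be \<open>8\<^sup>-\<^sup>k\<close> on \<open>B\<^sub>k \<union> B\<^sub>k\<^sub>+\<^sub>1\<close> for even \<open>k\<close>, and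
  \<open>b\<close> the same for odd \<open>k\<close>.  If the inner derivation of \<open>\<phi>\<close> is close to the given one at \<open>a\<close>
  and \<open>b\<close>, then testing on the indicator of \<open>B\<^sub>k \<times> B\<^sub>k\<^sub>+\<^sub>1\<close> shows that the mean of \<open>\<phi>\<close> over the border
  at \<open>B\<^sub>k\<close> hardly changes with \<open>k\<close>.  It is near 1 for \<open>k = 0\<close>, yet at most \<open>\<parallel>\<phi>\<parallel> / 4\<^sup>k\<close>.

  That an infinite compact abelian group has infinitely many characters is proved without the
  Peter--Weyl theorem.  For a hermitian continuous function \<open>k\<close>, the normalised even convolution powers converge
  uniformly to a convolution idempotent \<open>e\<close>, a finite rank projection; a minimal projection is a multiple of a
  character.  If there were only finitely many characters, then subtracting its Fourier series from
  a function supported near 0 would give a nonzero \<open>k\<close> orthogonal to all of them, and a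
  character below \<open>e\<close> would be a new one.
\<close>

section \<open>A bimodule over algebras that map onto an l1 space\<close>

definition l1 :: "('i \<Rightarrow> complex) \<Rightarrow> bool" where
  "l1 c \<longleftrightarrow> (\<lambda>i. cmod (c i)) summable_on UNIV"

definition l1_norm :: "('i \<Rightarrow> complex) \<Rightarrow> real" where
  "l1_norm c = (\<Sum>\<^sub>\<infinity>i. cmod (c i))"

definition bdd :: "('p \<Rightarrow> complex) \<Rightarrow> bool" where
  "bdd x \<longleftrightarrow> bdd_above (range (\<lambda>p. cmod (x p)))"

definition sup_norm :: "('p \<Rightarrow> complex) \<Rightarrow> real" where
  "sup_norm x = (SUP p. cmod (x p))"

lemma bddI: "(\<And>p. cmod (x p) \<le> K) \<Longrightarrow> bdd x"
  unfolding bdd_def by (rule bdd_aboveI[of _ K]) auto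

lemma sup_norm_upper: "bdd x \<Longrightarrow> cmod (x p) \<le> sup_norm x"
  unfolding bdd_def sup_norm_def by (rule cSUP_upper) auto

lemma sup_norm_least: "(\<And>p. cmod (x p) \<le> K) \<Longrightarrow> sup_norm x \<le> K"
  unfolding sup_norm_def by (rule cSUP_least) auto

lemma sup_norm_nonneg: "bdd x \<Longrightarrow> 0 \<le> sup_norm x"
  by (rule order_trans[OF norm_ge_zero sup_norm_upper])

lemma l1_norm_upper: "l1 c \<Longrightarrow> cmod (c i) \<le> l1_norm c"
  using finite_sum_le_infsum[of "\<lambda>i. cmod (c i)" UNIV "{i}"] by (simp add: l1_def l1_norm_def)

lemma l1_norm_nonneg: "0 \<le> l1_norm c"
  unfolding l1_norm_def by (rule infsum_nonneg) simp

lemma bdd_add: assumes "bdd x" "bdd y" shows "bdd (\<lambda>p. x p + y p)"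
proof (rule bddI)
  show "cmod (x p + y p) \<le> sup_norm x + sup_norm y" for p
    by (rule norm_triangle_le[OF add_mono[OF sup_norm_upper sup_norm_upper]]) (rule assms)+
qed

lemma bdd_scale: assumes "bdd x" shows "bdd (\<lambda>p. r * x p)"
proof (rule bddI)
  show "cmod (r * x p) \<le> cmod r * sup_norm x" for p
    unfolding norm_mult by (rule mult_left_mono[OF sup_norm_upper[OF assms]]) simp
qed

lemma sup_norm_scale:
  assumes "bdd x" shows "sup_norm (\<lambda>p. r * x p) = cmod r * sup_norm x"
proof (rule antisym)
  show "sup_norm (\<lambda>p. r * x p) \<le> cmod r * sup_norm x"
    using sup_norm_upper[OF assms] by (intro sup_norm_least) (simp add: norm_mult mult_left_mono)
  show "cmod r * sup_norm x \<le> sup_norm (\<lambda>p. r * x p)"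
  proof (cases "r = 0")
    case True
    then show ?thesis by (simp add: sup_norm_def)
  next
    case False
    have "sup_norm x \<le> sup_norm (\<lambda>p. r * x p) / cmod r"
      using sup_norm_upper[OF bdd_scale[OF assms], of r] False
      by (intro sup_norm_least) (simp add: norm_mult field_simps)
    then show ?thesis using False by (simp add: field_simps)
  qed
qed

text \<open>The limit is taken pointwise. The Cauchy estimate is uniform in \<open>p\<close> and
  survives letting \<open>n\<close> tend to infinity, so the convergence is uniform.\<close>

lemma sup_norm_complete:
  fixes s :: "nat \<Rightarrow> 'p \<Rightarrow> complex"
  assumes b: "\<And>n. bdd (s n)"
    and c: "\<And>e. 0 < e \<Longrightarrow> \<exists>N. \<forall>m\<ge>N. \<forall>n\<ge>N. sup_norm (\<lambda>p. s m p - s n p) < e"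
  shows "\<exists>l. bdd l \<and> (\<lambda>n. sup_norm (\<lambda>p. s n p - l p)) \<longlonglongrightarrow> 0"
proof -
  have bd: "bdd (\<lambda>p. s m p - s n p)" for m n
    using bdd_add[OF b bdd_scale[OF b], of m "-1" n] by simp
  have "Cauchy (\<lambda>n. s n p)" for p
  proof (rule CauchyI)
    fix e :: real assume "0 < e"
    then obtain N where "\<forall>m\<ge>N. \<forall>n\<ge>N. sup_norm (\<lambda>p. s m p - s n p) < e" using c by blast
    moreover have "cmod (s m p - s n p) \<le> sup_norm (\<lambda>p. s m p - s n p)" for m n
      using sup_norm_upper[OF bd[of m n], of p] .
    ultimately show "\<exists>N. \<forall>m\<ge>N. \<forall>n\<ge>N. cmod (s m p - s n p) < e"
      by (meson le_less_trans)
  qed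
  then obtain l where l: "\<And>p. (\<lambda>n. s n p) \<longlonglongrightarrow> l p"
    unfolding Cauchy_convergent_iff convergent_def by metis
  have lim: "cmod (s m p - l p) \<le> e"
    if "m \<ge> N" "\<forall>m\<ge>N. \<forall>n\<ge>N. sup_norm (\<lambda>p. s m p - s n p) < e" for m N e p
  proof (rule tendsto_upperbound)
    show "(\<lambda>n. cmod (s m p - s n p)) \<longlonglongrightarrow> cmod (s m p - l p)" by (intro tendsto_intros l)
    show "\<forall>\<^sub>F n in sequentially. cmod (s m p - s n p) \<le> e"
      unfolding eventually_sequentially
    proof (intro exI allI impI)
      fix n assume "N \<le> n"
      then have "sup_norm (\<lambda>p. s m p - s n p) < e" using that by blast
      then show "cmod (s m p - s n p) \<le> e" using sup_norm_upper[OF bd[of m n], of p] by linarith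
    qed
  qed simp
  have "bdd l"
  proof -
    obtain N where "\<forall>m\<ge>N. \<forall>n\<ge>N. sup_norm (\<lambda>p. s m p - s n p) < 1" using c[of 1] by auto
    then have 1: "cmod (s N p - l p) \<le> 1" for p using lim[of N N 1 p] by blast
    have "cmod (l p) \<le> sup_norm (s N) + 1" for p
      using sup_norm_upper[OF b, of N p] norm_triangle_sub[of "l p" "s N p"] 1[of p]
        norm_minus_commute[of "s N p" "l p"]
      by linarith
    then show ?thesis by (rule bddI)
  qed
  moreover have "(\<lambda>n. sup_norm (\<lambda>p. s n p - l p)) \<longlonglongrightarrow> 0"
  proof (rule LIMSEQ_I)
    fix e :: real assume "0 < e"
    then obtain N where N: "\<forall>m\<ge>N. \<forall>n\<ge>N. sup_norm (\<lambda>p. s m p - s n p) < e / 2"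
      using c[of "e / 2"] by auto
    have "sup_norm (\<lambda>p. s n p - l p) \<le> e / 2" if "n \<ge> N" for n
      by (rule sup_norm_least) (rule lim[OF that N])
    have "0 \<le> sup_norm (\<lambda>p. s n p - l p)" for n
      using bdd_add[OF b bdd_scale[OF \<open>bdd l\<close>], of n "-1"] by (intro sup_norm_nonneg) simp
    show "\<exists>no. \<forall>n\<ge>no. norm (sup_norm (\<lambda>p. s n p - l p) - 0) < e"
    proof (intro exI allI impI)
      fix n assume "N \<le> n"
      then have "sup_norm (\<lambda>p. s n p - l p) \<le> e / 2" by fact
      then show "norm (sup_norm (\<lambda>p. s n p - l p) - 0) < e"
        using \<open>0 \<le> sup_norm (\<lambda>p. s n p - l p)\<close> \<open>0 < e\<close> by simp
    qed
  qed
  ultimately show ?thesis by blast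
qed

text \<open>The reindexing \<open>h\<close> lets one estimate serve the rows, the columns and both
  borders of a matrix.\<close>

lemma l1_mult_bdd:
  assumes "l1 c" "bdd x"
  shows "l1 (\<lambda>j. c j * x (h j))" "(\<lambda>j. c j * x (h j)) summable_on UNIV"
    "cmod (\<Sum>\<^sub>\<infinity>j. c j * x (h j)) \<le> l1_norm c * sup_norm x"
proof -
  have s: "(\<lambda>j. cmod (c j) * sup_norm x) summable_on UNIV"
    using assms(1) unfolding l1_def by (rule summable_on_cmult_left)
  have le: "cmod (c j * x (h j)) \<le> cmod (c j) * sup_norm x" for j
    using sup_norm_upper[OF assms(2)] by (simp add: norm_mult mult_left_mono)
  show 1: "l1 (\<lambda>j. c j * x (h j))"
    unfolding l1_def by (rule summable_on_comparison_test[OF s]) (use le in auto)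
  then show 2: "(\<lambda>j. c j * x (h j)) summable_on UNIV"
    unfolding l1_def by (rule abs_summable_summable)
  have "cmod (\<Sum>\<^sub>\<infinity>j. c j * x (h j)) \<le> (\<Sum>\<^sub>\<infinity>j. cmod (c j) * sup_norm x)"
    by (rule norm_infsum_le[OF has_sum_infsum[OF 2] has_sum_infsum[OF s]]) (use le in auto)
  then show "cmod (\<Sum>\<^sub>\<infinity>j. c j * x (h j)) \<le> l1_norm c * sup_norm x"
    by (simp add: l1_norm_def infsum_cmult_left')
qed

lemma l1_row_column:
  assumes "l1 c" "bdd x"
  shows "(\<lambda>j. c j * x (Some i, Some j)) summable_on UNIV"
    "(\<lambda>i. c i * x (Some i, Some j)) summable_on UNIV"
    "(\<lambda>i. c i * x (Some i, None)) summable_on UNIV"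
    "(\<lambda>j. c j * x (None, Some j)) summable_on UNIV"
  using l1_mult_bdd(2)[OF assms] by auto

text \<open>
  The index \<^term>\<open>None\<close> plays the role of a point at infinity: a point of the bimodule is a bounded
  matrix on the index set extended by one row and one column.
\<close>

type_synonym 'i bmatrix = "'i option \<times> 'i option \<Rightarrow> complex"

text \<open>The weighted row sums overwrite the border column. As the old entries there are
  forgotten, the action is multiplicative in \<open>c\<close>.\<close>

fun left_mult :: "('i \<Rightarrow> complex) \<Rightarrow> 'i bmatrix \<Rightarrow> 'i bmatrix" where
  "left_mult c x (Some i, Some j) = c j * x (Some i, Some j)"
| "left_mult c x (Some i, None) = (\<Sum>\<^sub>\<infinity>j. c j * x (Some i, Some j))"
| "left_mult c x (None, Some j) = c j * x (None, Some j)"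
| "left_mult c x (None, None) = 0"

fun right_mult :: "('i \<Rightarrow> complex) \<Rightarrow> 'i bmatrix \<Rightarrow> 'i bmatrix" where
  "right_mult c x (Some i, Some j) = c i * x (Some i, Some j)"
| "right_mult c x (Some i, None) = c i * x (Some i, None)"
| "right_mult c x (None, Some j) = (\<Sum>\<^sub>\<infinity>i. c i * x (Some i, Some j))"
| "right_mult c x (None, None) = 0"

text \<open>Formally the commutator with the functional that adds up the border column and the
  border row and subtracts the sum of the inner matrix. On an infinite index set these sums need not
  converge, so this does not exhibit the derivation as inner.\<close>

definition border_sum :: "('i \<Rightarrow> complex) \<Rightarrow> 'i bmatrix \<Rightarrow> complex" where
  "border_sum c x = (\<Sum>\<^sub>\<infinity>i. c i * x (Some i, None)) - (\<Sum>\<^sub>\<infinity>j. c j * x (None, Some j))"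

lemma left_mult_bound:
  assumes "l1 c" "bdd x" shows "cmod (left_mult c x p) \<le> l1_norm c * sup_norm x"
proof -
  have "cmod (c j * x q) \<le> l1_norm c * sup_norm x" for j q
    unfolding norm_mult by (intro mult_mono l1_norm_upper sup_norm_upper assms l1_norm_nonneg) simp
  then show ?thesis
    using l1_mult_bdd(3)[OF assms] mult_nonneg_nonneg[OF l1_norm_nonneg sup_norm_nonneg[OF assms(2)]]
    by (cases "(c, x, p)" rule: left_mult.cases) auto
qed

lemma right_mult_bound:
  assumes "l1 c" "bdd x" shows "cmod (right_mult c x p) \<le> l1_norm c * sup_norm x"
proof -
  have "cmod (c j * x q) \<le> l1_norm c * sup_norm x" for j q
    unfolding norm_mult by (intro mult_mono l1_norm_upper sup_norm_upper assms l1_norm_nonneg) simp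
  then show ?thesis
    using l1_mult_bdd(3)[OF assms] mult_nonneg_nonneg[OF l1_norm_nonneg sup_norm_nonneg[OF assms(2)]]
    by (cases "(c, x, p)" rule: right_mult.cases) auto
qed

lemma left_mult_linear:
  assumes "l1 c" "l1 d" "bdd x" "bdd y"
  shows "left_mult c (\<lambda>p. x p + y p) = (\<lambda>p. left_mult c x p + left_mult c y p)"
    "left_mult c (\<lambda>p. r * x p) = (\<lambda>p. r * left_mult c x p)"
    "left_mult (\<lambda>i. c i + d i) x = (\<lambda>p. left_mult c x p + left_mult d x p)"
    "left_mult (\<lambda>i. r * c i) x = (\<lambda>p. r * left_mult c x p)"
    "left_mult (\<lambda>i. c i * d i) x = left_mult c (left_mult d x)"
proof -
  show "left_mult c (\<lambda>p. x p + y p) = (\<lambda>p. left_mult c x p + left_mult c y p)"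
  proof
    fix p show "left_mult c (\<lambda>p. x p + y p) p = left_mult c x p + left_mult c y p"
      by (cases "(c, x, p)" rule: left_mult.cases)
        (auto simp: algebra_simps infsum_add l1_row_column assms)
  qed
  show "left_mult c (\<lambda>p. r * x p) = (\<lambda>p. r * left_mult c x p)"
  proof
    fix p show "left_mult c (\<lambda>p. r * x p) p = r * left_mult c x p"
      by (cases "(c, x, p)" rule: left_mult.cases)
        (auto simp: mult.left_commute[of _ r] infsum_cmult_right')
  qed
  show "left_mult (\<lambda>i. c i + d i) x = (\<lambda>p. left_mult c x p + left_mult d x p)"
  proof
    fix p show "left_mult (\<lambda>i. c i + d i) x p = left_mult c x p + left_mult d x p"
      by (cases "(c, x, p)" rule: left_mult.cases)
        (auto simp: algebra_simps infsum_add l1_row_column assms)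
  qed
  show "left_mult (\<lambda>i. r * c i) x = (\<lambda>p. r * left_mult c x p)"
  proof
    fix p show "left_mult (\<lambda>i. r * c i) x p = r * left_mult c x p"
      by (cases "(c, x, p)" rule: left_mult.cases)
        (auto simp: mult.assoc infsum_cmult_right')
  qed
  show "left_mult (\<lambda>i. c i * d i) x = left_mult c (left_mult d x)"
  proof
    fix p show "left_mult (\<lambda>i. c i * d i) x p = left_mult c (left_mult d x) p"
      by (cases "(c, x, p)" rule: left_mult.cases) (auto simp: mult.assoc)
  qed
qed

text \<open>Row sums land only in the border column and column sums only in the border row. Hence
  commuting the two actions merely moves a scalar into a single sum; no double sum arises.\<close>

lemma right_mult_linear:
  assumes "l1 c" "l1 d" "bdd x" "bdd y"
  shows "right_mult c (\<lambda>p. x p + y p) = (\<lambda>p. right_mult c x p + right_mult c y p)"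
    "right_mult c (\<lambda>p. r * x p) = (\<lambda>p. r * right_mult c x p)"
    "right_mult (\<lambda>i. c i + d i) x = (\<lambda>p. right_mult c x p + right_mult d x p)"
    "right_mult (\<lambda>i. r * c i) x = (\<lambda>p. r * right_mult c x p)"
    "right_mult (\<lambda>i. c i * d i) x = right_mult d (right_mult c x)"
    "right_mult d (left_mult c x) = left_mult c (right_mult d x)"
proof -
  show "right_mult c (\<lambda>p. x p + y p) = (\<lambda>p. right_mult c x p + right_mult c y p)"
  proof
    fix p show "right_mult c (\<lambda>p. x p + y p) p = right_mult c x p + right_mult c y p"
      by (cases "(c, x, p)" rule: right_mult.cases)
        (auto simp: algebra_simps infsum_add l1_row_column assms)
  qed
  show "right_mult c (\<lambda>p. r * x p) = (\<lambda>p. r * right_mult c x p)"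
  proof
    fix p show "right_mult c (\<lambda>p. r * x p) p = r * right_mult c x p"
      by (cases "(c, x, p)" rule: right_mult.cases)
        (auto simp: mult.left_commute[of _ r] infsum_cmult_right')
  qed
  show "right_mult (\<lambda>i. c i + d i) x = (\<lambda>p. right_mult c x p + right_mult d x p)"
  proof
    fix p show "right_mult (\<lambda>i. c i + d i) x p = right_mult c x p + right_mult d x p"
      by (cases "(c, x, p)" rule: right_mult.cases)
        (auto simp: algebra_simps infsum_add l1_row_column assms)
  qed
  show "right_mult (\<lambda>i. r * c i) x = (\<lambda>p. r * right_mult c x p)"
  proof
    fix p show "right_mult (\<lambda>i. r * c i) x p = r * right_mult c x p"
      by (cases "(c, x, p)" rule: right_mult.cases)
        (auto simp: mult.assoc infsum_cmult_right')
  qed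
  show "right_mult (\<lambda>i. c i * d i) x = right_mult d (right_mult c x)"
  proof
    fix p show "right_mult (\<lambda>i. c i * d i) x p = right_mult d (right_mult c x) p"
      by (cases "(c, x, p)" rule: right_mult.cases) (auto simp: mult_ac)
  qed
  show "right_mult d (left_mult c x) = left_mult c (right_mult d x)"
  proof
    fix p show "right_mult d (left_mult c x) p = left_mult c (right_mult d x) p"
      by (cases "(c, x, p)" rule: right_mult.cases)
        (auto simp: mult.left_commute simp flip: infsum_cmult_right')
  qed
qed

text \<open>The two mixed terms are the iterated sums of
  \<open>c i * d j * x (Some i, Some j)\<close> in the two orders, with opposite signs. The double
  family is absolutely summable, so they cancel.\<close>

lemma border_sum_product:
  assumes c: "l1 c" and d: "l1 d" and x: "bdd x"
  shows "border_sum (\<lambda>i. c i * d i) x = border_sum d (right_mult c x) + border_sum c (left_mult d x)"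
proof -
  have "(\<lambda>(i, j). c i * d j * x (Some i, Some j)) summable_on UNIV \<times> UNIV"
  proof -
    have "(\<lambda>(i, j). cmod (c i) * cmod (d j)) summable_on UNIV \<times> UNIV"
    proof (rule summable_on_SigmaI)
      show "(\<lambda>i. cmod (c i) * l1_norm d) summable_on UNIV"
        using c unfolding l1_def by (rule summable_on_cmult_left)
      show "((\<lambda>j. case (i, j) of (i, j) \<Rightarrow> cmod (c i) * cmod (d j)) has_sum cmod (c i) * l1_norm d) UNIV" for i
        using has_sum_cmult_right[OF has_sum_infsum[OF d[unfolded l1_def]], of "cmod (c i)"]
        by (simp add: l1_norm_def)
    qed simp
    from summable_on_cmult_left[OF this, of "sup_norm x"]
    have "(\<lambda>p. cmod (case p of (i, j) \<Rightarrow> c i * d j * x (Some i, Some j))) summable_on UNIV \<times> UNIV"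
      by (rule summable_on_comparison_test)
        (auto simp: norm_mult intro!: mult_left_mono sup_norm_upper[OF x])
    then show ?thesis by (rule abs_summable_summable)
  qed
  then have "(\<Sum>\<^sub>\<infinity>i. \<Sum>\<^sub>\<infinity>j. c i * d j * x (Some i, Some j)) = (\<Sum>\<^sub>\<infinity>j. \<Sum>\<^sub>\<infinity>i. c i * d j * x (Some i, Some j))"
    by (rule infsum_swap_banach)
  moreover have "(\<Sum>\<^sub>\<infinity>i. c i * d j * x (Some i, Some j)) = d j * (\<Sum>\<^sub>\<infinity>i. c i * x (Some i, Some j))" for j
    by (subst infsum_cmult_right'[symmetric]) (simp only: mult_ac)
  moreover have "(\<Sum>\<^sub>\<infinity>j. c i * d j * x (Some i, Some j)) = c i * (\<Sum>\<^sub>\<infinity>j. d j * x (Some i, Some j))" for i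
    by (subst infsum_cmult_right'[symmetric]) (simp only: mult_ac)
  ultimately have "(\<Sum>\<^sub>\<infinity>i. c i * (\<Sum>\<^sub>\<infinity>j. d j * x (Some i, Some j))) = (\<Sum>\<^sub>\<infinity>j. d j * (\<Sum>\<^sub>\<infinity>i. c i * x (Some i, Some j)))"
    by (simp only:)
  moreover have "(\<Sum>\<^sub>\<infinity>i. c i * d i * x (Some i, None)) = (\<Sum>\<^sub>\<infinity>i. d i * (c i * x (Some i, None)))"
    "(\<Sum>\<^sub>\<infinity>i. c i * d i * x (None, Some i)) = (\<Sum>\<^sub>\<infinity>i. c i * (d i * x (None, Some i)))"
    by (simp_all only: mult_ac)
  ultimately show ?thesis by (simp only: border_sum_def left_mult.simps right_mult.simps) simp
qed

lemma bdd_left_mult: "\<lbrakk>l1 c; bdd x\<rbrakk> \<Longrightarrow> bdd (left_mult c x)"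
  by (rule bddI[OF left_mult_bound])

lemma bdd_right_mult: "\<lbrakk>l1 c; bdd x\<rbrakk> \<Longrightarrow> bdd (right_mult c x)"
  by (rule bddI[OF right_mult_bound])

lemma border_sum_linear:
  assumes "l1 c" "l1 d" "bdd x" "bdd y"
  shows "border_sum c (\<lambda>p. x p + y p) = border_sum c x + border_sum c y"
    "border_sum c (\<lambda>p. r * x p) = r * border_sum c x"
    "border_sum (\<lambda>i. c i + d i) x = border_sum c x + border_sum d x"
    "border_sum (\<lambda>i. r * c i) x = r * border_sum c x"
    "cmod (border_sum c x) \<le> 2 * l1_norm c * sup_norm x"
proof -
  show "border_sum c (\<lambda>p. x p + y p) = border_sum c x + border_sum c y"
    "border_sum (\<lambda>i. c i + d i) x = border_sum c x + border_sum d x"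
    by (simp_all add: border_sum_def algebra_simps infsum_add l1_row_column assms)
  show "border_sum c (\<lambda>p. r * x p) = r * border_sum c x"
    by (simp add: border_sum_def mult.left_commute[of _ r] infsum_cmult_right' right_diff_distrib)
  show "border_sum (\<lambda>i. r * c i) x = r * border_sum c x"
    by (simp add: border_sum_def mult.assoc infsum_cmult_right' right_diff_distrib)
  have "cmod (border_sum c x) \<le> l1_norm c * sup_norm x + l1_norm c * sup_norm x"
    unfolding border_sum_def by (intro norm_triangle_le_diff add_mono l1_mult_bdd(3) assms)
  then show "cmod (border_sum c x) \<le> 2 * l1_norm c * sup_norm x" by simp
qed

text \<open>A contractive homomorphism onto l1 with pointwise product. Module and derivation are
  pulled back along it, so no quotient algebra has to be formed.\<close>

locale l1_image = complex_banach_algebra A for A :: "('a, 'm) calgebra_scheme" +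
  fixes coef :: "'a \<Rightarrow> 'i \<Rightarrow> complex"
  assumes coef_l1: "a \<in> carrier A \<Longrightarrow> l1 (coef a)"
    and coef_norm: "a \<in> carrier A \<Longrightarrow> l1_norm (coef a) \<le> vnorm A a"
    and coef_add: "\<lbrakk>a \<in> carrier A; b \<in> carrier A\<rbrakk> \<Longrightarrow> coef (vadd A a b) = (\<lambda>i. coef a i + coef b i)"
    and coef_scale: "a \<in> carrier A \<Longrightarrow> coef (vscale A r a) = (\<lambda>i. r * coef a i)"
    and coef_mult: "\<lbrakk>a \<in> carrier A; b \<in> carrier A\<rbrakk> \<Longrightarrow> coef (vmult A a b) = (\<lambda>i. coef a i * coef b i)"
    and coef_surj: "l1 c \<Longrightarrow> \<exists>a\<in>carrier A. coef a = c"
begin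

definition matrix_module :: "('a, 'i bmatrix) cbimodule" where
  "matrix_module =
    \<lparr>carrier = {x. bdd x}, vadd = (\<lambda>x y p. x p + y p), vzero = (\<lambda>p. 0),
     vscale = (\<lambda>r x p. r * x p), vnorm = sup_norm,
     lact = (\<lambda>a. left_mult (coef a)), ract = (\<lambda>x a. right_mult (coef a) x)\<rparr>"

lemma matrix_module_simps:
  "carrier matrix_module = {x. bdd x}" "vadd matrix_module x y = (\<lambda>p. x p + y p)"
  "vzero matrix_module = (\<lambda>p. 0)" "vscale matrix_module r x = (\<lambda>p. r * x p)"
  "vnorm matrix_module = sup_norm" "lact matrix_module a x = left_mult (coef a) x"
  "ract matrix_module x a = right_mult (coef a) x" "vminus matrix_module x y = (\<lambda>p. x p - y p)"
  by (simp_all add: matrix_module_def vminus_def)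

lemma banach_bimodule_matrix_module: "banach_bimodule A matrix_module"
proof (unfold_locales, unfold matrix_module_simps linear_map_def)
  fix x y z :: "'i bmatrix" and r s :: complex
  show "(\<lambda>p. x p + y p) \<in> {x. bdd x}" if "x \<in> {x. bdd x}" "y \<in> {x. bdd x}"
    using that by (simp add: bdd_add)
  show "(\<lambda>p. 0) \<in> {x. bdd x}" by (simp add: bdd_def)
  show "(\<lambda>p. r * x p) \<in> {x. bdd x}" if "x \<in> {x. bdd x}" using that by (simp add: bdd_scale)
  show "0 \<le> sup_norm x" if "x \<in> {x. bdd x}" using that by (simp add: sup_norm_nonneg)
  show "sup_norm x = 0 \<longleftrightarrow> x = (\<lambda>p. 0)" if "x \<in> {x. bdd x}"
    using that sup_norm_upper[of x] by (fastforce simp: sup_norm_def)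
  show "sup_norm (\<lambda>p. r * x p) = cmod r * sup_norm x" if "x \<in> {x. bdd x}"
    using that by (simp add: sup_norm_scale)
  show "sup_norm (\<lambda>p. x p + y p) \<le> sup_norm x + sup_norm y" if "x \<in> {x. bdd x}" "y \<in> {x. bdd x}"
  proof (rule sup_norm_least)
    show "cmod (x p + y p) \<le> sup_norm x + sup_norm y" for p
      using that by (intro norm_triangle_le[OF add_mono[OF sup_norm_upper sup_norm_upper]]) auto
  qed
next
  fix \<sigma> :: "nat \<Rightarrow> 'i bmatrix"
  assume "\<And>n. \<sigma> n \<in> {x. bdd x}"
    "\<And>e. 0 < e \<Longrightarrow> \<exists>N. \<forall>m\<ge>N. \<forall>n\<ge>N. sup_norm (\<lambda>p. \<sigma> m p - \<sigma> n p) < e"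
  then show "\<exists>l\<in>{x. bdd x}. (\<lambda>n. sup_norm (\<lambda>p. \<sigma> n p - l p)) \<longlonglongrightarrow> 0"
    using sup_norm_complete[of \<sigma>] by auto
next
  show "\<exists>K. \<forall>a\<in>carrier A. \<forall>x\<in>{x. bdd x}.
      sup_norm (left_mult (coef a) x) \<le> K * vnorm A a * sup_norm x \<and>
      sup_norm (right_mult (coef a) x) \<le> K * vnorm A a * sup_norm x"
  proof (intro exI[of _ 1] ballI conjI)
    fix a and x :: "'i bmatrix" assume a: "a \<in> carrier A" and "x \<in> {x. bdd x}"
    then have x: "bdd x" by simp
    have le: "l1_norm (coef a) * sup_norm x \<le> 1 * vnorm A a * sup_norm x"
      using coef_norm[OF a] sup_norm_nonneg[OF x] by (simp add: mult_right_mono)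
    show "sup_norm (left_mult (coef a) x) \<le> 1 * vnorm A a * sup_norm x"
      by (rule sup_norm_least, rule order_trans[OF left_mult_bound[OF coef_l1[OF a] x] le])
    show "sup_norm (right_mult (coef a) x) \<le> 1 * vnorm A a * sup_norm x"
      by (rule sup_norm_least, rule order_trans[OF right_mult_bound[OF coef_l1[OF a] x] le])
  qed
next
  fix a b and x :: "'i bmatrix" assume a: "a \<in> carrier A" and b: "b \<in> carrier A" and "x \<in> {x. bdd x}"
  then have x: "bdd x" by simp
  note c = coef_l1[OF a] coef_l1[OF b] x x
  show "left_mult (coef (vmult A a b)) x = left_mult (coef a) (left_mult (coef b) x)"
    by (simp only: coef_mult[OF a b] left_mult_linear(5)[OF c])
  show "right_mult (coef (vmult A a b)) x = right_mult (coef b) (right_mult (coef a) x)"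
    by (simp only: coef_mult[OF a b] right_mult_linear(5)[OF c])
  show "right_mult (coef b) (left_mult (coef a) x) = left_mult (coef a) (right_mult (coef b) x)"
    by (rule right_mult_linear(6)[OF c])
next
  fix a assume a: "a \<in> carrier A"
  note c = coef_l1[OF a]
  show "(\<forall>x\<in>{x. bdd x}. left_mult (coef a) x \<in> {x. bdd x}) \<and>
    (\<forall>x\<in>{x. bdd x}. \<forall>y\<in>{x. bdd x}. left_mult (coef a) (\<lambda>p. x p + y p) =
        (\<lambda>p. left_mult (coef a) x p + left_mult (coef a) y p)) \<and>
    (\<forall>r. \<forall>x\<in>{x. bdd x}. left_mult (coef a) (\<lambda>p. r * x p) = (\<lambda>p. r * left_mult (coef a) x p))"
    using left_mult_linear(1,2)[OF c c] bdd_left_mult[OF c] by simp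
  show "(\<forall>x\<in>{x. bdd x}. right_mult (coef a) x \<in> {x. bdd x}) \<and>
    (\<forall>x\<in>{x. bdd x}. \<forall>y\<in>{x. bdd x}. right_mult (coef a) (\<lambda>p. x p + y p) =
        (\<lambda>p. right_mult (coef a) x p + right_mult (coef a) y p)) \<and>
    (\<forall>r. \<forall>x\<in>{x. bdd x}. right_mult (coef a) (\<lambda>p. r * x p) = (\<lambda>p. r * right_mult (coef a) x p))"
    using right_mult_linear(1,2)[OF c c] bdd_right_mult[OF c] by simp
next
  fix x :: "'i bmatrix" assume "x \<in> {x. bdd x}"
  then have x: "bdd x" by simp
  show "(\<forall>a\<in>carrier A. left_mult (coef a) x \<in> {x. bdd x}) \<and>
    (\<forall>a\<in>carrier A. \<forall>b\<in>carrier A. left_mult (coef (vadd A a b)) x =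
        (\<lambda>p. left_mult (coef a) x p + left_mult (coef b) x p)) \<and>
    (\<forall>r. \<forall>a\<in>carrier A. left_mult (coef (vscale A r a)) x = (\<lambda>p. r * left_mult (coef a) x p))"
    using left_mult_linear(3,4)[OF coef_l1 coef_l1 x x] bdd_left_mult[OF coef_l1 x]
    by (simp add: coef_add coef_scale)
  show "(\<forall>a\<in>carrier A. right_mult (coef a) x \<in> {x. bdd x}) \<and>
    (\<forall>a\<in>carrier A. \<forall>b\<in>carrier A. right_mult (coef (vadd A a b)) x =
        (\<lambda>p. right_mult (coef a) x p + right_mult (coef b) x p)) \<and>
    (\<forall>r. \<forall>a\<in>carrier A. right_mult (coef (vscale A r a)) x = (\<lambda>p. r * right_mult (coef a) x p))"
    using right_mult_linear(3,4)[OF coef_l1 coef_l1 x x] bdd_right_mult[OF coef_l1 x]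
    by (simp add: coef_add coef_scale)
qed (auto simp: algebra_simps)

text \<open>The value 0 at unbounded matrices follows the convention of \<open>dual_bimodule\<close>
  for functionals.\<close>

definition border_derivation :: "'a \<Rightarrow> 'i bmatrix \<Rightarrow> complex" where
  "border_derivation a x = (if bdd x then border_sum (coef a) x else 0)"

text \<open>In the dual module an action on a functional precomposes it with the opposite action on
  points, which turns \<open>border_sum_product\<close> into the derivation identity.\<close>

lemma bounded_derivation_border:
  "bounded_derivation A (dual_bimodule matrix_module) border_derivation"
proof -
  let ?E = "dual_bimodule matrix_module"
  have mem: "border_derivation a \<in> carrier ?E" if a: "a \<in> carrier A" for a
  proof -
    note c = coef_l1[OF a]
    have "cmod (border_derivation a x) \<le> (2 * l1_norm (coef a)) * sup_norm x" if "bdd x" for x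
      using border_sum_linear(5)[OF c c that that] that by (simp add: border_derivation_def)
    then show ?thesis
      using border_sum_linear(1,2)[OF c c]
      by (auto simp: dual_bimodule_def matrix_module_simps border_derivation_def bdd_add bdd_scale)
  qed
  have norm: "vnorm ?E (border_derivation a) \<le> 2 * vnorm A a" if a: "a \<in> carrier A" for a
  proof -
    note c = coef_l1[OF a]
    have "(SUP x\<in>{x \<in> carrier matrix_module. vnorm matrix_module x \<le> 1}. cmod (border_derivation a x))
        \<le> 2 * vnorm A a"
    proof (rule cSUP_least)
      have "(\<lambda>p. 0) \<in> {x \<in> carrier matrix_module. vnorm matrix_module x \<le> 1}"
        by (simp add: matrix_module_simps bdd_def sup_norm_def)
      then show "{x \<in> carrier matrix_module. vnorm matrix_module x \<le> 1} \<noteq> {}" by blast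
      fix x assume "x \<in> {x \<in> carrier matrix_module. vnorm matrix_module x \<le> 1}"
      then have x: "bdd x" "sup_norm x \<le> 1" by (auto simp: matrix_module_simps)
      have "cmod (border_derivation a x) \<le> 2 * l1_norm (coef a) * sup_norm x"
        using border_sum_linear(5)[OF c c x(1) x(1)] x(1) by (simp add: border_derivation_def)
      also have "\<dots> \<le> 2 * l1_norm (coef a) * 1"
        using x(2) l1_norm_nonneg[of "coef a"] by (intro mult_left_mono) auto
      also have "\<dots> \<le> 2 * vnorm A a" using coef_norm[OF a] by simp
      finally show "cmod (border_derivation a x) \<le> 2 * vnorm A a" .
    qed
    then show ?thesis by (simp add: dual_bimodule_def)
  qed
  have lin: "linear_map A ?E border_derivation"
    unfolding linear_map_def
  proof (intro conjI ballI allI)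
    fix a b r assume a: "a \<in> carrier A"
    show "border_derivation a \<in> carrier ?E" by (rule mem[OF a])
    show "border_derivation (vscale A r a) = vscale ?E r (border_derivation a)"
      using border_sum_linear(4)[OF coef_l1[OF a] coef_l1[OF a]]
      by (auto simp: border_derivation_def dual_bimodule_def coef_scale[OF a] fun_eq_iff)
    assume b: "b \<in> carrier A"
    show "border_derivation (vadd A a b) = vadd ?E (border_derivation a) (border_derivation b)"
      using border_sum_linear(3)[OF coef_l1[OF a] coef_l1[OF b]]
      by (auto simp: border_derivation_def dual_bimodule_def coef_add[OF a b] fun_eq_iff)
  qed
  have "border_derivation (vmult A a b) =
      vadd ?E (lact ?E a (border_derivation b)) (ract ?E (border_derivation a) b)"
    if a: "a \<in> carrier A" and b: "b \<in> carrier A" for a b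
    using border_sum_product[OF coef_l1[OF a] coef_l1[OF b]]
    by (auto simp: border_derivation_def dual_bimodule_def coef_mult[OF a b] fun_eq_iff
        matrix_module_simps bdd_left_mult[OF coef_l1[OF b]] bdd_right_mult[OF coef_l1[OF a]])
  then show ?thesis
    using lin norm by (auto simp: bounded_derivation_def bounded_linear_map_def)
qed

text \<open>Approximate amenability is used at two elements only: some inner derivation in the
  filter is close to the border derivation at both. The dual norm is then read off at single points
  of the unit ball, which leaves a statement about sequences and matrices without
  \<open>A\<close>.\<close>

lemma near_inner_functional:
  fixes c d :: "'i \<Rightarrow> complex"
  assumes am: "approximately_amenable_in TYPE('i bmatrix) A" and c: "l1 c" and d: "l1 d" and e: "0 < e"
  obtains \<phi> K where
    "\<And>x y. \<lbrakk>bdd x; bdd y\<rbrakk> \<Longrightarrow> \<phi> (\<lambda>p. x p + y p) = \<phi> x + \<phi> y"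
    "\<And>r x. bdd x \<Longrightarrow> \<phi> (\<lambda>p. r * x p) = r * \<phi> x"
    "\<And>x. bdd x \<Longrightarrow> cmod (\<phi> x) \<le> K * sup_norm x"
    "\<And>x. \<lbrakk>bdd x; sup_norm x \<le> 1\<rbrakk> \<Longrightarrow> cmod (\<phi> (right_mult c x) - \<phi> (left_mult c x) - border_sum c x) \<le> e"
    "\<And>x. \<lbrakk>bdd x; sup_norm x \<le> 1\<rbrakk> \<Longrightarrow> cmod (\<phi> (right_mult d x) - \<phi> (left_mult d x) - border_sum d x) \<le> e"
proof -
  let ?E = "dual_bimodule matrix_module"
  obtain F where F: "F \<noteq> bot" "\<forall>\<^sub>F D in F. inner_derivation A ?E D"
    "\<And>a. a \<in> carrier A \<Longrightarrow> ((\<lambda>D. vnorm ?E (vminus ?E (D a) (border_derivation a))) \<longlongrightarrow> 0) F"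
    using am banach_bimodule_matrix_module bounded_derivation_border
    unfolding approximately_amenable_in_def approximately_inner_def by blast
  obtain a b where a: "a \<in> carrier A" "coef a = c" and b: "b \<in> carrier A" "coef b = d"
    using coef_surj c d by blast
  have "\<forall>\<^sub>F D in F. vnorm ?E (vminus ?E (D a) (border_derivation a)) < e"
    "\<forall>\<^sub>F D in F. vnorm ?E (vminus ?E (D b) (border_derivation b)) < e"
    using order_tendstoD(2)[OF F(3)] a b e by blast+
  then have "\<forall>\<^sub>F D in F. inner_derivation A ?E D \<and>
      vnorm ?E (vminus ?E (D a) (border_derivation a)) < e \<and>
      vnorm ?E (vminus ?E (D b) (border_derivation b)) < e"
    using F(2) by eventually_elim blast
  then obtain D where D: "inner_derivation A ?E D"
    "vnorm ?E (vminus ?E (D a) (border_derivation a)) < e"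
    "vnorm ?E (vminus ?E (D b) (border_derivation b)) < e"
    using eventually_happens'[OF F(1)] by blast
  then obtain \<phi> where \<phi>: "\<phi> \<in> carrier ?E"
    "\<And>a. a \<in> carrier A \<Longrightarrow> D a = vminus ?E (lact ?E a \<phi>) (ract ?E \<phi> a)"
    by (auto simp: inner_derivation_def)
  obtain K where K: "\<And>x. bdd x \<Longrightarrow> cmod (\<phi> x) \<le> K * sup_norm x"
    using \<phi>(1) by (auto simp: dual_bimodule_def matrix_module_simps)
  have main: "cmod (\<phi> (right_mult (coef a) x) - \<phi> (left_mult (coef a) x) - border_sum (coef a) x) \<le> e"
    if a: "a \<in> carrier A" and n: "vnorm ?E (vminus ?E (D a) (border_derivation a)) < e"
      and x: "bdd x" "sup_norm x \<le> 1" for a x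
  proof -
    define \<psi> where "\<psi> = vminus ?E (D a) (border_derivation a)"
    note c = coef_l1[OF a]
    have \<psi>: "\<psi> y = \<phi> (right_mult (coef a) y) - \<phi> (left_mult (coef a) y) - border_sum (coef a) y"
      if "bdd y" for y
      using that unfolding \<psi>_def \<phi>(2)[OF a]
      by (simp add: dual_bimodule_def vminus_def matrix_module_simps border_derivation_def)
    \<comment> \<open>The dual norm is a real supremum; it dominates the values of
      \<open>\<psi>\<close> only once these are known to be bounded on the unit ball.\<close>
    have bound: "cmod (\<psi> y) \<le> 2 * \<bar>K\<bar> * l1_norm (coef a) + 2 * l1_norm (coef a)"
      if y: "bdd y" "sup_norm y \<le> 1" for y
    proof -
      have l: "l1_norm (coef a) * sup_norm y \<le> l1_norm (coef a)"
        using y l1_norm_nonneg[of "coef a"] by (simp add: mult_left_le)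
      have f: "cmod (\<phi> z) \<le> \<bar>K\<bar> * l1_norm (coef a)" if z: "bdd z" "sup_norm z \<le> l1_norm (coef a)" for z
      proof -
        have "cmod (\<phi> z) \<le> K * sup_norm z" by (rule K[OF z(1)])
        also have "\<dots> \<le> \<bar>K\<bar> * sup_norm z" using sup_norm_nonneg[OF z(1)] by (intro mult_right_mono) auto
        also have "\<dots> \<le> \<bar>K\<bar> * l1_norm (coef a)" using z(2) by (intro mult_left_mono) auto
        finally show ?thesis .
      qed
      have "sup_norm (right_mult (coef a) y) \<le> l1_norm (coef a)"
        by (rule sup_norm_least, rule order_trans[OF right_mult_bound[OF c y(1)] l])
      moreover have "sup_norm (left_mult (coef a) y) \<le> l1_norm (coef a)"
        by (rule sup_norm_least, rule order_trans[OF left_mult_bound[OF c y(1)] l])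
      ultimately have "cmod (\<phi> (right_mult (coef a) y)) \<le> \<bar>K\<bar> * l1_norm (coef a)"
        "cmod (\<phi> (left_mult (coef a) y)) \<le> \<bar>K\<bar> * l1_norm (coef a)"
        using f bdd_right_mult[OF c y(1)] bdd_left_mult[OF c y(1)] by blast+
      moreover have "cmod (border_sum (coef a) y) \<le> 2 * l1_norm (coef a)"
        using border_sum_linear(5)[OF c c y(1) y(1)] l by linarith
      ultimately show ?thesis
        unfolding \<psi>[OF y(1)]
        using norm_triangle_ineq4[of "\<phi> (right_mult (coef a) y) - \<phi> (left_mult (coef a) y)" "border_sum (coef a) y"]
          norm_triangle_ineq4[of "\<phi> (right_mult (coef a) y)" "\<phi> (left_mult (coef a) y)"] by linarith
    qed
    have "cmod (\<psi> x) \<le> (SUP x\<in>{x \<in> carrier matrix_module. vnorm matrix_module x \<le> 1}. cmod (\<psi> x))"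
    proof (rule cSUP_upper)
      show "x \<in> {x \<in> carrier matrix_module. vnorm matrix_module x \<le> 1}"
        using x by (simp add: matrix_module_simps)
      show "bdd_above ((\<lambda>x. cmod (\<psi> x)) ` {x \<in> carrier matrix_module. vnorm matrix_module x \<le> 1})"
        using bound by (intro bdd_aboveI2) (auto simp: matrix_module_simps)
    qed
    also have "\<dots> = vnorm ?E \<psi>" by (simp add: dual_bimodule_def)
    also have "\<dots> \<le> e" using n by (simp add: \<psi>_def)
    finally show ?thesis unfolding \<psi>[OF x(1)] .
  qed
  show thesis
  proof (rule that)
    show "\<phi> (\<lambda>p. x p + y p) = \<phi> x + \<phi> y" if "bdd x" "bdd y" for x y
      using \<phi>(1) that by (auto simp: dual_bimodule_def matrix_module_simps)
    show "\<phi> (\<lambda>p. r * x p) = r * \<phi> x" if "bdd x" for r x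
      using \<phi>(1) that by (auto simp: dual_bimodule_def matrix_module_simps)
  qed (use K main[OF a(1) D(2)] main[OF b(1) D(3)] a b in auto)
qed

end

section \<open>Test matrices\<close>

definition row_indicator :: "'i set \<Rightarrow> 'i bmatrix" where
  "row_indicator U = (\<lambda>(p, q). of_bool (p \<in> Some ` U \<and> q = None))"

definition column_indicator :: "'i set \<Rightarrow> 'i bmatrix" where
  "column_indicator V = (\<lambda>(p, q). of_bool (p = None \<and> q \<in> Some ` V))"

definition block_indicator :: "'i set \<Rightarrow> 'i set \<Rightarrow> 'i bmatrix" where
  "block_indicator U V = (\<lambda>(p, q). of_bool (p \<in> Some ` U \<and> q \<in> Some ` V))"

lemma indicators_bounded:
  "bdd (row_indicator U)" "sup_norm (row_indicator U) \<le> 1"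
  "bdd (column_indicator U)" "sup_norm (column_indicator U) \<le> 1"
  "bdd (block_indicator U V)" "sup_norm (block_indicator U V) \<le> 1"
  by (rule bddI[of _ 1] sup_norm_least;
      force simp: row_indicator_def column_indicator_def block_indicator_def)+

lemma infsum_of_bool:
  fixes w :: complex
  assumes "finite U" "\<And>i. i \<in> U \<Longrightarrow> c i = w"
  shows "(\<Sum>\<^sub>\<infinity>i. c i * of_bool (i \<in> U)) = w * of_nat (card U)"
proof -
  have "(\<Sum>\<^sub>\<infinity>i. c i * of_bool (i \<in> U)) = (\<Sum>\<^sub>\<infinity>i\<in>U. w)"
    using assms(2) by (intro infsum_cong_neutral) auto
  then show ?thesis using assms(1) by simp
qed

text \<open>Where \<open>c\<close> is constant, both actions reproduce the block with the same
  factor. Their difference is therefore a combination of the two border indicators, with weights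
  given by the block sizes. The factor 0 is written out so that homogeneity of a functional applies
  to it.\<close>

lemma mult_indicators:
  assumes U: "finite U" "\<And>i. i \<in> U \<Longrightarrow> c i = w" and V: "finite V" "\<And>j. j \<in> V \<Longrightarrow> c j = w"
  shows "right_mult c (row_indicator U) = (\<lambda>p. w * row_indicator U p)"
    "left_mult c (row_indicator U) = (\<lambda>p. 0 * row_indicator U p)"
    "border_sum c (row_indicator U) = w * of_nat (card U)"
    "right_mult c (block_indicator U V) =
      (\<lambda>p. w * block_indicator U V p + w * of_nat (card U) * column_indicator V p)"
    "left_mult c (block_indicator U V) =
      (\<lambda>p. w * block_indicator U V p + w * of_nat (card V) * row_indicator U p)"
    "border_sum c (block_indicator U V) = 0"
proof -
  note defs = row_indicator_def column_indicator_def block_indicator_def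
  have sumU: "(\<Sum>\<^sub>\<infinity>i. c i * of_bool (i \<in> U \<and> j \<in> V)) = w * of_nat (card U) * of_bool (j \<in> V)" for j
    using infsum_of_bool[of U c w] U by (cases "j \<in> V") auto
  have sumV: "(\<Sum>\<^sub>\<infinity>j. c j * of_bool (i \<in> U \<and> j \<in> V)) = w * of_nat (card V) * of_bool (i \<in> U)" for i
    using infsum_of_bool[of V c w] V by (cases "i \<in> U") auto
  show "border_sum c (row_indicator U) = w * of_nat (card U)"
    using infsum_of_bool[of U c w] U by (auto simp: border_sum_def defs image_iff)
  show "border_sum c (block_indicator U V) = 0" by (simp add: border_sum_def defs image_iff)
  show "right_mult c (row_indicator U) = (\<lambda>p. w * row_indicator U p)"
  proof
    fix p show "right_mult c (row_indicator U) p = w * row_indicator U p"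
      using U by (cases "(c, row_indicator U, p)" rule: right_mult.cases) (auto simp: defs image_iff)
  qed
  show "left_mult c (row_indicator U) = (\<lambda>p. 0 * row_indicator U p)"
  proof
    fix p show "left_mult c (row_indicator U) p = 0 * row_indicator U p"
      by (cases "(c, row_indicator U, p)" rule: left_mult.cases) (auto simp: defs image_iff)
  qed
  show "right_mult c (block_indicator U V) =
      (\<lambda>p. w * block_indicator U V p + w * of_nat (card U) * column_indicator V p)"
  proof
    fix p show "right_mult c (block_indicator U V) p =
        w * block_indicator U V p + w * of_nat (card U) * column_indicator V p"
      using U sumU
      by (cases "(c, block_indicator U V, p)" rule: right_mult.cases) (auto simp: defs image_iff)
  qed
  show "left_mult c (block_indicator U V) =
      (\<lambda>p. w * block_indicator U V p + w * of_nat (card V) * row_indicator U p)"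
  proof
    fix p show "left_mult c (block_indicator U V) p =
        w * block_indicator U V p + w * of_nat (card V) * row_indicator U p"
      using V sumV
      by (cases "(c, block_indicator U V, p)" rule: left_mult.cases) (auto simp: defs image_iff)
  qed
qed


text \<open>Level \<open>k\<close> contributes at most \<open>8 * 4 ^ k / 8 ^ k = 8 / 2 ^ k\<close>.
  The constant 8 admits coefficients whose exponent is one below the level.\<close>

lemma l1_level_decay:
  fixes lev :: "'i \<Rightarrow> nat"
  assumes card: "\<And>k. card {i. lev i = k} = 4 ^ k"
    and c: "\<And>i. cmod (c i) \<le> 8 * (1 / 8) ^ lev i"
  shows "l1 c"
proof -
  let ?f = "\<lambda>i. 8 * (1 / 8 :: real) ^ lev i"
  have fin: "finite {i. lev i = k}" for k
    using card[of k] by (intro card_ge_0_finite) simp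
  have "?f summable_on (\<Union>k. {i. lev i = k})"
  proof (rule summable_on_UnionI)
    show "(?f has_sum (8 * (1 / 2) ^ k)) {i. lev i = k}" for k
    proof (rule has_sum_finiteI[OF fin])
      have "(\<Sum>i\<in>{i. lev i = k}. ?f i) = (\<Sum>i\<in>{i. lev i = k}. 8 * (1 / 8) ^ k)"
        by (rule sum.cong) auto
      also have "\<dots> = 8 * (4 ^ k * (1 / 8) ^ k)" by (simp add: card)
      also have "\<dots> = 8 * (1 / 2) ^ k" by (simp flip: power_mult_distrib)
      finally show "8 * (1 / 2) ^ k = (\<Sum>i\<in>{i. lev i = k}. ?f i)" by simp
    qed
    show "(\<lambda>k. 8 * (1 / 2 :: real) ^ k) summable_on UNIV"
      by (intro summable_on_cmult_right norm_summable_imp_summable_on) (simp add: summable_geometric)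
  qed (auto simp: disjoint_family_on_def)
  also have "(\<Union>k. {i. lev i = k}) = UNIV" by auto
  finally show ?thesis
    unfolding l1_def by (rule summable_on_comparison_test) (use c in auto)
qed

context l1_image
begin

theorem not_approximately_amenable:
  fixes lev :: "'i \<Rightarrow> nat"
  assumes card: "\<And>k. card {i. lev i = k} = 4 ^ k"
  shows "\<not> approximately_amenable_in TYPE('i bmatrix) A"
proof
  assume am: "approximately_amenable_in TYPE('i bmatrix) A"
  define B where "B k = {i. lev i = k}" for k
  have B: "finite (B k)" "card (B k) = 4 ^ k" "i \<in> B k \<longleftrightarrow> lev i = k" for k i
    using card[of k] by (auto simp: B_def intro: card_ge_0_finite)
  define w :: "nat \<Rightarrow> complex" where "w k = (1 / 8) ^ k" for k
  \<comment> \<open>The exponent is the largest even number not above the level.\<close>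
  define a where "a i = w (2 * (lev i div 2))" for i
  \<comment> \<open>The exponent is the largest odd number not above the level. Level 0 has none and
    needs its own case, because \<open>0 - 1 = 0\<close> would give exponent 1.\<close>
  define b where "b i = (if lev i = 0 then 0 else w (2 * ((lev i - 1) div 2) + 1))" for i
  have w_le: "cmod (w k) \<le> 8 * (1 / 8) ^ l" if "l \<le> k + 1" for k l
  proof -
    have "cmod (w k) = 8 * (1 / 8) ^ (k + 1)" by (simp add: w_def norm_power norm_divide)
    also have "\<dots> \<le> 8 * (1 / 8) ^ l" using that by (intro mult_left_mono power_decreasing) auto
    finally show ?thesis .
  qed
  have "l1 a" by (rule l1_level_decay[OF card]) (auto simp: a_def intro!: w_le)
  moreover have "l1 b" by (rule l1_level_decay[OF card]) (auto simp: b_def intro!: w_le)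
  ultimately obtain \<phi> K where add: "\<And>x y. \<lbrakk>bdd x; bdd y\<rbrakk> \<Longrightarrow> \<phi> (\<lambda>p. x p + y p) = \<phi> x + \<phi> y"
    and scale: "\<And>r x. bdd x \<Longrightarrow> \<phi> (\<lambda>p. r * x p) = r * \<phi> x"
    and K: "\<And>x. bdd x \<Longrightarrow> cmod (\<phi> x) \<le> K * sup_norm x"
    and na: "\<And>x. \<lbrakk>bdd x; sup_norm x \<le> 1\<rbrakk> \<Longrightarrow> cmod (\<phi> (right_mult a x) - \<phi> (left_mult a x) - border_sum a x) \<le> 1 / 4"
    and nb: "\<And>x. \<lbrakk>bdd x; sup_norm x \<le> 1\<rbrakk> \<Longrightarrow> cmod (\<phi> (right_mult b x) - \<phi> (left_mult b x) - border_sum b x) \<le> 1 / 4"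
    using near_inner_functional[OF am, of a b "1 / 4"] by auto
  define P where "P k = \<phi> (row_indicator (B k)) / 4 ^ k" for k
  define Q where "Q k = \<phi> (column_indicator (B k)) / 4 ^ k" for k
  \<comment> \<open>A block test matrix relates a mean \<open>P\<close> over border rows to a mean
    \<open>Q\<close> over border columns, so the chain of means must alternate between them.\<close>
  define z where "z k = (if even k then P k else Q k)" for k
  \<comment> \<open>The condition \<open>m + n = 2 * k + 1\<close> covers the neighbours
    \<open>k\<close> and \<open>k + 1\<close> in either order. The weight \<open>8 ^ (- k)\<close>
    times the \<open>4 ^ (m + n)\<close> entries of the block is \<open>4 * 2 ^ k\<close>, so the
    fixed error 1/4 becomes a geometrically small error for the means.\<close>
  have block: "cmod (P m - Q n) \<le> (1 / 4) * (1 / 4) * (1 / 2) ^ k"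
    if near: "\<And>x. \<lbrakk>bdd x; sup_norm x \<le> 1\<rbrakk> \<Longrightarrow> cmod (\<phi> (right_mult c x) - \<phi> (left_mult c x) - border_sum c x) \<le> 1 / 4"
      and c: "\<And>i. i \<in> B m \<union> B n \<Longrightarrow> c i = w k" and mn: "m + n = 2 * k + 1" for c m n k
  proof -
    let ?G = "block_indicator (B m) (B n)"
    have "\<phi> (right_mult c ?G) - \<phi> (left_mult c ?G) - border_sum c ?G
      = w k * 4 ^ m * \<phi> (column_indicator (B n)) - w k * 4 ^ n * \<phi> (row_indicator (B m))"
      using c B
      by (subst mult_indicators[where w = "w k"]; (simp; fail)?)+
        (simp add: add scale bdd_scale indicators_bounded)
    also have "\<dots> = w k * 4 ^ (m + n) * (Q n - P m)"
      by (simp add: P_def Q_def power_add field_simps)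
    also have "w k * 4 ^ (m + n) = 4 * 2 ^ k"
    proof -
      have "w k * 4 ^ (m + n) = 4 * ((1 / 8) ^ k * 16 ^ k)" by (simp add: w_def mn power_mult)
      also have "\<dots> = 4 * 2 ^ k" by (simp flip: power_mult_distrib)
      finally show ?thesis .
    qed
    finally have "cmod (4 * 2 ^ k * (Q n - P m)) \<le> 1 / 4"
      using near[of ?G] indicators_bounded(5,6) by metis
    moreover have "cmod (4 * 2 ^ k * x) = 4 * 2 ^ k * cmod x" for x
      by (simp add: Real_Vector_Spaces.norm_mult norm_power)
    ultimately have "4 * 2 ^ k * cmod (P m - Q n) \<le> 1 / 4"
      by (metis norm_minus_commute)
    then show ?thesis by (simp add: field_simps)
  qed
  have step: "cmod (z (Suc k) - z k) \<le> (1 / 4) * (1 / 4) * (1 / 2) ^ k" for k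
  proof (cases "even k")
    case True
    then have "z (Suc k) - z k = - (P k - Q (Suc k))" by (simp add: z_def)
    moreover have "a i = w k" if "i \<in> B k \<union> B (Suc k)" for i
      using that True by (auto simp: a_def B elim!: evenE)
    ultimately show ?thesis using block[OF na, of k "Suc k" k] by (metis norm_minus_cancel add_Suc_right mult_2 Suc_eq_plus1)
  next
    case False
    then have "z (Suc k) - z k = P (Suc k) - Q k" by (simp add: z_def)
    moreover have "b i = w k" if "i \<in> B (Suc k) \<union> B k" for i
      using that False by (auto simp: b_def B elim!: oddE)
    ultimately show ?thesis using block[OF nb, of "Suc k" k k] by simp
  qed
  \<comment> \<open>Level 0 is a single index with \<open>a = 1\<close>. On its indicator the border
    sum is 1 and the left action vanishes, which pins the mean near 1.\<close>
  have "cmod (z 0 - 1) \<le> 1 / 4"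
  proof -
    let ?R = "row_indicator (B 0)"
    have a1: "a i = 1" if "i \<in> B 0" for i using that by (simp add: a_def B w_def)
    have "right_mult a ?R = ?R" "left_mult a ?R = (\<lambda>p. 0 * ?R p)" "border_sum a ?R = 1"
      using mult_indicators(1-3)[OF B(1) a1 B(1) a1] by (simp_all add: B(2))
    then have "\<phi> (right_mult a ?R) - \<phi> (left_mult a ?R) - border_sum a ?R = \<phi> ?R - 1"
      using scale[OF indicators_bounded(1), of 0 "B 0"] by simp
    then show ?thesis using na[OF indicators_bounded(1,2), of "B 0"] by (simp add: z_def P_def)
  qed
  \<comment> \<open>The partial sum of the step bounds \<open>1 / 16 * (1 / 2) ^ k\<close>.\<close>
  have "cmod (z n - z 0) \<le> 1 / 8 * (1 - (1 / 2) ^ n)" for n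
  proof (induction n)
    case (Suc n)
    have "cmod (z (Suc n) - z 0) \<le> cmod (z (Suc n) - z n) + cmod (z n - z 0)"
      using norm_triangle_ineq[of "z (Suc n) - z n" "z n - z 0"] by simp
    then show ?case using step[of n] Suc by simp
  qed simp
  then have far: "cmod (z n - z 0) \<le> 1 / 8" for n
    using order_trans[of "cmod (z n - z 0)" "1 / 8 * (1 - (1 / 2) ^ n)" "1 / 8"] by simp
  \<comment> \<open>The errors leave \<open>1 - 1/4 - 1/8 = 5/8\<close>.\<close>
  have low: "1 / 2 \<le> cmod (z n)" for n
  proof -
    have "cmod 1 \<le> cmod (z n) + cmod (z n - z 0) + cmod (z 0 - 1)"
      using norm_triangle_ineq4[of "z n" "z n - z 0"] norm_triangle_ineq4[of "z 0" "z 0 - 1"]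
      by (simp add: algebra_simps)
    then show ?thesis using \<open>cmod (z 0 - 1) \<le> 1 / 4\<close> far[of n] by simp
  qed
  have "cmod (\<phi> x) \<le> \<bar>K\<bar>" if "bdd x" "sup_norm x \<le> 1" for x
  proof -
    have "cmod (\<phi> x) \<le> K * sup_norm x" by (rule K[OF that(1)])
    also have "\<dots> \<le> \<bar>K\<bar> * 1" using that sup_norm_nonneg[OF that(1)] by (intro mult_mono) auto
    finally show ?thesis by simp
  qed
  \<comment> \<open>The indicators have norm at most 1 whatever the size of the block, so dividing
    by that size makes the means decay.\<close>
  then have up: "cmod (z n) \<le> \<bar>K\<bar> / 4 ^ n" for n
    by (simp add: z_def P_def Q_def norm_divide norm_power divide_right_mono indicators_bounded)
  have "(\<lambda>n. \<bar>K\<bar> / 4 ^ n) \<longlonglongrightarrow> 0"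
    using tendsto_mult_right_zero[OF LIMSEQ_realpow_zero[of "1 / 4 :: real"], of "\<bar>K\<bar>"]
    by (simp add: power_divide)
  then have "\<forall>\<^sub>F n in sequentially. \<bar>K\<bar> / 4 ^ n < 1 / 2" by (rule order_tendstoD) simp
  then obtain n where "\<bar>K\<bar> / 4 ^ n < 1 / 2" by (meson eventually_happens sequentially_bot)
  then show False using up[of n] low[of n] by linarith
qed

end

section \<open>Integration of continuous functions over a compact abelian group\<close>

locale compact_abelian_group =
  fixes M :: "'g::{topological_ab_group_add, t2_space} measure"
  assumes compact_group: "compact (UNIV :: 'g set)"
    and haar: "normalized_haar_measure M"
begin

abbreviation cont :: "('g \<Rightarrow> complex) \<Rightarrow> bool" where
  "cont f \<equiv> continuous_on UNIV f"

lemma cont_compose: "\<lbrakk>cont f; continuous_on S h\<rbrakk> \<Longrightarrow> continuous_on S (\<lambda>x. f (h x))"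
  by (rule continuous_on_compose2) auto

lemma cont_bounded:
  assumes "cont f" obtains B where "\<And>x. cmod (f x) \<le> B"
proof -
  have "bounded (range f)" using compact_continuous_image[OF assms compact_group] by (rule compact_imp_bounded)
  then show thesis using that by (auto simp: bounded_iff)
qed

lemma cont_integrable: assumes "cont f" shows "integrable M f"
  using cont_bounded[OF assms] integrable_bounded_continuous[OF haar assms] by metis

lemma cont_integrable_real:
  fixes f :: "'g \<Rightarrow> real" assumes "continuous_on UNIV f" shows "integrable M f"
proof -
  have "integrable M (\<lambda>x. complex_of_real (f x))" by (intro cont_integrable continuous_intros assms)
  then show ?thesis unfolding complex_of_real_integrable_eq .
qed

lemma measure_group [simp]: "measure M (space M) = 1"
  by (rule prob_space.prob_space[OF haar_measureD(3)[OF haar]])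

lemma integral_norm_le:
  assumes f: "cont f" and e: "\<And>x. cmod (f x) \<le> e"
  shows "cmod (LINT x|M. f x) \<le> e"
proof -
  have "cmod (LINT x|M. f x) \<le> (LINT x|M. cmod (f x))" by simp
  also have "\<dots> \<le> (LINT x|M. e)"
    by (intro integral_mono integrable_norm cont_integrable f e cont_integrable_real continuous_intros)
  also have "\<dots> = e" by simp
  finally show ?thesis .
qed

lemma integral_diff_le:
  assumes f: "cont f" and g: "cont g" and e: "\<And>x. cmod (f x - g x) \<le> e"
  shows "cmod ((LINT x|M. f x) - (LINT x|M. g x)) \<le> e"
proof -
  have "(LINT x|M. f x) - (LINT x|M. g x) = (LINT x|M. f x - g x)"
    by (intro Bochner_Integration.integral_diff[symmetric] cont_integrable f g)
  then show ?thesis using integral_norm_le[OF continuous_on_diff[OF f g] e] by simp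
qed

text \<open>Compact Hausdorff spaces are normal. These functions separate points for
  Stone-Weierstrass and later give a function supported near 0.\<close>

lemma urysohn:
  fixes x :: 'g assumes "open U" "x \<in> U"
  obtains u :: "'g \<Rightarrow> real"
  where "continuous_on UNIV u" "u x = 1" "\<And>y. y \<notin> U \<Longrightarrow> u y = 0" "\<And>y. 0 \<le> u y" "\<And>y. u y \<le> 1"
proof -
  have "normal_space (euclidean :: 'g topology)"
    using compact_group
    by (intro compact_Hausdorff_or_regular_imp_normal_space)
      (auto simp: compact_space_def Hausdorff_space_def disjnt_def separation_t2)
  moreover have "closedin euclidean (- U)" "closedin euclidean {x}" "disjnt (- U) {x}"
    using assms by (auto simp: disjnt_def)
  ultimately obtain u :: "'g \<Rightarrow> real" where
    u: "continuous_map euclidean (top_of_set {0..1}) u" "u ` (- U) \<subseteq> {0}" "u ` {x} \<subseteq> {1}"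
    by (rule Urysohn_lemma[of euclidean "- U" "{x}" 0 1]) auto
  have "u y \<in> {0..1}" for y using u(1) by (auto simp: continuous_map_in_subtopology)
  moreover have "continuous_on UNIV u" using u(1) by (auto simp: continuous_map_in_subtopology)
  ultimately show thesis using u(2,3) by (intro that[of u]) (auto simp: image_subset_iff)
qed

text \<open>
  The Borel sets of the square can be more than the product sigma algebra, so Fubini's theorem is
  obtained for continuous functions from uniform approximation by sums of products.
\<close>

inductive_set separated :: "('g \<times> 'g \<Rightarrow> complex) set" where
  prod: "\<lbrakk>cont u; cont v\<rbrakk> \<Longrightarrow> (\<lambda>p. u (fst p) * v (snd p)) \<in> separated"
| sum: "\<lbrakk>F \<in> separated; G \<in> separated\<rbrakk> \<Longrightarrow> (\<lambda>p. F p + G p) \<in> separated"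

lemma separated_continuous: "F \<in> separated \<Longrightarrow> continuous_on UNIV F"
proof (induction rule: separated.induct)
  case (prod u v)
  then show ?case
    by (intro continuous_on_mult cont_compose[OF prod(1)] cont_compose[OF prod(2)]
        continuous_on_fst continuous_on_snd continuous_on_id)
qed (rule continuous_on_add)

lemma separated_mult:
  assumes "F \<in> separated" "G \<in> separated" shows "(\<lambda>p. F p * G p) \<in> separated"
  using assms
proof (induction arbitrary: G rule: separated.induct)
  case (prod u v)
  from prod(3) show ?case
  proof (induction rule: separated.induct)
    case (prod u' v')
    have "(\<lambda>p. (u (fst p) * u' (fst p)) * (v (snd p) * v' (snd p))) \<in> separated"
      by (rule separated.prod[of "\<lambda>x. u x * u' x" "\<lambda>x. v x * v' x"])
        (intro continuous_intros prod \<open>cont u\<close> \<open>cont v\<close>)+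
    then show ?case by (simp add: mult_ac)
  next
    case (sum F' G')
    then show ?case by (simp add: distrib_left separated.sum)
  qed
next
  case (sum F F')
  then show ?case by (simp add: distrib_right separated.sum)
qed

lemma separated_const: "(\<lambda>p. c) \<in> separated"
  using separated.prod[of "\<lambda>x. c" "\<lambda>x. 1"] by simp

text \<open>Stone-Weierstrass for the real functions whose complexification is separated, applied to
  real and imaginary part. Points of the square differ in some coordinate, and a Urysohn function of
  that coordinate separates them.\<close>

lemma separated_approximation:
  fixes F :: "'g \<times> 'g \<Rightarrow> complex"
  assumes F: "continuous_on UNIV F" and e: "0 < e"
  obtains G where "G \<in> separated" "\<And>p. cmod (F p - G p) < e"
proof -
  interpret SW: function_ring_on "{f. (\<lambda>p. complex_of_real (f p)) \<in> separated}" UNIV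
  proof
    show "compact (UNIV :: ('g \<times> 'g) set)"
      using compact_Times[OF compact_group compact_group] by (simp add: UNIV_Times_UNIV)
    show "continuous_on UNIV f" if "f \<in> {f. (\<lambda>p. complex_of_real (f p)) \<in> separated}" for f
      using continuous_on_Re[OF separated_continuous] that by fastforce
    show "\<exists>f\<in>{f. (\<lambda>p. complex_of_real (f p)) \<in> separated}. f p \<noteq> f q" if "p \<noteq> q" for p q :: "'g \<times> 'g"
    proof (cases "fst p = fst q")
      case True
      then have "snd p \<in> - {snd q}" using that by (auto simp: prod_eq_iff)
      then obtain u :: "'g \<Rightarrow> real" where "continuous_on UNIV u" "u (snd p) = 1" "u (snd q) = 0"
        using urysohn[of "- {snd q}" "snd p"] by force
      then show ?thesis
        using separated.prod[of "\<lambda>x. 1" "\<lambda>x. complex_of_real (u x)"]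
        by (intro bexI[of _ "\<lambda>p. u (snd p)"]) (auto intro!: continuous_intros)
    next
      case False
      then have "fst p \<in> - {fst q}" by auto
      then obtain u :: "'g \<Rightarrow> real" where "continuous_on UNIV u" "u (fst p) = 1" "u (fst q) = 0"
        using urysohn[of "- {fst q}" "fst p"] by force
      then show ?thesis
        using separated.prod[of "\<lambda>x. complex_of_real (u x)" "\<lambda>x. 1"]
        by (intro bexI[of _ "\<lambda>p. u (fst p)"]) (auto intro!: continuous_intros)
    qed
  qed (auto simp: separated.sum separated_mult separated_const)
  obtain f where f: "(\<lambda>p. complex_of_real (f p)) \<in> separated" "\<And>p. \<bar>Re (F p) - f p\<bar> < e / 2"
    using SW.Stone_Weierstrass_basic[of "\<lambda>p. Re (F p)" "e / 2"] F e by (auto intro: continuous_intros)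
  obtain g where g: "(\<lambda>p. complex_of_real (g p)) \<in> separated" "\<And>p. \<bar>Im (F p) - g p\<bar> < e / 2"
    using SW.Stone_Weierstrass_basic[of "\<lambda>p. Im (F p)" "e / 2"] F e by (auto intro: continuous_intros)
  show thesis
  proof
    show "(\<lambda>p. complex_of_real (f p) + \<i> * complex_of_real (g p)) \<in> separated"
      by (intro separated.sum separated_mult separated_const f g)
    show "cmod (F p - (complex_of_real (f p) + \<i> * complex_of_real (g p))) < e" for p
      using cmod_le[of "F p - (complex_of_real (f p) + \<i> * complex_of_real (g p))"] f(2)[of p] g(2)[of p]
      by simp
  qed
qed

lemma cont_section:
  assumes "continuous_on UNIV (F :: 'g \<times> 'g \<Rightarrow> complex)"
  shows "cont (\<lambda>y. F (x, y))" "cont (\<lambda>x. F (x, y))"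
  by (rule continuous_on_compose2[OF assms], auto intro!: continuous_intros)+

text \<open>The claims are proved together: in the sum case, the swap needs the inner integrals to
  be integrable, which their continuity provides.\<close>

lemma separated_swap:
  assumes "F \<in> separated"
  shows "cont (\<lambda>x. LINT y|M. F (x, y)) \<and> cont (\<lambda>y. LINT x|M. F (x, y)) \<and>
    (LINT x|M. LINT y|M. F (x, y)) = (LINT y|M. LINT x|M. F (x, y))"
  using assms
proof (induction rule: separated.induct)
  case (prod u v)
  then show ?case by (auto intro!: continuous_intros)
next
  case (sum F G)
  note c = cont_section[OF separated_continuous[OF sum.hyps(1)]]
    cont_section[OF separated_continuous[OF sum.hyps(2)]]
  show ?case
    using sum.IH by (simp add: c cont_integrable continuous_on_add)
qed

text \<open>The partial integrals of separated approximants are continuous and converge uniformly,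
  because the total mass is 1.\<close>

lemma cont_partial_integral:
  fixes F :: "'g \<times> 'g \<Rightarrow> complex"
  assumes F: "continuous_on UNIV F"
  shows "cont (\<lambda>x. LINT y|M. F (x, y))"
proof -
  have "\<exists>G. G \<in> separated \<and> (\<forall>p. cmod (F p - G p) < 1 / Suc n)" for n
    by (rule separated_approximation[OF F, of "1 / Suc n"]) auto
  then obtain G where G: "\<And>n. G n \<in> separated" "\<And>n p. cmod (F p - G n p) < 1 / Suc n" by metis
  have "uniform_limit UNIV (\<lambda>n x. LINT y|M. G n (x, y)) (\<lambda>x. LINT y|M. F (x, y)) sequentially"
  proof (rule uniform_limitI)
    fix e :: real assume "0 < e"
    then obtain N where N: "1 / Suc N < e" using nat_approx_posE by auto
    have "dist (LINT y|M. G n (x, y)) (LINT y|M. F (x, y)) < e" if "N \<le> n" for n x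
    proof -
      have "cmod ((LINT y|M. F (x, y)) - (LINT y|M. G n (x, y))) \<le> 1 / Suc n"
        by (intro integral_diff_le cont_section separated_continuous F G less_imp_le[OF G(2)])
      also have "\<dots> \<le> 1 / Suc N" using that by (simp add: frac_le)
      finally show ?thesis using N by (simp add: dist_norm norm_minus_commute)
    qed
    then show "\<forall>\<^sub>F n in sequentially. \<forall>x\<in>UNIV. dist (LINT y|M. G n (x, y)) (LINT y|M. F (x, y)) < e"
      unfolding eventually_sequentially by blast
  qed
  then show ?thesis
    by (rule uniform_limit_theorem[rotated]) (use separated_swap[OF G(1)] in auto)
qed

lemma integral_swap:
  fixes F :: "'g \<times> 'g \<Rightarrow> complex"
  assumes F: "continuous_on UNIV F"
  shows "(LINT x|M. LINT y|M. F (x, y)) = (LINT y|M. LINT x|M. F (x, y))" (is "?I = ?J")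
proof -
  have F': "continuous_on UNIV (\<lambda>p. F (snd p, fst p))"
    by (rule continuous_on_compose2[OF F]) (auto intro!: continuous_intros)
  \<comment> \<open>Both iterated integrals are within \<open>e / 2\<close> of the common value for
    a separated approximant. The summand 0 matches \<open>field_le_epsilon\<close>.\<close>
  have "cmod (?I - ?J) \<le> 0 + e" if e: "0 < e" for e
  proof -
    obtain G where G: "G \<in> separated" "\<And>p. cmod (F p - G p) < e / 2"
      using separated_approximation[OF F, of "e / 2"] e by auto
    note s = separated_swap[OF G(1)]
    have "cmod (?I - (LINT x|M. LINT y|M. G (x, y))) \<le> e / 2"
      using s by (intro integral_diff_le cont_section separated_continuous[OF G(1)] cont_partial_integral
          F less_imp_le[OF G(2)]; auto)
    moreover have "cmod (?J - (LINT y|M. LINT x|M. G (x, y))) \<le> e / 2"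
      using s cont_partial_integral[OF F']
      by (intro integral_diff_le cont_section separated_continuous[OF G(1)] F less_imp_le[OF G(2)]; auto)
    ultimately show ?thesis
      using s norm_triangle_ineq4[of "?I - (LINT x|M. LINT y|M. G (x, y))" "?J - (LINT y|M. LINT x|M. G (x, y))"]
      by simp
  qed
  then have "cmod (?I - ?J) \<le> 0" by (rule field_le_epsilon)
  then show ?thesis by simp
qed

lemma integral_translate: "cont f \<Longrightarrow> (LINT x|M. f (a + x)) = (LINT x|M. f x)"
  by (rule haar_integral_translate[OF haar])

text \<open>Integrate \<open>f (x - y)\<close> in both orders. By translation invariance each inner
  integral is constant: one is the integral of \<open>f\<close>, the other that of its
  reflection.\<close>

lemma integral_uminus:
  assumes f: "cont f" shows "(LINT x|M. f (- x)) = (LINT x|M. f x)"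
proof -
  have "continuous_on UNIV (\<lambda>p. f (fst p - snd p))"
    by (rule cont_compose[OF f]) (intro continuous_intros)
  from integral_swap[OF this]
  have "(LINT x|M. LINT y|M. f (x - y)) = (LINT y|M. LINT x|M. f (x - y))" by (simp only: fst_conv snd_conv)
  moreover have "(LINT x|M. f (x - y)) = (LINT x|M. f x)" for y
    using integral_translate[OF f, of "- y"] by simp
  moreover have "(LINT y|M. f (x - y)) = (LINT y|M. f (- y))" for x
    using integral_translate[OF cont_compose[OF f, of UNIV uminus], of "- x"] by (simp add: continuous_intros)
  ultimately show ?thesis by simp
qed

lemma integral_reflect:
  assumes f: "cont f" shows "(LINT y|M. f (x - y)) = (LINT y|M. f y)"
proof -
  have "(LINT y|M. f (x - y)) = (LINT y|M. f (x + y))"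
    using integral_uminus[OF cont_compose[OF f, of UNIV "\<lambda>y. x + y"]] by (simp add: continuous_intros)
  then show ?thesis using integral_translate[OF f] by simp
qed

text \<open>Finitely many translates of \<open>U\<close> cover the compact group; if
  \<open>U\<close> were null, so would be the whole group.\<close>

lemma emeasure_open_pos:
  assumes U: "open U" "U \<noteq> {}" shows "emeasure M U \<noteq> 0"
proof
  assume 0: "emeasure M U = 0"
  obtain u where u: "u \<in> U" using U by auto
  have op: "open ((+) a ` U)" for a
  proof -
    have "(+) a ` U = (\<lambda>x. - a + x) -` U" by (force simp: image_iff)
    also have "open \<dots>" by (rule open_vimage[OF U(1)]) (intro continuous_intros)
    finally show ?thesis .
  qed
  have "x \<in> (+) (x - u) ` U" for x using u by (force simp: image_iff)
  then have "UNIV \<subseteq> (\<Union>a. (+) a ` U)" by blast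
  then obtain D where D: "finite D" "UNIV \<subseteq> (\<Union>a\<in>D. (+) a ` U)"
    using compactE_image[OF compact_group, of UNIV "\<lambda>a. (+) a ` U"] op by auto
  have B: "U \<in> sets borel" using U by auto
  have "emeasure M (\<Union>a\<in>D. (+) a ` U) \<le> (\<Sum>a\<in>D. emeasure M ((+) a ` U))"
    by (rule emeasure_subadditive_finite[OF D(1)]) (use op haar_measureD(1)[OF haar] in auto)
  also have "\<dots> = 0" by (simp add: haar_measureD(4)[OF haar B] 0)
  finally have "emeasure M UNIV = 0" using D(2) by (simp add: top.extremum_unique)
  then show False
    using prob_space.emeasure_space_1[OF haar_measureD(3)[OF haar]] haar_measureD(2)[OF haar] by simp
qed

section \<open>The convolution algebra of continuous functions\<close>

abbreviation conv :: "('g \<Rightarrow> complex) \<Rightarrow> ('g \<Rightarrow> complex) \<Rightarrow> 'g \<Rightarrow> complex" (infixl "\<odot>" 70) where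
  "f \<odot> g \<equiv> convolution M f g"

definition star :: "('g \<Rightarrow> complex) \<Rightarrow> 'g \<Rightarrow> complex" where
  "star f = (\<lambda>x. cnj (f (- x)))"

text \<open>The square of the L2 norm, not the norm itself; it is the value of
  \<open>f \<odot> star f\<close> at 0.\<close>

definition norm2 :: "('g \<Rightarrow> complex) \<Rightarrow> real" where
  "norm2 f = (LINT x|M. (cmod (f x))\<^sup>2)"

lemma cont_star: assumes "cont f" shows "cont (star f)"
  unfolding star_def by (intro continuous_on_cnj cont_compose[OF assms] continuous_on_minus continuous_on_id)

lemma star_star: "star (star f) = f"
  by (simp add: star_def)

lemma cont_conv_integrand:
  assumes "cont f" "cont g" shows "cont (\<lambda>y. f y * g (x - y))"
  by (intro continuous_intros cont_compose[OF assms(2)] assms)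

lemma cont_conv: assumes f: "cont f" and g: "cont g" shows "cont (f \<odot> g)"
proof -
  have "continuous_on UNIV (\<lambda>p. f (snd p) * g (fst p - snd p))"
    by (intro continuous_intros cont_compose[OF f] cont_compose[OF g])
  from cont_partial_integral[OF this] show ?thesis by (simp add: convolution_def)
qed

lemma conv_commute: assumes f: "cont f" and g: "cont g" shows "f \<odot> g = g \<odot> f"
proof
  fix x
  show "(f \<odot> g) x = (g \<odot> f) x"
    using integral_reflect[OF cont_conv_integrand[OF f g, of x], of x]
    by (simp add: convolution_def mult.commute)
qed

text \<open>Swap the two integrals, then translate the inner variable by \<open>z\<close>.\<close>

lemma conv_assoc:
  assumes f: "cont f" and g: "cont g" and h: "cont h"
  shows "f \<odot> g \<odot> h = f \<odot> (g \<odot> h)"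
proof
  fix x
  have "continuous_on UNIV (\<lambda>p. f (snd p) * g (fst p - snd p) * h (x - fst p))"
    by (intro continuous_intros cont_compose[OF f] cont_compose[OF g] cont_compose[OF h])
  from integral_swap[OF this]
  have "(f \<odot> g \<odot> h) x = (LINT z|M. LINT y|M. f z * g (y - z) * h (x - y))"
    by (simp add: convolution_def)
  moreover have "(LINT y|M. f z * g (y - z) * h (x - y)) = f z * (g \<odot> h) (x - z)" for z
  proof -
    have "cont (\<lambda>y. f z * g (y - z) * h (x - y))"
      by (intro continuous_intros cont_compose[OF g] cont_compose[OF h])
    from integral_translate[OF this, of z, symmetric] show ?thesis
      by (simp add: convolution_def mult.assoc diff_diff_eq del: mult_cancel_left)
  qed
  ultimately show "(f \<odot> g \<odot> h) x = (f \<odot> (g \<odot> h)) x"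
    by (simp only: convolution_def[of M f "g \<odot> h"])
qed

lemma conv_linear:
  assumes f: "cont f" and g: "cont g" and h: "cont h"
  shows "f \<odot> (\<lambda>x. g x + h x) = (\<lambda>x. (f \<odot> g) x + (f \<odot> h) x)"
    "f \<odot> (\<lambda>x. g x - h x) = (\<lambda>x. (f \<odot> g) x - (f \<odot> h) x)"
    "f \<odot> (\<lambda>x. c * g x) = (\<lambda>x. c * (f \<odot> g) x)"
    "(\<lambda>x. g x + h x) \<odot> f = (\<lambda>x. (g \<odot> f) x + (h \<odot> f) x)"
    "(\<lambda>x. g x - h x) \<odot> f = (\<lambda>x. (g \<odot> f) x - (h \<odot> f) x)"
    "(\<lambda>x. c * g x) \<odot> f = (\<lambda>x. c * (g \<odot> f) x)"
  using cont_integrable[OF cont_conv_integrand[OF f g]] cont_integrable[OF cont_conv_integrand[OF f h]]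
    cont_integrable[OF cont_conv_integrand[OF g f]] cont_integrable[OF cont_conv_integrand[OF h f]]
  by (simp_all add: convolution_def algebra_simps)

lemma star_conv: assumes f: "cont f" and g: "cont g" shows "star (f \<odot> g) = star f \<odot> star g"
proof
  fix x
  have "(star f \<odot> star g) x = (LINT y|M. cnj (f (- y) * g (- x - - y)))"
    by (simp add: convolution_def star_def)
  also have "\<dots> = cnj (LINT y|M. f (- y) * g (- x - - y))" by (rule Bochner_Integration.integral_cnj)
  also have "\<dots> = star (f \<odot> g) x"
    using integral_uminus[OF cont_conv_integrand[OF f g, of "- x"]] by (simp add: convolution_def star_def)
  finally show "star (f \<odot> g) x = (star f \<odot> star g) x" by simp
qed

lemma conv_translate: "f \<odot> (\<lambda>x. g (x + a)) = (\<lambda>x. (f \<odot> g) (x + a))"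
  by (simp add: convolution_def algebra_simps)

lemma conv_star_zero: "(f \<odot> star f) 0 = complex_of_real (norm2 f)"
  by (simp add: convolution_def star_def norm2_def complex_norm_square[symmetric] flip: integral_complex_of_real)

lemma norm2_nonneg: "0 \<le> norm2 f"
  unfolding norm2_def by (rule Bochner_Integration.integral_nonneg) simp

lemma norm2_le: assumes f: "cont f" and B: "\<And>x. cmod (f x) \<le> B" shows "norm2 f \<le> B\<^sup>2"
proof -
  have "norm2 f \<le> (LINT x|M. B\<^sup>2)"
    unfolding norm2_def
    by (intro integral_mono cont_integrable_real continuous_intros f power_mono B) auto
  then show ?thesis by simp
qed

text \<open>The set where \<open>f\<close> does not vanish is open and null, hence empty.\<close>

lemma norm2_eq_0: assumes f: "cont f" and 0: "norm2 f = 0" shows "f = (\<lambda>x. 0)"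
proof (rule ccontr)
  assume "f \<noteq> (\<lambda>x. 0)"
  then obtain x where x: "f x \<noteq> 0" by auto
  have int: "integrable M (\<lambda>x. (cmod (f x))\<^sup>2)" by (intro cont_integrable_real continuous_intros f)
  have "AE x in M. (cmod (f x))\<^sup>2 = 0"
    using 0 integral_nonneg_eq_0_iff_AE[OF int] by (simp add: norm2_def)
  then have "AE x in M. x \<notin> {x. f x \<noteq> 0}" by simp
  moreover have op: "open {x. f x \<noteq> 0}"
    using open_Collect_neq[OF f continuous_on_const] by simp
  ultimately have "emeasure M {x. f x \<noteq> 0} = 0"
    using haar_measureD(1,2)[OF haar] by (subst (asm) AE_iff_measurable[of "{x. f x \<noteq> 0}"]) auto
  then show False using emeasure_open_pos[OF op] x by auto
qed

lemma cauchy_schwarz: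
  assumes f: "cont f" and g: "cont g"
  shows "(cmod (LINT x|M. f x * g x))\<^sup>2 \<le> norm2 f * norm2 g"
proof -
  define b where "b = (LINT x|M. cmod (f x) * cmod (g x))"
  have int: "integrable M (\<lambda>x. (cmod (f x))\<^sup>2)" "integrable M (\<lambda>x. (cmod (g x))\<^sup>2)"
    "integrable M (\<lambda>x. cmod (f x) * cmod (g x))"
    by (intro cont_integrable_real continuous_intros f g)+
  have q: "0 \<le> norm2 f - 2 * t * b + t\<^sup>2 * norm2 g" for t
  proof -
    have "0 \<le> (LINT x|M. (cmod (f x) - t * cmod (g x))\<^sup>2)" by (rule Bochner_Integration.integral_nonneg) simp
    also have "\<dots> = (LINT x|M. (cmod (f x))\<^sup>2 - (2 * t) * (cmod (f x) * cmod (g x)) + t\<^sup>2 * (cmod (g x))\<^sup>2)"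
      by (simp add: power2_eq_square algebra_simps)
    also have "\<dots> = norm2 f - 2 * t * b + t\<^sup>2 * norm2 g"
      using int by (simp add: norm2_def b_def)
    finally show ?thesis .
  qed
  have b0: "0 \<le> b" unfolding b_def by (rule Bochner_Integration.integral_nonneg) simp
  have "b\<^sup>2 \<le> norm2 f * norm2 g"
  proof (cases "norm2 g = 0")
    case True
    have "b = 0"
    proof (rule ccontr)
      assume "b \<noteq> 0"
      \<comment> \<open>With \<open>norm2 g = 0\<close> the quadratic is linear in \<open>t\<close>;
        this \<open>t\<close> gives it the value -1.\<close>
      then show False using q[of "(norm2 f + 1) / (2 * b)"] True by simp
    qed
    then show ?thesis using True by simp
  next
    case False
    then have "0 < norm2 g" using norm2_nonneg[of g] by simp
    \<comment> \<open>The minimum of the quadratic is at \<open>t = b / norm2 g\<close>.\<close>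
    then show ?thesis using q[of "b / norm2 g"] by (simp add: field_simps power2_eq_square)
  qed
  moreover have "cmod (LINT x|M. f x * g x) \<le> b"
    unfolding b_def using integral_norm_bound[of M "\<lambda>x. f x * g x"] by (simp add: norm_mult)
  ultimately show ?thesis by (meson norm_ge_zero order_trans power_mono)
qed

lemma norm2_reflect: assumes f: "cont f" shows "norm2 (\<lambda>y. f (x - y)) = norm2 f"
proof -
  have "complex_of_real (norm2 (\<lambda>y. f (x - y))) = complex_of_real (norm2 f)"
    unfolding norm2_def integral_complex_of_real[symmetric]
    by (rule integral_reflect[of "\<lambda>y. complex_of_real ((cmod (f y))\<^sup>2)"]) (intro continuous_intros f)
  then show ?thesis by simp
qed

text \<open>This turns L2 estimates into uniform ones.\<close>

lemma conv_bound:
  assumes f: "cont f" and g: "cont g" shows "(cmod ((f \<odot> g) x))\<^sup>2 \<le> norm2 f * norm2 g"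
  using cauchy_schwarz[OF f cont_compose[OF g, of UNIV "\<lambda>y. x - y"]] norm2_reflect[OF g]
  by (simp add: convolution_def continuous_intros)

lemma norm2_conv_le:
  assumes f: "cont f" and g: "cont g" shows "norm2 (f \<odot> g) \<le> norm2 f * norm2 g"
  using norm2_le[OF cont_conv[OF f g], of "sqrt (norm2 f * norm2 g)"] conv_bound[OF f g]
    norm2_nonneg[of f] norm2_nonneg[of g] by (simp add: real_le_rsqrt)

end

section \<open>Spectral projections from convolution powers\<close>

lemma log_convex_submultiplicative_limit:
  fixes a :: "nat \<Rightarrow> real"
  assumes pos: "\<And>n. 0 < a n"
    and convex: "\<And>n. (a (Suc n))\<^sup>2 \<le> a n * a (Suc (Suc n))"
    and sub: "\<And>i j. a (Suc (i + j)) \<le> a i * a j"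
  obtains lam c where "0 < lam" "1 \<le> c" "(\<lambda>n. a n / lam ^ Suc n) \<longlonglongrightarrow> c"
proof -
  \<comment> \<open>The number \<open>a n\<close> plays the role of a power with exponent
    \<open>n + 1\<close>. Log convexity makes the ratios increase and submultiplicativity bounds
    them by \<open>a 0\<close>; their limit is the growth rate \<open>lam\<close>.\<close>
  define r where "r n = a (Suc n) / a n" for n
  have r_pos: "0 < r n" for n using pos by (simp add: r_def)
  have "incseq r"
    by (rule incseq_SucI) (use pos convex in \<open>simp add: r_def divide_le_eq pos_le_divide_eq power2_eq_square mult.commute\<close>)
  moreover have "r n \<le> a 0" for n
    using sub[of n 0] pos[of n] by (simp add: r_def divide_le_eq mult.commute)
  ultimately obtain lam where lam: "r \<longlonglongrightarrow> lam" "\<And>n. r n \<le> lam"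
    using incseq_convergent[of r "a 0"] by blast
  have lam_pos: "0 < lam" using r_pos[of 0] lam(2)[of 0] by linarith
  have grow: "a n * r n ^ Suc N \<le> a (Suc (n + N))" for n N
  proof (induction N)
    case 0
    show ?case using pos[of n] by (simp add: r_def)
  next
    case (Suc N)
    have "a n * r n ^ Suc (Suc N) = a n * r n ^ Suc N * r n" by simp
    also have "\<dots> \<le> a (Suc (n + N)) * r (Suc (n + N))"
      using Suc r_pos[of n] pos[of "Suc (n + N)"] incseqD[OF \<open>incseq r\<close>, of n "Suc (n + N)"]
      by (intro mult_mono) (auto intro: less_imp_le)
    also have "\<dots> = a (Suc (n + Suc N))" using pos[of "Suc (n + N)"] by (simp add: r_def)
    finally show ?case .
  qed
  \<comment> \<open>Multiply by \<open>a n\<close>: the left side is then at most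
    \<open>a (Suc (n + N))\<close> by growth, and this is at most \<open>a n * a N\<close>. In the
    limit of \<open>n\<close>, \<open>a N\<close> is at least \<open>lam ^ Suc N\<close>, so the
    normalised sequence stays above 1 and cannot tend to 0.\<close>
  have "r n ^ Suc N \<le> a N" for n N
  proof -
    have "a n * r n ^ Suc N \<le> a n * a N" using grow sub by (rule order_trans)
    then show ?thesis using pos[of n] by simp
  qed
  then have "lam ^ Suc N \<le> a N" for N
    by (intro tendsto_upperbound[OF tendsto_power[OF lam(1), of "Suc N"]]) auto
  then have low: "1 \<le> a n / lam ^ Suc n" for n using lam_pos by (simp add: pos_le_divide_eq)
  have "decseq (\<lambda>n. a n / lam ^ Suc n)"
  proof (rule decseq_SucI)
    fix n
    have "a (Suc n) \<le> a n * lam"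
      using lam(2)[of n] pos[of n] by (simp add: r_def divide_le_eq mult.commute)
    then show "a (Suc n) / lam ^ Suc (Suc n) \<le> a n / lam ^ Suc n"
      using lam_pos by (simp add: field_simps)
  qed
  then obtain c where c: "(\<lambda>n. a n / lam ^ Suc n) \<longlonglongrightarrow> c"
    by (rule decseq_convergent[of _ 1]) (use low in auto)
  moreover have "1 \<le> c" by (rule tendsto_lowerbound[OF c]) (use low in auto)
  ultimately show thesis using that lam_pos by blast
qed

context compact_abelian_group
begin

text \<open>The exponent is shifted: \<open>conv_power k n\<close> is the convolution of
  \<open>n + 1\<close> copies of \<open>k\<close>, since in general there is no continuous
  convolution unit to start from.\<close>

fun conv_power :: "('g \<Rightarrow> complex) \<Rightarrow> nat \<Rightarrow> 'g \<Rightarrow> complex" where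
  "conv_power k 0 = k"
| "conv_power k (Suc n) = k \<odot> conv_power k n"

lemma cont_conv_power: "cont k \<Longrightarrow> cont (conv_power k n)"
  by (induction n) (auto intro: cont_conv)

lemma star_conv_power: "\<lbrakk>cont k; star k = k\<rbrakk> \<Longrightarrow> star (conv_power k n) = conv_power k n"
  by (induction n) (auto simp: star_conv cont_conv_power)

lemma conv_power_add: "cont k \<Longrightarrow> conv_power k i \<odot> conv_power k j = conv_power k (Suc (i + j))"
  by (induction i) (auto simp: conv_assoc cont_conv_power)

lemma conv_uniform_limit:
  assumes f: "cont f" and E: "\<And>n. cont (E n)" and lim: "uniform_limit UNIV E e sequentially"
  shows "(\<lambda>n. (f \<odot> E n) x) \<longlonglongrightarrow> (f \<odot> e) x"
proof -
  have e: "cont e" by (rule uniform_limit_theorem[OF _ lim]) (use E in auto)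
  obtain B where B: "\<And>x. cmod (f x) \<le> B" using cont_bounded[OF f] by blast
  then have B0: "0 \<le> B" using norm_ge_zero order_trans by blast
  show ?thesis
  proof (rule LIMSEQ_I)
    fix \<epsilon> :: real assume \<epsilon>: "0 < \<epsilon>"
    then have "0 < \<epsilon> / (B + 1)" using B0 by simp
    then obtain N where N: "\<And>n x. N \<le> n \<Longrightarrow> dist (E n x) (e x) < \<epsilon> / (B + 1)"
      using lim unfolding uniform_limit_iff eventually_sequentially by blast
    have "cmod ((f \<odot> E n) x - (f \<odot> e) x) < \<epsilon>" if n: "N \<le> n" for n
    proof -
      have "cmod ((f \<odot> E n) x - (f \<odot> e) x) \<le> B * (\<epsilon> / (B + 1))"
        unfolding convolution_def
      proof (rule integral_diff_le[OF cont_conv_integrand[OF f E] cont_conv_integrand[OF f e]])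
        fix y
        show "cmod (f y * E n (x - y) - f y * e (x - y)) \<le> B * (\<epsilon> / (B + 1))"
          unfolding right_diff_distrib[symmetric] norm_mult
          by (intro mult_mono B B0 norm_ge_zero) (use N[OF n, of "x - y"] in \<open>simp add: dist_norm\<close>)
      qed
      also have "\<dots> < \<epsilon>" using B0 \<epsilon> by (simp add: field_simps)
      finally show ?thesis .
    qed
    then show "\<exists>no. \<forall>n\<ge>no. norm ((f \<odot> E n) x - (f \<odot> e) x) < \<epsilon>" by blast
  qed
qed

definition projection :: "('g \<Rightarrow> complex) \<Rightarrow> bool" where
  "projection e \<longleftrightarrow> cont e \<and> star e = e \<and> e \<odot> e = e"

lemma projectionD: assumes "projection e" shows "cont e" "star e = e" "e \<odot> e = e"
  using assms by (auto simp: projection_def)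

lemma projection_zero: "projection e \<Longrightarrow> e 0 = complex_of_real (norm2 e)"
  using conv_star_zero[of e] by (simp add: projection_def)

lemma projection_bound: assumes "projection e" shows "cmod (e x) \<le> norm2 e"
proof -
  have "(cmod (e x))\<^sup>2 \<le> (norm2 e)\<^sup>2"
    using conv_bound[of e e x] assms by (simp add: projection_def power2_eq_square)
  then show ?thesis using norm2_nonneg by (rule power2_le_imp_le)
qed

text \<open>A projection is bounded by its own \<open>norm2\<close>, so \<open>norm2 e\<close> is at
  most its square, and it is positive.\<close>

lemma projection_norm_ge_1: assumes "projection e" "e \<noteq> (\<lambda>x. 0)" shows "1 \<le> norm2 e"
proof -
  have "norm2 e \<le> (norm2 e)\<^sup>2"
    by (rule norm2_le[OF projectionD(1)[OF assms(1)] projection_bound[OF assms(1)]])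
  moreover have "0 < norm2 e"
    using norm2_eq_0[OF projectionD(1)[OF assms(1)]] norm2_nonneg[of e] assms(2) by linarith
  ultimately show ?thesis by (simp add: power2_eq_square)
qed

text \<open>The difference of \<open>e\<close> and \<open>d\<close> is again a nonzero projection,
  and \<open>norm2\<close> is additive here because for projections it is the value at 0.\<close>

lemma subprojection_norm:
  assumes e: "projection e" and d: "projection d" and ed: "e \<odot> d = d" and ne: "d \<noteq> e"
  shows "norm2 d \<le> norm2 e - 1"
proof -
  note c = projectionD(1)[OF e] projectionD(1)[OF d]
  define q where "q = (\<lambda>x. e x - d x)"
  have cq: "cont q" unfolding q_def by (intro continuous_intros c)
  have "q \<odot> q = (\<lambda>x. (e \<odot> q) x - (d \<odot> q) x)"
    using conv_linear(5)[OF cq c] by (simp only: q_def)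
  also have "e \<odot> q = (\<lambda>x. e x - d x)"
    unfolding q_def using conv_linear(2)[OF c(1) c] by (simp only: ed projectionD(3)[OF e])
  also have "d \<odot> q = (\<lambda>x. d x - d x)"
    unfolding q_def using conv_linear(2)[OF c(2) c] ed
    by (simp only: conv_commute[OF c(2) c(1)] projectionD(3)[OF d])
  finally have "q \<odot> q = q" by (simp add: q_def)
  moreover have "star q x = q x" for x
    using projectionD(2)[OF e] projectionD(2)[OF d] by (simp add: q_def star_def fun_eq_iff)
  ultimately have q: "projection q" using cq by (auto simp: projection_def)
  moreover have "q \<noteq> (\<lambda>x. 0)"
  proof
    assume "q = (\<lambda>x. 0)"
    then have "d = e" by (simp add: q_def fun_eq_iff)
    with ne show False by simp
  qed
  ultimately have "1 \<le> norm2 q" by (rule projection_norm_ge_1)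
  moreover have "norm2 q = norm2 e - norm2 d"
  proof -
    have "complex_of_real (norm2 q) = complex_of_real (norm2 e - norm2 d)"
      using projection_zero[OF q] projection_zero[OF e] projection_zero[OF d] by (simp add: q_def)
    then show ?thesis by (simp only: of_real_eq_iff)
  qed
  ultimately show ?thesis by simp
qed

text \<open>
  The normalised even powers of a hermitian \<^term>\<open>k\<close> converge to the projection onto the
  eigenspaces of largest modulus of convolution with \<^term>\<open>k\<close>.
\<close>

lemma spectral_projection:
  assumes k: "cont k" and herm: "star k = k" and nz: "k \<noteq> (\<lambda>x. 0)"
  obtains e lam where "projection e" "e \<noteq> (\<lambda>x. 0)" "0 < lam"
    "k \<odot> k \<odot> e = (\<lambda>x. complex_of_real lam * e x)"
proof -
  define a where "a n = norm2 (conv_power k n)" for n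
  \<comment> \<open>The power with exponent \<open>2 * n + 2\<close>, the square of the hermitian
    \<open>conv_power k n\<close>; hence its value at 0 is \<open>a n\<close>.\<close>
  define Q where "Q n = conv_power k (Suc (n + n))" for n
  note cp = cont_conv_power[OF k]
  have cQ: "cont (Q n)" for n by (simp only: Q_def cp)
  have QQ: "Q i \<odot> Q j = Q (Suc (i + j))" for i j
    by (simp add: Q_def conv_power_add[OF k] add_ac del: conv_power.simps)
  have aQ: "Q n 0 = complex_of_real (a n)" for n
    using conv_star_zero[of "conv_power k n"]
    by (simp add: a_def Q_def star_conv_power[OF k herm] conv_power_add[OF k] del: conv_power.simps)
  \<comment> \<open>Write \<open>Q (Suc n)\<close> as the product of the powers with exponents
    \<open>n + 1\<close> and \<open>n + 3\<close> and apply Cauchy-Schwarz at 0.\<close>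
  have convex: "(a (Suc n))\<^sup>2 \<le> a n * a (Suc (Suc n))" for n
  proof -
    have "Q (Suc n) 0 = (conv_power k n \<odot> conv_power k (Suc (Suc n))) 0"
      by (simp add: Q_def conv_power_add[OF k] add_ac del: conv_power.simps)
    then have "(a (Suc n))\<^sup>2 = (cmod ((conv_power k n \<odot> conv_power k (Suc (Suc n))) 0))\<^sup>2"
      unfolding aQ by (metis norm_of_real power2_abs)
    then show ?thesis
      using conv_bound[OF cp[of n] cp[of "Suc (Suc n)"], of 0] by (simp only: a_def[symmetric])
  qed
  have sub: "a (Suc (i + j)) \<le> a i * a j" for i j
    using norm2_conv_le[OF cp[of i] cp[of j]] by (simp only: a_def conv_power_add[OF k])
  have pos: "0 < a n" for n
  proof (induction n rule: induct_nat_012)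
    case 0
    show ?case using norm2_eq_0[OF k] norm2_nonneg[of k] nz by (auto simp: a_def less_le)
    then have "(k \<odot> k) 0 \<noteq> 0" using conv_star_zero[of k] by (simp add: herm a_def)
    then have "k \<odot> k \<noteq> (\<lambda>x. 0)" by auto
    then have "0 < norm2 (k \<odot> k)"
      using norm2_eq_0[OF cont_conv[OF k k]] norm2_nonneg[of "k \<odot> k"] by (auto simp: less_le)
    then show "0 < a (Suc 0)" by (simp add: a_def)
  next
    case (ge2 n)
    have "a (Suc (Suc n)) \<noteq> 0" using convex[of n] ge2 by auto
    then show ?case using norm2_nonneg[of "conv_power k (Suc (Suc n))"] by (simp only: a_def less_le) auto
  qed
  obtain lam c where lam: "0 < lam" and c: "1 \<le> c" "(\<lambda>n. a n / lam ^ Suc n) \<longlonglongrightarrow> c"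
    by (rule log_convex_submultiplicative_limit[of a, OF pos convex sub])
  define b where "b n = a n / lam ^ Suc n" for n
  define E where "E n x = complex_of_real (1 / lam ^ Suc n) * Q n x" for n x
  have E_fun: "E n = (\<lambda>x. complex_of_real (1 / lam ^ Suc n) * Q n x)" for n by (simp add: E_def fun_eq_iff)
  have cE: "cont (E n)" for n unfolding E_fun by (intro continuous_intros cQ)
  have EE: "E i \<odot> E j = E (Suc (i + j))" for i j
  proof -
    have "E i \<odot> E j = (\<lambda>x. complex_of_real (1 / lam ^ Suc i) * (Q i \<odot> E j) x)"
      unfolding E_fun[of i] by (rule conv_linear(6)[OF cE cQ cQ])
    moreover have "Q i \<odot> E j = (\<lambda>x. complex_of_real (1 / lam ^ Suc j) * (Q i \<odot> Q j) x)"
      unfolding E_fun[of j] by (rule conv_linear(3)[OF cQ cQ cQ])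
    moreover have "1 / lam ^ Suc i * (1 / lam ^ Suc j) = 1 / lam ^ Suc (Suc (i + j))"
      by (simp add: power_add)
    ultimately show ?thesis
      by (simp only: E_fun[of "Suc (i + j)"] QQ mult.assoc[symmetric] of_real_mult[symmetric])
  qed
  have starE: "star (E n) = E n" for n
    using star_conv_power[OF k herm, of "Suc (n + n)"] by (simp add: E_def star_def Q_def fun_eq_iff)
  have E0: "E n 0 = complex_of_real (b n)" for n by (simp add: E_def aQ b_def)
  \<comment> \<open>Splitting off the factor \<open>E 0\<close> makes \<open>conv_bound\<close>
    applicable, so it is enough that the sequence is Cauchy in L2.\<close>
  have diff: "E (Suc i) x - E (Suc j) x = (E 0 \<odot> (\<lambda>x. E i x - E j x)) x" for i j x
    by (simp add: conv_linear(2)[OF cE cE cE] EE)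
  \<comment> \<open>The squared L2 distance is a combination of values of \<open>b\<close> with
    coefficients 1, -2, 1; as \<open>b\<close> converges, it tends to 0.\<close>
  have norm_diff: "norm2 (\<lambda>x. E i x - E j x) = b (Suc (i + i)) - 2 * b (Suc (i + j)) + b (Suc (j + j))" for i j
  proof -
    let ?d = "\<lambda>x. E i x - E j x"
    have cd: "cont ?d" by (intro continuous_intros cE)
    have "star ?d = ?d" using starE[of i] starE[of j] by (simp add: star_def fun_eq_iff)
    then have "complex_of_real (norm2 ?d) = (?d \<odot> ?d) 0" using conv_star_zero[of ?d] by simp
    also have "\<dots> = (E i \<odot> ?d) 0 - (E j \<odot> ?d) 0"
      by (subst conv_linear(5)[OF cd cE cE]) simp
    also have "\<dots> = E (Suc (i + i)) 0 - 2 * E (Suc (i + j)) 0 + E (Suc (j + j)) 0"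
      by (simp add: conv_linear(2)[OF cE cE cE] EE add.commute[of j i])
    finally have "complex_of_real (norm2 ?d) = complex_of_real (b (Suc (i + i)) - 2 * b (Suc (i + j)) + b (Suc (j + j)))"
      by (simp add: E0)
    then show ?thesis by (simp only: of_real_eq_iff)
  qed
  have "uniformly_Cauchy_on UNIV E"
    unfolding uniformly_Cauchy_on_def
  proof (intro allI impI)
    fix \<epsilon> :: real assume \<epsilon>: "0 < \<epsilon>"
    define C where "C = norm2 (E 0) + 1"
    \<comment> \<open>Counted with multiplicity, four values of \<open>b\<close> enter the distance,
      each within \<open>\<delta>\<close> of \<open>c\<close>; then
      \<open>C * (4 * \<delta>) = \<epsilon>\<^sup>2\<close>. The summand 1 in \<open>C\<close>
      keeps it positive.\<close>
    define \<delta> where "\<delta> = \<epsilon>\<^sup>2 / (4 * C)"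
    have n0: "0 < C" using norm2_nonneg[of "E 0"] by (simp add: C_def)
    then have "0 < \<delta>" using \<epsilon> by (simp add: \<delta>_def)
    then obtain N where N: "\<And>n. N \<le> n \<Longrightarrow> \<bar>b n - c\<bar> < \<delta>"
      using LIMSEQ_D[OF c(2), of \<delta>] by (auto simp: b_def)
    have "dist (E m x) (E n x) < \<epsilon>" if "Suc N \<le> m" "Suc N \<le> n" for m n x
    proof -
      define i j where "i = m - 1" and "j = n - 1"
      then have ij: "m = Suc i" "n = Suc j" "N \<le> i" "N \<le> j" using that by simp_all
      have "norm2 (\<lambda>x. E i x - E j x) < 4 * \<delta>"
        using N[of "Suc (i + i)"] N[of "Suc (i + j)"] N[of "Suc (j + j)"] ij(3,4)
        unfolding norm_diff by linarith
      moreover have "(cmod (E m x - E n x))\<^sup>2 \<le> norm2 (E 0) * norm2 (\<lambda>x. E i x - E j x)"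
        unfolding ij(1,2) diff[of i x j]
        by (rule conv_bound[OF cE continuous_on_diff[OF cE cE]])
      moreover have "norm2 (E 0) * norm2 (\<lambda>x. E i x - E j x) \<le> C * norm2 (\<lambda>x. E i x - E j x)"
        using norm2_nonneg by (simp add: C_def mult_right_mono)
      moreover have "C * norm2 (\<lambda>x. E i x - E j x) < C * (4 * \<delta>)"
        using calculation(1) n0 by (rule mult_strict_left_mono)
      moreover have "C * (4 * \<delta>) = \<epsilon>\<^sup>2" using n0 by (simp add: \<delta>_def)
      ultimately have "(cmod (E m x - E n x))\<^sup>2 < \<epsilon>\<^sup>2" by linarith
      then show ?thesis using \<epsilon> by (simp add: dist_norm power2_less_imp_less)
    qed
    then show "\<exists>M. \<forall>x\<in>UNIV. \<forall>m\<ge>M. \<forall>n\<ge>M. dist (E m x) (E n x) < \<epsilon>"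
      by (intro exI[of _ "Suc N"] ballI allI impI)
  qed
  then obtain e where lim: "uniform_limit UNIV E e sequentially"
    using Cauchy_uniformly_convergent unfolding uniformly_convergent_on_def by blast
  have ce: "cont e" by (rule uniform_limit_theorem[OF _ lim]) (use cE in auto)
  have ptw: "(\<lambda>n. E n x) \<longlonglongrightarrow> e x" for x by (rule tendsto_uniform_limitI[OF lim]) simp
  \<comment> \<open>Convolving with \<open>E i\<close> only shifts the sequence, so it fixes the
    limit.\<close>
  have Ee: "E i \<odot> e = e" for i
  proof
    fix x
    have "(\<lambda>n. E (n + Suc i) x) \<longlonglongrightarrow> (E i \<odot> e) x"
      using conv_uniform_limit[OF cE cE lim, of i x] by (simp add: EE add.commute)
    then show "(E i \<odot> e) x = e x" using LIMSEQ_ignore_initial_segment[OF ptw] LIMSEQ_unique by blast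
  qed
  have "e \<odot> e = e"
  proof
    fix x
    have "(\<lambda>n. (e \<odot> E n) x) \<longlonglongrightarrow> (e \<odot> e) x" by (rule conv_uniform_limit[OF ce cE lim])
    then have "(\<lambda>n. e x) \<longlonglongrightarrow> (e \<odot> e) x" by (simp add: conv_commute[OF ce cE] Ee)
    then show "(e \<odot> e) x = e x" by (simp add: LIMSEQ_const_iff)
  qed
  moreover have "star e = e"
  proof
    fix x
    have "(\<lambda>n. star (E n) x) \<longlonglongrightarrow> star e x" unfolding star_def by (intro tendsto_intros ptw)
    then show "star e x = e x" unfolding starE using ptw LIMSEQ_unique by blast
  qed
  ultimately have "projection e" using ce by (simp add: projection_def)
  \<comment> \<open>The bound \<open>1 \<le> c\<close> keeps the limit from vanishing.\<close>
  moreover have "e 0 = complex_of_real c"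
    using ptw[of 0] tendsto_of_real[OF c(2), where 'a = complex] LIMSEQ_unique
    by (simp only: E0 b_def) blast
  then have "e \<noteq> (\<lambda>x. 0)" using c(1) by auto
  moreover have "k \<odot> k \<odot> e = (\<lambda>x. complex_of_real lam * e x)"
  proof -
    have "k \<odot> k = (\<lambda>x. complex_of_real lam * E 0 x)" using lam by (simp add: E_def Q_def fun_eq_iff)
    then have "k \<odot> k \<odot> e = (\<lambda>x. complex_of_real lam * (E 0 \<odot> e) x)"
      using conv_linear(6)[OF ce cE cE, of "complex_of_real lam" 0] by (simp only:)
    then show ?thesis by (simp only: Ee)
  qed
  ultimately show thesis using lam by (intro that)
qed

end

section \<open>Characters below projections\<close>

context compact_abelian_group
begin

text \<open>Evaluating at \<open>x = 0\<close> shows that the translation factor is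
  \<open>e y / e 0\<close>, so the normalised \<open>e\<close> is multiplicative. Its modulus is at
  most 1, as \<open>e 0 = norm2 e\<close> bounds \<open>e\<close>; the same at \<open>- x\<close>
  forces modulus 1.\<close>

lemma translation_eigenfunction_character:
  assumes e: "projection e" and nz: "e \<noteq> (\<lambda>x. 0)" and eig: "\<And>y. \<exists>c. \<forall>x. e (x + y) = c * e x"
  shows "\<exists>\<eta>\<in>dual_group. \<eta> \<odot> e = \<eta>"
proof
  note ce = projectionD(1)[OF e]
  have n: "0 < norm2 e" using projection_norm_ge_1[OF e nz] by simp
  then have e0: "e 0 \<noteq> 0" by (simp add: projection_zero[OF e])
  define \<eta> where "\<eta> = (\<lambda>x. (1 / e 0) * e x)"
  have mult: "\<eta> (x + y) = \<eta> x * \<eta> y" for x y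
  proof -
    obtain c where c: "\<And>x. e (x + y) = c * e x" using eig by blast
    then show ?thesis using c[of 0] c[of x] e0 by (simp add: \<eta>_def)
  qed
  have le: "cmod (\<eta> x) \<le> 1" for x
    using projection_bound[OF e, of x] n by (simp add: \<eta>_def projection_zero[OF e] norm_divide)
  have "cmod (\<eta> x) = 1" for x
  proof (rule antisym[OF le])
    have "\<eta> x * \<eta> (- x) = 1" using mult[of x "- x"] e0 by (simp add: \<eta>_def)
    then have "1 = cmod (\<eta> x) * cmod (\<eta> (- x))" by (metis norm_mult norm_one)
    also have "\<dots> \<le> cmod (\<eta> x) * 1" using le by (intro mult_left_mono) auto
    finally show "1 \<le> cmod (\<eta> x)" by simp
  qed
  moreover have "cont \<eta>" unfolding \<eta>_def by (intro continuous_intros ce)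
  ultimately show "\<eta> \<in> dual_group" using mult by (simp add: dual_group_def)
  show "\<eta> \<odot> e = \<eta>" unfolding \<eta>_def conv_linear(6)[OF ce ce ce] projectionD(3)[OF e] ..
qed

text \<open>
  A projection all of whose hermitian multipliers are scalar is fixed by translations up to
  scalars.  Otherwise a hermitian non-scalar \<^term>\<open>k\<close> gives a proper subprojection: if
  the spectral projections of \<^term>\<open>k\<close> and of \<open>k + e\<close> were both \<^term>\<open>e\<close>, then \<open>k\<close> would be scalar.
  The squared norm of a projection is its rank, and it drops by at least 1.
\<close>

lemma projection_character:
  assumes "projection e" "e \<noteq> (\<lambda>x. 0)"
  shows "\<exists>\<eta>\<in>dual_group. \<eta> \<odot> e = \<eta>"
proof -
  \<comment> \<open>The rank \<open>norm2 e\<close> is a real number here, so the induction runs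
    over natural upper bounds for it.\<close>
  have "\<exists>\<eta>\<in>dual_group. \<eta> \<odot> e = \<eta>"
    if "projection e" "e \<noteq> (\<lambda>x. 0)" "norm2 e \<le> real n" for n e
    using that
  proof (induction n arbitrary: e)
    case 0
    then show ?case using projection_norm_ge_1[OF 0(1,2)] by simp
  next
    case (Suc n)
    note e = Suc.prems(1)
    note ce = projectionD(1)[OF e]
    \<comment> \<open>The spectral projection \<open>d\<close> of \<open>k\<close> lies below
      \<open>e\<close>. If it is smaller, induction gives a character below \<open>d\<close> and
      thus below \<open>e\<close>; if \<open>d = e\<close>, then \<open>k \<odot> k\<close> is a
      multiple of \<open>e\<close>.\<close>
    have descend: "(\<exists>\<eta>\<in>dual_group. \<eta> \<odot> e = \<eta>) \<or> (\<exists>lam. k \<odot> k = (\<lambda>x. lam * e x))"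
      if k: "cont k" "star k = k" "k \<noteq> (\<lambda>x. 0)" and ek: "e \<odot> k = k" for k
    proof -
      obtain d lam where d: "projection d" "d \<noteq> (\<lambda>x. 0)" and lam: "0 < lam"
        and kd: "k \<odot> k \<odot> d = (\<lambda>x. complex_of_real lam * d x)"
        using spectral_projection[OF k] by blast
      note cd = projectionD(1)[OF d(1)]
      note ckk = cont_conv[OF k(1) k(1)]
      have ekk: "e \<odot> (k \<odot> k) = k \<odot> k" using conv_assoc[OF ce k(1) k(1)] ek by simp
      have "(\<lambda>x. complex_of_real lam * (e \<odot> d) x) = e \<odot> (k \<odot> k \<odot> d)"
        unfolding kd by (rule conv_linear(3)[OF ce cd cd, symmetric])
      also have "\<dots> = k \<odot> k \<odot> d" using conv_assoc[OF ce ckk cd] by (simp add: ekk)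
      finally have ed: "e \<odot> d = d" using lam unfolding kd by (simp add: fun_eq_iff)
      show ?thesis
      proof (cases "d = e")
        case True
        then have "k \<odot> k = (\<lambda>x. complex_of_real lam * e x)"
          using kd ekk conv_commute[OF ckk ce] by simp
        then show ?thesis by blast
      next
        case False
        then have "norm2 d \<le> real n" using subprojection_norm[OF e d(1) ed] Suc.prems(3) by simp
        then obtain \<eta> where \<eta>: "\<eta> \<in> dual_group" "\<eta> \<odot> d = \<eta>" using Suc.IH[OF d] by blast
        have "\<eta> \<odot> e = \<eta> \<odot> (d \<odot> e)"
          using conv_assoc[OF dual_groupD(1)[OF \<eta>(1)] cd ce] \<eta>(2) by simp
        then show ?thesis using \<eta> ed conv_commute[OF cd ce] by auto
      qed
    qed
    show ?case
    proof (cases "\<forall>y. \<exists>c. \<forall>x. e (x + y) = c * e x")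
      case True
      then show ?thesis using translation_eigenfunction_character[OF e Suc.prems(2)] by blast
    next
      case False
      then obtain y where y: "\<And>c. \<not> (\<forall>x. e (x + y) = c * e x)" by blast
      define h where "h = (\<lambda>x. e (x + y))"
      have ch: "cont h" unfolding h_def by (intro cont_compose[OF ce] continuous_intros)
      note csh = cont_star[OF ch]
      have eh: "e \<odot> h = h" unfolding h_def conv_translate projectionD(3)[OF e] ..
      have esh: "e \<odot> star h = star h"
        using star_conv[OF ce ch] by (simp add: eh projectionD(2)[OF e])
      \<comment> \<open>The hermitian parts of the translate: \<open>2 * h = k1 - \<i> * k2\<close>.
        If both were multiples of \<open>e\<close>, so would be \<open>h\<close>.\<close>
      define k1 where "k1 = (\<lambda>x. h x + star h x)"
      define k2 where "k2 = (\<lambda>x. \<i> * (h x - star h x))"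
      have c1: "cont k1" unfolding k1_def by (intro continuous_intros ch csh)
      have c2: "cont k2" unfolding k2_def by (intro continuous_intros ch csh)
      have s1: "star k1 = k1" by (simp add: k1_def star_def add.commute)
      have s2: "star k2 = k2" by (simp add: k2_def star_def fun_eq_iff algebra_simps)
      have e1: "e \<odot> k1 = k1" unfolding k1_def conv_linear(1)[OF ce ch csh] eh esh ..
      have e2: "e \<odot> k2 = k2"
      proof -
        have "cont (\<lambda>x. h x - star h x)" by (intro continuous_intros ch csh)
        from conv_linear(3)[OF ce this this] show ?thesis
          unfolding k2_def by (simp add: conv_linear(2)[OF ce ch csh] eh esh)
      qed
      have "(\<forall>c. k1 \<noteq> (\<lambda>x. c * e x)) \<or> (\<forall>c. k2 \<noteq> (\<lambda>x. c * e x))"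
      proof (rule ccontr)
        assume "\<not> ?thesis"
        then obtain a b where ab: "k1 = (\<lambda>x. a * e x)" "k2 = (\<lambda>x. b * e x)" by blast
        have "e (x + y) = (a - \<i> * b) / 2 * e x" for x
        proof -
          have "2 * h x = k1 x - \<i> * k2 x" by (simp add: k1_def k2_def algebra_simps)
          then show ?thesis by (simp add: ab h_def field_simps)
        qed
        then show False using y by blast
      qed
      then obtain k where k: "cont k" "star k = k" "e \<odot> k = k" "\<And>c. k \<noteq> (\<lambda>x. c * e x)"
        using c1 c2 s1 s2 e1 e2 by metis
      define k' where "k' = (\<lambda>x. k x + e x)"
      have ck': "cont k'" unfolding k'_def by (intro continuous_intros k ce)
      have sk': "star k' x = k' x" for x
        using k(2) projectionD(2)[OF e] by (simp add: k'_def star_def fun_eq_iff)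
      have ek': "e \<odot> k' = k'"
        unfolding k'_def conv_linear(1)[OF ce k(1) ce] k(3) projectionD(3)[OF e] ..
      have nz: "k \<noteq> (\<lambda>x. 0)" using k(4)[of 0] by simp
      have nz': "k' \<noteq> (\<lambda>x. 0)"
      proof
        assume "k' = (\<lambda>x. 0)"
        then have "k = (\<lambda>x. - 1 * e x)" by (simp add: k'_def fun_eq_iff eq_neg_iff_add_eq_0)
        then show False using k(4) by blast
      qed
      \<comment> \<open>Adding \<open>e\<close> removes the sign ambiguity of the square:
        \<open>k' \<odot> k'\<close> is \<open>k \<odot> k\<close> plus \<open>2 * k + e\<close>. If
        both squares were multiples of \<open>e\<close>, so would be \<open>k\<close>.\<close>
      have "\<not> ((\<exists>lam. k \<odot> k = (\<lambda>x. lam * e x)) \<and> (\<exists>lam. k' \<odot> k' = (\<lambda>x. lam * e x)))"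
      proof
        assume "(\<exists>lam. k \<odot> k = (\<lambda>x. lam * e x)) \<and> (\<exists>lam. k' \<odot> k' = (\<lambda>x. lam * e x))"
        then obtain l m where l: "k \<odot> k = (\<lambda>x. l * e x)" and m: "k' \<odot> k' = (\<lambda>x. m * e x)" by blast
        have "k' \<odot> k' = (\<lambda>x. (k \<odot> k') x + (e \<odot> k') x)"
          using conv_linear(4)[OF ck' k(1) ce] by (simp only: k'_def)
        also have "k \<odot> k' = (\<lambda>x. (k \<odot> k) x + k x)"
          unfolding k'_def conv_linear(1)[OF k(1) k(1) ce] conv_commute[OF k(1) ce] k(3) ..
        finally have "(\<lambda>x. m * e x) = (\<lambda>x. l * e x + k x + k' x)" by (simp only: m l ek')
        from fun_cong[OF this] have "k x = (m - l - 1) / 2 * e x" for x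
          by (simp add: k'_def field_simps)
        then show False using k(4) by blast
      qed
      then show ?thesis
        using descend[OF k(1,2) nz k(3)] descend[OF ck' ext[OF sk'] nz' ek'] by blast
    qed
  qed
  moreover obtain n where "norm2 e \<le> real n" using real_arch_simple by blast
  ultimately show ?thesis using assms by blast
qed

section \<open>Infinitely many characters\<close>

lemma conv_character:
  assumes \<eta>: "\<eta> \<in> dual_group"
  shows "f \<odot> \<eta> = (\<lambda>x. (LINT y|M. f y * cnj (\<eta> y)) * \<eta> x)"
proof
  fix x
  have "(f \<odot> \<eta>) x = (LINT y|M. \<eta> x * (f y * cnj (\<eta> y)))"
    by (simp add: convolution_def dual_groupD(6)[OF \<eta>] mult_ac)
  then show "(f \<odot> \<eta>) x = (LINT y|M. f y * cnj (\<eta> y)) * \<eta> x"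
    by (simp add: mult.commute)
qed

text \<open>All points have the same measure, and infinitely many of them fit into total mass 1, so
  points are null. Outer regularity at 0 then gives \<open>U\<close>.\<close>

lemma small_neighbourhood:
  assumes inf: "infinite (UNIV :: 'g set)" and \<epsilon>: "0 < \<epsilon>"
  obtains U where "open U" "(0::'g) \<in> U" "measure M U < \<epsilon>"
proof -
  interpret prob_space M using haar_measureD(3)[OF haar] .
  note s = haar_measureD(1)[OF haar]
  have single: "emeasure M {x} = emeasure M {0}" for x
    using haar_measureD(4)[OF haar, of "{0}" x] by simp
  have "emeasure M {0} = 0"
  proof (rule ccontr)
    assume "emeasure M {0} \<noteq> 0"
    then have p: "0 < prob {0}" by (simp add: emeasure_eq_measure zero_less_measure_iff)
    obtain n where n: "1 / prob {0} < real n" using reals_Archimedean2 by blast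
    obtain F :: "'g set" where F: "finite F" "card F = n"
      using infinite_arbitrarily_large[OF inf] by blast
    have "prob F = (\<Sum>x\<in>F. prob {x})"
      by (rule finite_measure_eq_sum_singleton[OF F(1)]) (simp add: s)
    also have "\<dots> = real n * prob {0}"
      unfolding measure_def using F(2) by (subst single) simp
    finally have "1 < prob F" using n p by (simp add: field_simps)
    then show False using prob_le_1[of F] by simp
  qed
  moreover have "emeasure M {0} = (INF U\<in>{U. open U \<and> {0} \<subseteq> U}. emeasure M U)"
    using haar unfolding normalized_haar_measure_def by auto
  ultimately have "(INF U\<in>{U. open U \<and> {0} \<subseteq> U}. emeasure M U) < ennreal \<epsilon>" using \<epsilon> by simp
  then obtain U where "open U" "0 \<in> U" "emeasure M U < ennreal \<epsilon>"
    unfolding INF_less_iff by auto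
  then show thesis using that \<epsilon> by (simp add: emeasure_eq_measure ennreal_less_iff)
qed

theorem infinite_dual_group:
  assumes inf: "infinite (UNIV :: 'g set)"
  shows "infinite (dual_group :: ('g \<Rightarrow> complex) set)"
proof
  let ?D = "dual_group :: ('g \<Rightarrow> complex) set"
  assume fin: "finite ?D"
  interpret prob_space M using haar_measureD(3)[OF haar] .
  have "(\<lambda>x. 1) \<in> ?D" by (simp add: dual_group_def)
  then have "0 < card ?D" using fin card_gt_0_iff by blast
  then have "0 < 1 / real (card ?D)" by simp
  \<comment> \<open>Every Fourier coefficient of \<open>f\<close> is below this threshold, so the
    finite Fourier sum at 0 stays below \<open>f 0 = 1\<close>.\<close>
  then obtain U where U: "open U" "(0::'g) \<in> U" "prob U < 1 / real (card ?D)"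
    using small_neighbourhood[OF inf] by blast
  obtain u :: "'g \<Rightarrow> real" where u: "continuous_on UNIV u" "u 0 = 1" "\<And>y. y \<notin> U \<Longrightarrow> u y = 0"
    "\<And>y. 0 \<le> u y" "\<And>y. u y \<le> 1"
    using urysohn[OF U(1,2)] by metis
  have UM: "U \<in> sets M" using U(1) haar_measureD(1)[OF haar] by simp
  define f where "f x = complex_of_real (u x)" for x
  define a where "a \<eta> = (LINT y|M. f y * cnj (\<eta> y))" for \<eta>
  have cf: "cont f" unfolding f_def by (intro continuous_intros u)
  have small: "cmod (a \<eta>) < 1 / real (card ?D)" if \<eta>: "\<eta> \<in> ?D" for \<eta>
  proof -
    note c\<eta> = dual_groupD(1)[OF \<eta>]
    have "cmod (a \<eta>) \<le> (LINT y|M. cmod (f y * cnj (\<eta> y)))" unfolding a_def by simp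
    also have "\<dots> \<le> (LINT y|M. indicator U y)"
    proof (rule integral_mono)
      show "integrable M (\<lambda>y. cmod (f y * cnj (\<eta> y)))"
        by (intro cont_integrable_real continuous_intros cf c\<eta>)
      show "integrable M (indicator U :: 'g \<Rightarrow> real)" using UM by (simp add: emeasure_eq_measure)
      show "cmod (f y * cnj (\<eta> y)) \<le> indicator U y" for y
        using u(3)[of y] u(4,5)[of y] dual_groupD(2)[OF \<eta>, of y]
        by (auto simp: f_def norm_mult indicator_def)
    qed
    also have "\<dots> = prob U" using UM by simp
    finally show ?thesis using U(3) by simp
  qed
  define r where "r = (\<lambda>x. f x - (\<Sum>\<eta>\<in>?D. a \<eta> * \<eta> x))"
  have cr: "cont r" unfolding r_def by (intro continuous_intros cf dual_groupD(1))
  have "r 0 \<noteq> 0"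
  proof
    assume "r 0 = 0"
    then have "1 = cmod (\<Sum>\<eta>\<in>?D. a \<eta> * \<eta> 0)" by (simp add: r_def f_def u(2))
    also have "\<dots> \<le> (\<Sum>\<eta>\<in>?D. cmod (a \<eta> * \<eta> 0))" by (rule norm_sum)
    also have "\<dots> < (\<Sum>\<eta>\<in>?D. 1 / real (card ?D))"
      using fin \<open>(\<lambda>x. 1) \<in> ?D\<close> small
      by (intro sum_strict_mono) (auto simp: norm_mult dual_groupD)
    also have "\<dots> = 1" using \<open>0 < card ?D\<close> by simp
    finally show False by simp
  qed
  then have "norm2 r \<noteq> 0" using norm2_eq_0[OF cr] by auto
  \<comment> \<open>This makes \<open>r\<close> hermitian without losing what matters:
    \<open>k\<close> still annihilates every character, and its value at 0 is
    \<open>norm2 r\<close>.\<close>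
  define k where "k = r \<odot> star r"
  have ck: "cont k" unfolding k_def by (intro cont_conv cont_star cr)
  have sk: "star k = k"
    using star_conv[OF cr cont_star[OF cr]] conv_commute[OF cr cont_star[OF cr]] by (simp add: k_def star_star)
  have "k 0 \<noteq> 0" using \<open>norm2 r \<noteq> 0\<close> by (simp add: k_def conv_star_zero)
  then have "k \<noteq> (\<lambda>x. 0)" by auto
  then obtain e lam where e: "projection e" "e \<noteq> (\<lambda>x. 0)" and lam: "0 < lam"
    and ke: "k \<odot> k \<odot> e = (\<lambda>x. complex_of_real lam * e x)"
    using spectral_projection[OF ck sk] by blast
  note ce = projectionD(1)[OF e(1)]
  obtain \<psi> where \<psi>: "\<psi> \<in> ?D" "\<psi> \<odot> e = \<psi>" using projection_character[OF e] by blast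
  note c\<psi> = dual_groupD(1)[OF \<psi>(1)]
  have "(LINT y|M. r y * cnj (\<psi> y)) = 0"
  proof -
    have int: "integrable M (\<lambda>y. f y * cnj (\<psi> y))" "integrable M (\<lambda>y. a \<eta> * \<eta> y * cnj (\<psi> y))"
      if "\<eta> \<in> ?D" for \<eta>
      by (intro cont_integrable continuous_intros cf c\<psi> dual_groupD(1)[OF that])+
    have "(LINT y|M. r y * cnj (\<psi> y)) = (LINT y|M. f y * cnj (\<psi> y) - (\<Sum>\<eta>\<in>?D. a \<eta> * \<eta> y * cnj (\<psi> y)))"
      by (simp add: r_def left_diff_distrib sum_distrib_right)
    also have "\<dots> = a \<psi> - (\<Sum>\<eta>\<in>?D. LINT y|M. a \<eta> * \<eta> y * cnj (\<psi> y))"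
      using int \<psi>(1) by (subst Bochner_Integration.integral_diff) (auto simp: a_def)
    also have "(\<Sum>\<eta>\<in>?D. LINT y|M. a \<eta> * \<eta> y * cnj (\<psi> y)) = (\<Sum>\<eta>\<in>?D. if \<eta> = \<psi> then a \<psi> else 0)"
      using character_orthogonality[OF haar _ \<psi>(1)] by (intro sum.cong) (auto simp: mult.assoc)
    also have "\<dots> = a \<psi>" using fin \<psi>(1) by simp
    finally show ?thesis by simp
  qed
  then have r0: "r \<odot> \<psi> = (\<lambda>x. 0)" by (simp add: conv_character[OF \<psi>(1)])
  have zero: "g \<odot> (\<lambda>x. 0) = (\<lambda>x. 0)" for g by (simp add: convolution_def)
  have "k \<odot> \<psi> = star r \<odot> (r \<odot> \<psi>)"
    using conv_commute[OF cr cont_star[OF cr]] conv_assoc[OF cont_star[OF cr] cr c\<psi>] by (simp add: k_def)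
  then have k0: "k \<odot> \<psi> = (\<lambda>x. 0)" by (simp add: r0 zero)
  \<comment> \<open>Since \<open>\<psi>\<close> lies below \<open>e\<close>, the square of
    \<open>k\<close> acts on it as \<open>lam\<close>; yet \<open>k\<close> annihilates it.\<close>
  have "(\<lambda>x. complex_of_real lam * \<psi> x) = \<psi> \<odot> (k \<odot> k \<odot> e)"
    unfolding ke conv_linear(3)[OF c\<psi> ce ce] \<psi>(2) ..
  also have "\<dots> = k \<odot> k \<odot> e \<odot> \<psi>" by (rule conv_commute) (intro c\<psi> cont_conv ck ce)+
  also have "\<dots> = k \<odot> (e \<odot> (k \<odot> \<psi>))"
    by (simp add: conv_assoc conv_commute[OF ck ce] cont_conv ck ce c\<psi>)
  also have "\<dots> = (\<lambda>x. 0)" by (simp add: k0 zero)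
  finally have "complex_of_real lam * \<psi> 0 = 0" by (rule fun_cong)
  then show False using lam dual_groupD(4)[OF \<psi>(1)] by simp
qed

end

section \<open>The Feichtinger algebra maps onto a sequence algebra\<close>

text \<open>The coefficients are given by Fourier integrals, which avoids choosing an expansion.
  Restriction to the range of \<open>\<gamma>\<close> does not increase the norm, and extension by 0
  gives surjectivity.\<close>

lemma l1_image_feichtinger:
  fixes M :: "'g::topological_ab_group_add measure" and \<gamma> :: "'i \<Rightarrow> 'g \<Rightarrow> complex"
  assumes M: "normalized_haar_measure M" and inj: "inj \<gamma>" and \<gamma>: "range \<gamma> \<subseteq> dual_group"
  shows "l1_image (feichtinger_algebra M) (\<lambda>f i. LINT x|M. f x * cnj (\<gamma> i x))"
proof -
  let ?G = "dual_group :: ('g \<Rightarrow> complex) set"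
  let ?c = "\<lambda>(f :: 'g \<Rightarrow> complex) i. LINT x|M. f x * cnj (\<gamma> i x)"
  interpret complex_banach_algebra "feichtinger_algebra M"
    by (rule feichtinger_algebra_is_banach_algebra[OF M])
  have coef: "?c f i = c (\<gamma> i)" if "character_expansion c f" for c f i
    using character_expansion_coefficient[OF M that] \<gamma> by blast
  have S: "carrier (feichtinger_algebra M) = {f. \<exists>c. character_expansion c f}"
    "vadd (feichtinger_algebra M) f g = (\<lambda>x. f x + g x)"
    "vscale (feichtinger_algebra M) r f = (\<lambda>x. r * f x)"
    "vnorm (feichtinger_algebra M) f = feichtinger_norm f"
    "vmult (feichtinger_algebra M) f g = convolution M f g" for f g r
    by (simp_all add: feichtinger_algebra_def)
  have reindex: "(\<lambda>\<eta>. cmod (c \<eta>)) summable_on range \<gamma> \<longleftrightarrow> l1 (\<lambda>i. c (\<gamma> i))"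
    "(\<Sum>\<^sub>\<infinity>\<eta>\<in>range \<gamma>. cmod (c \<eta>)) = l1_norm (\<lambda>i. c (\<gamma> i))" for c
    using summable_on_reindex[OF inj, of "\<lambda>\<eta>. cmod (c \<eta>)"] infsum_reindex[OF inj, of "\<lambda>\<eta>. cmod (c \<eta>)"]
    by (simp_all add: l1_def l1_norm_def o_def)
  show ?thesis
  proof (unfold_locales, unfold S)
    fix f g :: "'g \<Rightarrow> complex" and r
    assume "f \<in> {f. \<exists>c. character_expansion c f}"
    then obtain c where c: "character_expansion c f" by blast
    have cs: "(\<lambda>\<eta>. cmod (c \<eta>)) summable_on ?G" using c by (simp add: character_expansion_def)
    have cs': "(\<lambda>\<eta>. cmod (c \<eta>)) summable_on range \<gamma>" by (rule summable_on_subset_banach[OF cs \<gamma>])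
    show "l1 (?c f)" using cs' by (simp add: coef[OF c] reindex)
    show "l1_norm (?c f) \<le> feichtinger_norm f"
    proof -
      have "(\<Sum>\<^sub>\<infinity>\<eta>\<in>range \<gamma>. cmod (c \<eta>)) \<le> (\<Sum>\<^sub>\<infinity>\<eta>\<in>?G. cmod (c \<eta>))"
        by (rule infsum_mono_neutral[OF cs' cs]) (use \<gamma> in auto)
      then show ?thesis by (simp add: coef[OF c] reindex feichtinger_norm_eq[OF M c])
    qed
    show "?c (\<lambda>x. r * f x) = (\<lambda>i. r * ?c f i)"
      by (simp only: coef[OF character_expansion_scale[OF c]] coef[OF c])
    assume "g \<in> {f. \<exists>c. character_expansion c f}"
    then obtain d where d: "character_expansion d g" by blast
    show "?c (\<lambda>x. f x + g x) = (\<lambda>i. ?c f i + ?c g i)"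
      by (simp only: coef[OF character_expansion_add(1)[OF c d]] coef[OF c] coef[OF d])
    show "?c (convolution M f g) = (\<lambda>i. ?c f i * ?c g i)"
      by (simp only: coef[OF character_expansion_convolution(1)[OF M c d]] coef[OF c] coef[OF d])
  next
    fix c :: "'i \<Rightarrow> complex" assume c: "l1 c"
    define d where "d \<eta> = (if \<eta> \<in> range \<gamma> then c (inv \<gamma> \<eta>) else 0)" for \<eta>
    have d\<gamma>: "d (\<gamma> i) = c i" for i using inj by (simp add: d_def)
    have "(\<lambda>\<eta>. cmod (d \<eta>)) summable_on range \<gamma>" using c by (simp add: reindex d\<gamma>)
    then have s: "(\<lambda>\<eta>. cmod (d \<eta>)) summable_on ?G"
      by (rule summable_on_cong_neutral[THEN iffD1, rotated 3]) (use \<gamma> in \<open>auto simp: d_def\<close>)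
    have "(\<lambda>\<eta>. d \<eta> * \<eta> x) summable_on ?G" for x
      by (rule abs_summable_summable, rule summable_on_comparison_test[OF s])
        (auto simp: Real_Vector_Spaces.norm_mult dual_groupD(2))
    then have "character_expansion d (\<lambda>x. \<Sum>\<^sub>\<infinity>\<eta>\<in>?G. d \<eta> * \<eta> x)"
      using s by (simp add: character_expansion_def)
    then show "\<exists>f\<in>{f. \<exists>c. character_expansion c f}. ?c f = c"
      using coef d\<gamma> by (intro bexI[of _ "\<lambda>x. \<Sum>\<^sub>\<infinity>\<eta>\<in>?G. d \<eta> * \<eta> x"]) auto
  qed
qed

text \<open>Enumerate the disjoint union of blocks of sizes \<open>4 ^ k\<close> by the natural
  numbers; the level is the first component.\<close>

lemma level_function: "\<exists>lev :: nat \<Rightarrow> nat. \<forall>k. card {i. lev i = k} = 4 ^ k"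
proof -
  define S where "S = (SIGMA k:UNIV :: nat set. {..<4 ^ k :: nat})"
  have inf: "infinite S"
  proof
    assume "finite S"
    then have "finite (fst ` S)" by simp
    moreover have "k \<in> fst ` S" for k
      by (rule image_eqI[of _ _ "(k, 0)"]) (simp_all add: S_def)
    then have "fst ` S = UNIV" by blast
    ultimately show False by simp
  qed
  define h where "h = from_nat_into S"
  have h: "bij_betw h UNIV S" unfolding h_def by (rule bij_betw_from_nat_into[OF _ inf]) simp
  show ?thesis
  proof (intro exI allI)
    fix k
    have "h ` {i. fst (h i) = k} = {k} \<times> {..<4 ^ k}"
    proof
      show "h ` {i. fst (h i) = k} \<subseteq> {k} \<times> {..<4 ^ k}"
      proof
        fix p assume "p \<in> h ` {i. fst (h i) = k}"
        then obtain i where i: "p = h i" "fst (h i) = k" by blast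
        have "h i \<in> S" using bij_betw_imp_surj_on[OF h] by blast
        then show "p \<in> {k} \<times> {..<4 ^ k}" using i by (auto simp: S_def)
      qed
      have "p \<in> h ` {i. fst (h i) = k}" if "p \<in> {k} \<times> {..<4 ^ k}" for p
      proof -
        have "p \<in> range h" using that bij_betw_imp_surj_on[OF h] by (auto simp: S_def)
        then obtain i where "p = h i" by blast
        with that show ?thesis by (intro image_eqI[of _ _ i]) (auto simp: mem_Times_iff)
      qed
      then show "{k} \<times> {..<4 ^ k} \<subseteq> h ` {i. fst (h i) = k}" by blast
    qed
    moreover have "inj_on h {i. fst (h i) = k}"
      using bij_betw_imp_inj_on[OF h] by (rule inj_on_subset) simp
    ultimately have "card {i. fst (h i) = k} = card ({k} \<times> {..<4 ^ k :: nat})"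
      by (metis card_image)
    then show "card {i. fst (h i) = k} = 4 ^ k" by simp
  qed
qed

theorem proposition5p1:
  fixes M :: "'g::{topological_ab_group_add, t2_space} measure"
  assumes "compact (UNIV :: 'g set)"
    and "infinite (UNIV :: 'g set)"
    and "normalized_haar_measure M"
  shows "\<not> approximately_amenable (feichtinger_algebra M)"
proof
  assume am: "approximately_amenable (feichtinger_algebra M)"
  interpret compact_abelian_group M by unfold_locales (fact assms)+
  obtain \<gamma> :: "nat \<Rightarrow> 'g \<Rightarrow> complex" where "inj \<gamma>" "range \<gamma> \<subseteq> dual_group"
    using infinite_countable_subset[OF infinite_dual_group[OF assms(2)]] by blast
  then interpret F: l1_image "feichtinger_algebra M" "\<lambda>f i. LINT x|M. f x * cnj (\<gamma> i x)"
    by (rule l1_image_feichtinger[OF assms(3)])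
  obtain lev :: "nat \<Rightarrow> nat" where "\<And>k. card {i. lev i = k} = 4 ^ k" using level_function by blast
  then have "\<not> approximately_amenable_in TYPE(nat bmatrix) (feichtinger_algebra M)"
    by (rule F.not_approximately_amenable)
  moreover have "approximately_amenable_in TYPE(nat bmatrix) (feichtinger_algebra M)"
  proof (rule approximately_amenable_in_mono)
    \<comment> \<open>The type of bimodule points in \<open>approximately_amenable\<close> consists
      of functions on pairs of elements of the algebra's type. The countable index set of the
      matrices is coded by constant functions.\<close>
    define j :: "nat option \<times> nat option \<Rightarrow> ('g \<Rightarrow> complex) \<times> ('g \<Rightarrow> complex)"
      where "j p = ((\<lambda>_. of_nat (to_nat p)), (\<lambda>_. 0))" for p
    have "inj j" by (rule injI) (simp add: j_def fun_eq_iff)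
    \<comment> \<open>Composing with \<open>j\<close> recovers \<open>x\<close>.\<close>
    then show "inj (\<lambda>x. x \<circ> inv j)"
      by (intro injI) (metis comp_assoc comp_id inv_o_cancel)
    show "approximately_amenable_in TYPE(('g \<Rightarrow> complex) \<times> ('g \<Rightarrow> complex) \<Rightarrow> complex) (feichtinger_algebra M)"
      using am by (simp add: approximately_amenable_def)
  qed
  ultimately show False by simp
qed

end
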